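(* Let $k$ be a field of characteristic zero, $A$ an associative unital $k$-algebra and $V$ a nonzero finite-dimensional $k$-vector space. The images of the algebra homomorphisms $$\boldsymbol\Lambda\mathrm{Tr}_V(A)_\bullet:\ \boldsymbol\Lambda[\mathrm{HC}(A)]\to\mathrm H_\bullet(A,V)\qquad\text{and}\qquad\overline{\mathrm{Tr}}_V(A)_\bullet:\ \mathrm{Sym}(\mathrm{HC}_0(A))\otimes\boldsymbol\Lambda(\overline{\mathrm{HC}}_{\ge1}(A))\to\mathrm H_\bullet(A,V)$$ are contained in $\mathrm H_\bullet(A,V)^{\mathrm{GL}(V)}$.
   Context: Differentials have degree $-1$. $\boldsymbol\Lambda(W)$ is the graded symmetric algebra of a graded vector space $W$. Let $R\to A$ be a cofibrant resolution of $A$ in the category of DG $k$-algebras, which may be taken almost free (a surjective quasi-isomorphism from a non-negatively graded DG algebra that is free as a graded algebra). $R_V$ is the commutative DG algebra with $\mathrm{Hom}(R_V,C)\cong\mathrm{Hom}(R,\mathrm{End}\,V\otimes C)$ for all commutative DG algebras $C$; $\mathrm H_\bullet(A,V):=\mathrm H_\bullet(R_V)$, with $\mathrm H_0(A,V)\cong A_V$. The conjugation action $\alpha\mapsto g^{-1}\alpha g$ of $\mathrm{GL}(V)$ on $\mathrm{End}\,V$ induces, via this adjunction, a left action of $\mathrm{GL}(V)$ on $R_V$ by DG algebra automorphisms and hence on $\mathrm H_\bullet(A,V)$. $\mathrm{HC}_\bullet(A)$ is the homology of Connes' complex $\mathrm{CC}_n(A)=A^{\otimes(n+1)}/\mathrm{Im}(\mathrm{Id}-t_n)$,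 $t_n(a_0,\dots,a_n)=(-1)^n(a_n,a_0,\dots,a_{n-1})$, with differential induced from the Hochschild differential; $\overline{\mathrm{HC}}_\bullet(A)$ is the homology of $\mathrm{CC}(A)/\mathrm{CC}(k)$; $\overline{\mathrm{HC}}_{\ge1}(A)=\bigoplus_{n\ge1}\overline{\mathrm{HC}}_n(A)$. Trace maps: let $\pi_V:R\to\mathrm{End}\,V\otimes R_V$ be the universal representation; the composite $(\mathrm{Tr}\otimes\mathrm{id})\circ\pi_V:R\to R_V$ kills commutators and induces $R_\natural/k\to R_V/k$, where $R_\natural=R/[R,R]$. With the canonical Feigin–Tsygan isomorphism $\overline{\mathrm{HC}}_n(A)\cong\mathrm H_n(R_\natural/k)$ and $\mathrm H_n(R_V/k)\cong\mathrm H_n(R_V)$ for $n\ge1$ (when $R_V$ is not acyclic; otherwise $\mathrm H_\bullet(A,V)=0$), this gives $\mathrm{Tr}_V(A)_n:\overline{\mathrm{HC}}_n(A)\to\mathrm H_n(A,V)$ for $n\ge1$, and by composing with $\mathrm{HC}_n(A)\to\overline{\mathrm{HC}}_n(A)$, maps $\mathrm{Tr}_V(A)_n:\mathrm{HC}_n(A)\to\mathrm H_n(A,V)$. For $n=0$, $\mathrm{Tr}_V(A)_0:\mathrm{HC}_0(A)=A/[A,A]\to A_V$ is the usual trace. $\boldsymbol\Lambda\mathrm{Tr}_V(A)_\bullet$ is the algebra homomorphism extending all $\mathrm{Tr}_V(A)_n$, $n\ge0$, on $\mathrm{HC}_\bullet(A)$, and $\overline{\mathrm{Tr}}_V(A)_\bullet$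 is the algebra homomorphism through which it factors, extending $\mathrm{Tr}_V(A)_0$ on $\mathrm{HC}_0(A)$ and $\mathrm{Tr}_V(A)_n$ on $\overline{\mathrm{HC}}_n(A)$, $n\ge1$. *)

theory Defs
  imports Complex_Main "HOL-Library.Poly_Mapping" "HOL-Library.Set_Algebras"
begin

section \<open>Linear combinations of words\<close>

text \<open>
  \<^typ>\<open>'x \<Rightarrow>\<^sub>0 'k\<close> is the vector space with basis \<^typ>\<open>'x\<close>. Words form a monoid under concatenation;
  the convolution product of \<^theory>\<open>HOL-Library.Poly_Mapping\<close> expects that monoid to be
  written additively, and then \<^typ>\<open>'g list \<Rightarrow>\<^sub>0 'k\<close> is the free associative algebra
  on \<^typ>\<open>'g\<close>.
\<close>

instantiation list :: (type) monoid_add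
begin
definition zero_list :: "'a list" where "0 = []"
definition plus_list :: "'a list \<Rightarrow> 'a list \<Rightarrow> 'a list" where "u + v = u @ v"
instance by standard (simp_all add: zero_list_def plus_list_def)
end

abbreviation basis_vec :: "'x \<Rightarrow> ('x \<Rightarrow>\<^sub>0 'k::field)" where
  "basis_vec x \<equiv> Poly_Mapping.single x 1"

definition psmul :: "'k::field \<Rightarrow> ('x \<Rightarrow>\<^sub>0 'k) \<Rightarrow> ('x \<Rightarrow>\<^sub>0 'k)" where
  "psmul c x = Poly_Mapping.map ((*) c) x"

lemma lookup_psmul: "Poly_Mapping.lookup (psmul c x) w = c * Poly_Mapping.lookup x w"
  by (simp add: psmul_def Poly_Mapping.map.rep_eq when_def)

lemma vector_space_psmul: "vector_space (psmul :: 'k::field \<Rightarrow> ('x \<Rightarrow>\<^sub>0 'k) \<Rightarrow> _)"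
  by standard (auto intro!: poly_mapping_eqI simp: lookup_psmul lookup_add algebra_simps)

interpretation psmul: vector_space "psmul :: 'k::field \<Rightarrow> ('x \<Rightarrow>\<^sub>0 'k) \<Rightarrow> _"
  by (rule vector_space_psmul)

lemma psmul_single: "psmul c (Poly_Mapping.single w a) = Poly_Mapping.single w (c * a)"
  by (rule poly_mapping_eqI) (simp add: lookup_psmul lookup_single when_def)

lemma basis_vec_Nil: "(basis_vec [] :: 'g list \<Rightarrow>\<^sub>0 'k::field) = 1"
  unfolding single_one[symmetric] zero_list_def ..

lemma psmul_basis_expansion:
  "x = (\<Sum>w\<in>Poly_Mapping.keys x. psmul (Poly_Mapping.lookup x w) (basis_vec w))"
proof -
  have "x = (\<Sum>w\<in>Poly_Mapping.keys x. Poly_Mapping.single w (Poly_Mapping.lookup x w))"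
    by (rule poly_mapping_eqI)
      (auto simp: lookup_sum lookup_single when_def in_keys_iff sum.delta' if_distrib cong: if_cong)
  then show ?thesis by (simp add: psmul_single)
qed

abbreviation pspan :: "('x \<Rightarrow>\<^sub>0 'k::field) set \<Rightarrow> ('x \<Rightarrow>\<^sub>0 'k) set" where
  "pspan \<equiv> module.span psmul"

text \<open>The linear map with prescribed values on the basis; \<open>s\<close> is the scalar multiplication
  of the target.\<close>

definition lext :: "('k::field \<Rightarrow> 'b \<Rightarrow> 'b) \<Rightarrow> ('x \<Rightarrow> 'b::ab_group_add) \<Rightarrow> ('x \<Rightarrow>\<^sub>0 'k) \<Rightarrow> 'b" where
  "lext s f x = (\<Sum>w\<in>Poly_Mapping.keys x. s (Poly_Mapping.lookup x w) (f w))"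

lemma lext_superset:
  assumes "vector_space s" "finite K" "Poly_Mapping.keys x \<subseteq> K"
  shows "lext s f x = (\<Sum>w\<in>K. s (Poly_Mapping.lookup x w) (f w))"
proof -
  interpret vector_space s by fact
  show ?thesis unfolding lext_def
    by (rule sum.mono_neutral_left) (use assms in \<open>auto simp: in_keys_iff\<close>)
qed

lemma linear_lext:
  fixes s :: "'k::field \<Rightarrow> 'b::ab_group_add \<Rightarrow> 'b" and f :: "'x \<Rightarrow> 'b"
  assumes "vector_space s"
  shows "Vector_Spaces.linear psmul s (lext s f)"
proof -
  interpret vector_space s by fact
  show ?thesis
  proof (unfold_locales)
    fix x y :: "'x \<Rightarrow>\<^sub>0 'k" and c
    let ?K = "Poly_Mapping.keys x \<union> Poly_Mapping.keys y"
    have "Poly_Mapping.keys (x + y) \<subseteq> ?K" by (rule Poly_Mapping.keys_add)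
    then show "lext s f (x + y) = lext s f x + lext s f y"
      by (simp add: lext_superset[OF assms, where K = ?K] lookup_add scale_left_distrib sum.distrib)
    have "Poly_Mapping.keys (psmul c x) \<subseteq> Poly_Mapping.keys x"
      by (auto simp: in_keys_iff lookup_psmul)
    then show "lext s f (psmul c x) = s c (lext s f x)"
      by (simp add: lext_superset[OF assms, where K = "Poly_Mapping.keys x"] lookup_psmul scale_sum_right)
  qed
qed

lemma lext_single:
  assumes "vector_space s"
  shows "lext s f (Poly_Mapping.single w a) = s a (f w)"
proof -
  interpret vector_space s by fact
  show ?thesis
    by (subst lext_superset[OF assms, where K = "{w}"]) auto
qed

text \<open>The algebra map out of the free algebra with prescribed values on the letters;
  \<open>u\<close> is the unit of the target.\<close>

definition alg_ext :: "('k::field \<Rightarrow> 'b \<Rightarrow> 'b) \<Rightarrow> 'b \<Rightarrow> ('g \<Rightarrow> 'b::ring) \<Rightarrow> ('g list \<Rightarrow>\<^sub>0 'k) \<Rightarrow> 'b" where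
  "alg_ext s u f = lext s (\<lambda>w. foldr (\<lambda>g y. f g * y) w u)"


section \<open>Complexes and homology\<close>

text \<open>
  As for relative singular homology in HOL-Homology, a quotient complex
  \<open>C / D\<close> is handled through the complex \<open>C\<close> (components \<open>ch n\<close>) and
  the subcomplex \<open>D\<close> (\<open>rel\<close>, a graded subspace): a relative cycle has boundary in \<open>D\<close>, a relative
  boundary is a boundary up to an element of \<open>D\<close>. Homology classes are cosets.
\<close>

record 'x cx =
  ch :: "nat \<Rightarrow> 'x set"
  rel :: "'x set"
  bdry :: "'x \<Rightarrow> 'x"

definition gr_sum :: "(nat \<Rightarrow> 'x::comm_monoid_add set) \<Rightarrow> 'x set" where
  "gr_sum C = {(\<Sum>n<N. x n) | N x. \<forall>n. x n \<in> C n}"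

definition boundaries :: "'x::ab_group_add cx \<Rightarrow> nat \<Rightarrow> 'x set" where
  "boundaries K n = {bdry K y + r | y r. y \<in> ch K (Suc n) \<and> r \<in> rel K \<inter> ch K n}"

definition homology :: "'x::ab_group_add cx \<Rightarrow> nat \<Rightarrow> 'x set set" where
  "homology K n = {x +o boundaries K n | x. x \<in> ch K n \<and> bdry K x \<in> rel K}"

definition induced :: "('x \<Rightarrow> 'y) \<Rightarrow> 'y::ab_group_add cx \<Rightarrow> nat \<Rightarrow> 'x set \<Rightarrow> 'y set" where
  "induced f L n X = (\<Union>x\<in>X. f x +o boundaries L n)"

text \<open>The direct sum of all \<open>homology K n\<close>, realised as all cycles modulo all boundaries.\<close>

definition boundaries_tot :: "'x::ab_group_add cx \<Rightarrow> 'x set" where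
  "boundaries_tot K = {bdry K y + r | y r. y \<in> gr_sum (ch K) \<and> r \<in> rel K}"

definition homology_tot :: "'x::ab_group_add cx \<Rightarrow> 'x set set" where
  "homology_tot K = {x +o boundaries_tot K | x. x \<in> gr_sum (ch K) \<and> bdry K x \<in> rel K}"

definition induced_tot :: "('x \<Rightarrow> 'y) \<Rightarrow> 'y::ab_group_add cx \<Rightarrow> 'x set \<Rightarrow> 'y set" where
  "induced_tot f L X = (\<Union>x\<in>X. f x +o boundaries_tot L)"

definition quasi_iso :: "('x \<Rightarrow> 'y) \<Rightarrow> 'x::ab_group_add cx \<Rightarrow> 'y::ab_group_add cx \<Rightarrow> bool" where
  "quasi_iso f K L \<longleftrightarrow> (\<forall>n. bij_betw (induced f L n) (homology K n) (homology L n))"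


section \<open>Algebras and DG algebras\<close>

text \<open>
  Algebras live on types of class \<^class>\<open>ring\<close> and the unit is a parameter, because
  \<^class>\<open>ring_1\<close> would exclude the zero algebra.
\<close>

locale unital_algebra = vector_space scale
  for scale :: "'k::field \<Rightarrow> 'a::ring \<Rightarrow> 'a" +
  fixes e :: 'a
  assumes scale_mult_left: "scale c x * y = scale c (x * y)"
    and scale_mult_right: "x * scale c y = scale c (x * y)"
    and unit_left: "e * x = x"
    and unit_right: "x * e = x"

lemma (in unital_algebra) alg_ext_mult:
  "alg_ext scale e f (x * y) = alg_ext scale e f x * alg_ext scale e f y"
proof -
  let ?F = "alg_ext scale e f"
  let ?m = "\<lambda>w. foldr (\<lambda>g y. f g * y) w e"
  have vs: "vector_space scale" by unfold_locales
  interpret F: Vector_Spaces.linear psmul scale ?F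
    unfolding alg_ext_def by (rule linear_lext[OF vs])
  have m: "foldr (\<lambda>g y. f g * y) u (?m v) = ?m u * ?m v" for u v
    by (induction u) (simp_all add: unit_left mult.assoc)
  have basis: "?F (Poly_Mapping.single u a * Poly_Mapping.single v b)
      = ?F (Poly_Mapping.single u a) * ?F (Poly_Mapping.single v b)" for u v a b
    by (simp add: mult_single plus_list_def alg_ext_def lext_single[OF vs] m
        scale_mult_left scale_mult_right mult.commute)
  have "?F (x * y) = ?F ((\<Sum>u\<in>Poly_Mapping.keys x. psmul (Poly_Mapping.lookup x u) (basis_vec u)) *
      (\<Sum>v\<in>Poly_Mapping.keys y. psmul (Poly_Mapping.lookup y v) (basis_vec v)))"
    by (simp flip: psmul_basis_expansion)
  also have "\<dots> = (\<Sum>u\<in>Poly_Mapping.keys x. \<Sum>v\<in>Poly_Mapping.keys y.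
      ?F (psmul (Poly_Mapping.lookup x u) (basis_vec u)) * ?F (psmul (Poly_Mapping.lookup y v) (basis_vec v)))"
    by (simp add: sum_product F.sum psmul_single basis)
  also have "\<dots> = ?F (\<Sum>u\<in>Poly_Mapping.keys x. psmul (Poly_Mapping.lookup x u) (basis_vec u)) *
      ?F (\<Sum>v\<in>Poly_Mapping.keys y. psmul (Poly_Mapping.lookup y v) (basis_vec v))"
    by (simp add: sum_product F.sum)
  finally show ?thesis by (simp flip: psmul_basis_expansion)
qed

record ('k, 'a) dga =
  smul :: "'k \<Rightarrow> 'a \<Rightarrow> 'a"
  unt :: 'a
  gr :: "nat \<Rightarrow> 'a set"
  dif :: "'a \<Rightarrow> 'a"

locale dg_algebra = unital_algebra "smul R" "unt R"
  for R :: "('k::field, 'a::ring) dga" +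
  assumes gr_subspace: "subspace (gr R n)"
    and gr_sum_UNIV: "gr_sum (gr R) = UNIV"
    and gr_direct: "(\<forall>i. f i \<in> gr R i) \<Longrightarrow> (\<Sum>i<N. f i) = 0 \<Longrightarrow> n < N \<Longrightarrow> f n = 0"
    and unt_gr: "unt R \<in> gr R 0"
    and mult_gr: "x \<in> gr R m \<Longrightarrow> y \<in> gr R n \<Longrightarrow> x * y \<in> gr R (m + n)"
    and dif_linear: "Vector_Spaces.linear (smul R) (smul R) (dif R)"
    and dif_gr: "x \<in> gr R (Suc n) \<Longrightarrow> dif R x \<in> gr R n"
    and dif_gr_0: "x \<in> gr R 0 \<Longrightarrow> dif R x = 0"
    and dif_dif: "dif R (dif R x) = 0"
    and dif_mult: "x \<in> gr R n \<Longrightarrow> dif R (x * y) = dif R x * y + smul R ((-1) ^ n) (x * dif R y)"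

definition graded_commutative :: "('k::field, 'a::ring) dga \<Rightarrow> bool" where
  "graded_commutative R \<longleftrightarrow>
    (\<forall>m n. \<forall>x\<in>gr R m. \<forall>y\<in>gr R n. x * y = smul R ((-1) ^ (m * n)) (y * x))"

definition dg_hom :: "('k::field, 'a::ring) dga \<Rightarrow> ('k, 'b::ring) dga \<Rightarrow> ('a \<Rightarrow> 'b) \<Rightarrow> bool" where
  "dg_hom R S f \<longleftrightarrow> Vector_Spaces.linear (smul R) (smul S) f \<and>
    (\<forall>x y. f (x * y) = f x * f y) \<and> f (unt R) = unt S \<and>
    (\<forall>n. f ` gr R n \<subseteq> gr S n) \<and> (\<forall>x. f (dif R x) = dif S (f x))"

definition in_degree_0 :: "('k::field \<Rightarrow> 'a \<Rightarrow> 'a) \<Rightarrow> 'a \<Rightarrow> ('k, 'a::ring) dga" where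
  "in_degree_0 scale e =
    \<lparr>smul = scale, unt = e, gr = (\<lambda>n. if n = 0 then UNIV else {0}), dif = (\<lambda>_. 0)\<rparr>"

definition dga_cx :: "('k, 'a::ring) dga \<Rightarrow> 'a cx" where
  "dga_cx R = \<lparr>ch = gr R, rel = {0}, bdry = dif R\<rparr>"

text \<open>Free as a graded algebra: the monomials in some set of homogeneous elements form a basis.\<close>

definition almost_free :: "('k::field, 'a::ring) dga \<Rightarrow> bool" where
  "almost_free R \<longleftrightarrow>
    (\<exists>X \<subseteq> (\<Union>n. gr R n).
       inj_on (\<lambda>w. foldr (*) w (unt R)) (lists X) \<and>
       \<not> module.dependent (smul R) ((\<lambda>w. foldr (*) w (unt R)) ` lists X) \<and>
       module.span (smul R) ((\<lambda>w. foldr (*) w (unt R)) ` lists X) = UNIV)"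

definition almost_free_resolution ::
  "('k::field, 'r::ring) dga \<Rightarrow> ('k, 'a::ring) dga \<Rightarrow> ('r \<Rightarrow> 'a) \<Rightarrow> bool" where
  "almost_free_resolution R A p \<longleftrightarrow> dg_algebra R \<and> almost_free R \<and>
    dg_hom R A p \<and> surj p \<and> quasi_iso p (dga_cx R) (dga_cx A)"


section \<open>Cyclic homology\<close>

text \<open>
  The word \<open>[(m\<^sub>0, a\<^sub>0), \<dots>, (m\<^sub>p, a\<^sub>p)]\<close> with \<open>a\<^sub>i\<close> homogeneous of degree \<open>m\<^sub>i\<close> stands for the tensor
  \<open>a\<^sub>0 \<otimes> \<dots> \<otimes> a\<^sub>p\<close>, of total degree \<open>p + m\<^sub>0 + \<dots> + m\<^sub>p\<close>. Tensor powers are spanned by such words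
  modulo multilinearity. For an algebra in degree 0 all \<open>m\<^sub>i\<close> are 0 (up to words with an entry 0),
  the Koszul signs disappear and \<open>cyclic_cx\<close> is Connes' complex; for a DG algebra it is the
  total complex of the cyclic tensor powers.
\<close>

definition wdeg :: "(nat \<times> 'b) list \<Rightarrow> nat" where
  "wdeg w = sum_list (map fst w)"

definition hom_words :: "('k, 'a) dga \<Rightarrow> (nat \<times> 'a) list set" where
  "hom_words R = lists {(m, x). x \<in> gr R m}"

definition multilin_rel :: "('k::field, 'a::ring) dga \<Rightarrow> ((nat \<times> 'a) list \<Rightarrow>\<^sub>0 'k) set" where
  "multilin_rel R =
     {basis_vec (u @ (m, x + y) # v) - basis_vec (u @ (m, x) # v) - basis_vec (u @ (m, y) # v)
       | u v m x y. u \<in> hom_words R \<and> v \<in> hom_words R \<and> x \<in> gr R m \<and> y \<in> gr R m} \<union>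
     {basis_vec (u @ (m, smul R c x) # v) - psmul c (basis_vec (u @ (m, x) # v))
       | u v m c x. u \<in> hom_words R \<and> v \<in> hom_words R \<and> x \<in> gr R m}"

definition cyclic_perm :: "(nat \<times> 'a) list \<Rightarrow> ((nat \<times> 'a) list \<Rightarrow>\<^sub>0 'k::field)" where
  "cyclic_perm w = Poly_Mapping.single (last w # butlast w)
     ((-1) ^ (length w - 1 + fst (last w) * wdeg (butlast w)))"

definition cyclic_rel :: "('k::field, 'a::ring) dga \<Rightarrow> ((nat \<times> 'a) list \<Rightarrow>\<^sub>0 'k) set" where
  "cyclic_rel R = {basis_vec w - cyclic_perm w | w. w \<in> hom_words R \<and> w \<noteq> []}"

definition hochschild_d :: "(nat \<times> 'a::ring) list \<Rightarrow> ((nat \<times> 'a) list \<Rightarrow>\<^sub>0 'k::field)" where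
  "hochschild_d w =
     (let p = length w - 1; mul = (\<lambda>(m, x) (n, y). (m + n, x * y)) in
      if p = 0 then 0 else
        (\<Sum>i<p. Poly_Mapping.single (take i w @ mul (w ! i) (w ! Suc i) # drop (i + 2) w) ((-1) ^ i)) +
        Poly_Mapping.single (mul (last w) (hd w) # butlast (tl w))
          ((-1) ^ (p + fst (last w) * wdeg (butlast w))))"

text \<open>The derivation of the free algebra extending a map \<open>\<delta>\<close> on letters; letters of degree 0 are sent
  to 0.\<close>

definition letterwise_d ::
  "(nat \<times> 'b \<Rightarrow> nat \<times> 'b) \<Rightarrow> (nat \<times> 'b) list \<Rightarrow> ((nat \<times> 'b) list \<Rightarrow>\<^sub>0 'k::field)" where
  "letterwise_d \<delta> w =
     (\<Sum>i<length w. if fst (w ! i) = 0 then 0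
        else Poly_Mapping.single (w[i := \<delta> (w ! i)]) ((-1) ^ wdeg (take i w)))"

definition cyclic_cx :: "('k::field, 'a::ring) dga \<Rightarrow> ((nat \<times> 'a) list \<Rightarrow>\<^sub>0 'k) cx" where
  "cyclic_cx R =
     \<lparr>ch = (\<lambda>n. {x. \<forall>w\<in>Poly_Mapping.keys x.
                      w \<in> hom_words R \<and> w \<noteq> [] \<and> length w - 1 + wdeg w = n}),
      rel = pspan (multilin_rel R \<union> cyclic_rel R),
      bdry = lext psmul (\<lambda>w. hochschild_d w +
        psmul ((-1) ^ (length w - 1)) (letterwise_d (\<lambda>(m, x). (m - 1, dif R x)) w))\<rparr>"

text \<open>The quotient by the image of the cyclic complex of \<open>k\<close> under the unit map.\<close>

definition reduced_cyclic_cx :: "('k::field, 'a::ring) dga \<Rightarrow> ((nat \<times> 'a) list \<Rightarrow>\<^sub>0 'k) cx" where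
  "reduced_cyclic_cx R = (cyclic_cx R)
     \<lparr>rel := pspan (multilin_rel R \<union> cyclic_rel R \<union>
        {basis_vec w | w. w \<noteq> [] \<and> w \<in> lists {(0, smul R c (unt R)) | c. True}})\<rparr>"

text \<open>\<open>R / (k + [R, R])\<close>, with graded commutators.\<close>

definition nat_cx :: "('k::field, 'a::ring) dga \<Rightarrow> 'a cx" where
  "nat_cx R =
     \<lparr>ch = gr R,
      rel = module.span (smul R) ({x * y - smul R ((-1) ^ (m * n)) (y * x)
              | m n x y. x \<in> gr R m \<and> y \<in> gr R n} \<union> {unt R}),
      bdry = dif R\<rparr>"

text \<open>
  For \<open>n \<ge> 1\<close>, the Feigin--Tsygan isomorphism from the \<open>n\<close>-th reduced cyclic homology of \<open>A\<close>
  to the \<open>n\<close>-th homology of \<open>nat_cx R\<close>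
  is induced by the quasi-isomorphisms \<open>reduced_cyclic_cx A \<leftarrow> reduced_cyclic_cx R \<rightarrow> nat_cx R\<close>.
  The first one applies the resolution \<open>p\<close> to all letters, the second one projects onto
  tensors of length 1.  By the theorem of Feigin and Tsygan there is exactly one \<open>\<beta>\<close> as below
  if the characteristic is 0 and \<open>A\<close> is not the zero algebra. (For the zero algebra, where the trace
  maps have zero target, the value is the zero class.)
\<close>

definition letters_map :: "('a \<Rightarrow> 'b) \<Rightarrow> ((nat \<times> 'a) list \<Rightarrow>\<^sub>0 'k::field) \<Rightarrow> ((nat \<times> 'b) list \<Rightarrow>\<^sub>0 'k)" where
  "letters_map f = lext psmul (\<lambda>w. basis_vec (map (apsnd f) w))"

definition length_1_part :: "('k::field, 'a::ring) dga \<Rightarrow> ((nat \<times> 'a) list \<Rightarrow>\<^sub>0 'k) \<Rightarrow> 'a" where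
  "length_1_part R = lext (smul R) (\<lambda>w. if length w = 1 then snd (hd w) else 0)"

definition feigin_tsygan_rel ::
  "('k::field, 'r::ring) dga \<Rightarrow> ('r \<Rightarrow> 'a::ring) \<Rightarrow> nat \<Rightarrow> ((nat \<times> 'a) list \<Rightarrow>\<^sub>0 'k) set \<Rightarrow> 'r set \<Rightarrow> bool" where
  "feigin_tsygan_rel R p n \<alpha> \<beta> \<longleftrightarrow>
     (\<exists>z \<in> ch (reduced_cyclic_cx R) n.
        bdry (reduced_cyclic_cx R) z \<in> rel (reduced_cyclic_cx R) \<and>
        letters_map p z \<in> \<alpha> \<and> length_1_part R z \<in> \<beta>)"

definition feigin_tsygan ::
  "('k::field, 'r::ring) dga \<Rightarrow> ('r \<Rightarrow> 'a::ring) \<Rightarrow> nat \<Rightarrow> ((nat \<times> 'a) list \<Rightarrow>\<^sub>0 'k) set \<Rightarrow> 'r set" where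
  "feigin_tsygan R p n \<alpha> =
     (if \<exists>!\<beta>. \<beta> \<in> homology (nat_cx R) n \<and> feigin_tsygan_rel R p n \<alpha> \<beta>
      then (THE \<beta>. \<beta> \<in> homology (nat_cx R) n \<and> feigin_tsygan_rel R p n \<alpha> \<beta>)
      else boundaries (nat_cx R) n)"


section \<open>Quotients of free algebras\<close>

definition ideal_gen :: "'g set \<Rightarrow> ('g list \<Rightarrow>\<^sub>0 'k::field) set \<Rightarrow> ('g list \<Rightarrow>\<^sub>0 'k) set" where
  "ideal_gen G S =
     pspan {basis_vec u * r * basis_vec v | u r v. u \<in> lists G \<and> r \<in> S \<and> v \<in> lists G}"

definition comm_rel :: "(nat \<times> 'b) set \<Rightarrow> ((nat \<times> 'b) list \<Rightarrow>\<^sub>0 'k::field) set" where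
  "comm_rel G =
     {basis_vec [g, h] - psmul ((-1) ^ (fst g * fst h)) (basis_vec [h, g]) | g h. g \<in> G \<and> h \<in> G}"


section \<open>The derived representation algebra and its action of GL(V)\<close>

text \<open>
  Let \<open>E\<close> be a basis of \<open>V\<close>. \<open>R\<^sub>V\<close> is the graded commutative algebra generated by
  the matrix entries \<open>x\<^sub>i\<^sub>j\<close> (\<open>i, j \<in> E\<close>) of the universal representation, \<open>x \<in> R\<close> homogeneous of
  degree \<open>m\<close>. The letter \<open>(m, x, i, j)\<close> stands for \<open>x\<^sub>i\<^sub>j\<close>. The universal property is
  \<open>rep_cx_universal\<close> below.
\<close>

definition rep_gens :: "('k, 'r) dga \<Rightarrow> 'v set \<Rightarrow> (nat \<times> 'r \<times> 'v \<times> 'v) set" where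
  "rep_gens R E = {(m, x, i, j). x \<in> gr R m \<and> i \<in> E \<and> j \<in> E}"

definition rep_rel ::
  "('k::field, 'r::ring) dga \<Rightarrow> 'v set \<Rightarrow> ((nat \<times> 'r \<times> 'v \<times> 'v) list \<Rightarrow>\<^sub>0 'k) set" where
  "rep_rel R E =
     {basis_vec [(m, x + y, i, j)] - basis_vec [(m, x, i, j)] - basis_vec [(m, y, i, j)]
       | m x y i j. x \<in> gr R m \<and> y \<in> gr R m \<and> i \<in> E \<and> j \<in> E} \<union>
     {basis_vec [(m, smul R c x, i, j)] - psmul c (basis_vec [(m, x, i, j)])
       | m c x i j. x \<in> gr R m \<and> i \<in> E \<and> j \<in> E} \<union>
     {basis_vec [(m + n, x * y, i, j)] - (\<Sum>l\<in>E. basis_vec [(m, x, i, l), (n, y, l, j)])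
       | m n x y i j. x \<in> gr R m \<and> y \<in> gr R n \<and> i \<in> E \<and> j \<in> E} \<union>
     {basis_vec [(0, unt R, i, j)] - (if i = j then 1 else 0) | i j. i \<in> E \<and> j \<in> E} \<union>
     comm_rel (rep_gens R E)"

definition rep_cx ::
  "('k::field, 'r::ring) dga \<Rightarrow> 'v set \<Rightarrow> ((nat \<times> 'r \<times> 'v \<times> 'v) list \<Rightarrow>\<^sub>0 'k) cx" where
  "rep_cx R E =
     \<lparr>ch = (\<lambda>n. {x. \<forall>w\<in>Poly_Mapping.keys x. w \<in> lists (rep_gens R E) \<and> wdeg w = n}),
      rel = ideal_gen (rep_gens R E) (rep_rel R E),
      bdry = lext psmul (letterwise_d (\<lambda>(m, x, i, j). (m - 1, dif R x, i, j)))\<rparr>"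

text \<open>\<open>R\<^sub>V / k\<close>\<close>

definition reduced_rep_cx ::
  "('k::field, 'r::ring) dga \<Rightarrow> 'v set \<Rightarrow> ((nat \<times> 'r \<times> 'v \<times> 'v) list \<Rightarrow>\<^sub>0 'k) cx" where
  "reduced_rep_cx R E = (rep_cx R E)\<lparr>rel := pspan (rel (rep_cx R E) \<union> {1})\<rparr>"

text \<open>A representation of \<open>R\<close> on \<open>V\<close> over \<open>C\<close>: a DG algebra map from \<open>R\<close> to \<open>End V \<otimes> C\<close>,
  written as a matrix over \<open>C\<close> with rows and columns indexed by \<open>E\<close>.\<close>

definition dg_rep ::
  "('k::field, 'r::ring) dga \<Rightarrow> 'v set \<Rightarrow> ('k, 'c::ring) dga \<Rightarrow> ('r \<Rightarrow> 'v \<Rightarrow> 'v \<Rightarrow> 'c) \<Rightarrow> bool" where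
  "dg_rep R E C \<phi> \<longleftrightarrow> (\<forall>i\<in>E. \<forall>j\<in>E.
     Vector_Spaces.linear (smul R) (smul C) (\<lambda>x. \<phi> x i j) \<and>
     (\<forall>x y. \<phi> (x * y) i j = (\<Sum>l\<in>E. \<phi> x i l * \<phi> y l j)) \<and>
     \<phi> (unt R) i j = (if i = j then unt C else 0) \<and>
     (\<forall>n. \<forall>x\<in>gr R n. \<phi> x i j \<in> gr C n) \<and>
     (\<forall>x. \<phi> (dif R x) i j = dif C (\<phi> x i j)))"

text \<open>A DG algebra map from \<open>R\<^sub>V\<close> to \<open>C\<close>: one from the free algebra that kills the relations.\<close>

definition rep_cx_hom ::
  "('k::field, 'r::ring) dga \<Rightarrow> 'v set \<Rightarrow> ('k, 'c::ring) dga \<Rightarrow>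
   (((nat \<times> 'r \<times> 'v \<times> 'v) list \<Rightarrow>\<^sub>0 'k) \<Rightarrow> 'c) \<Rightarrow> bool" where
  "rep_cx_hom R E C \<psi> \<longleftrightarrow> Vector_Spaces.linear psmul (smul C) \<psi> \<and>
     (\<forall>x y. \<psi> (x * y) = \<psi> x * \<psi> y) \<and> \<psi> 1 = unt C \<and>
     (\<forall>n. \<psi> ` ch (rep_cx R E) n \<subseteq> gr C n) \<and>
     (\<forall>x\<in>gr_sum (ch (rep_cx R E)). \<psi> (bdry (rep_cx R E) x) = dif C (\<psi> x)) \<and>
     (\<forall>x\<in>rel (rep_cx R E). \<psi> x = 0)"

lemma letterwise_d_Cons:
  "letterwise_d \<delta> (g # w) = (if fst g = 0 then 0 else basis_vec (\<delta> g # w)) +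
     psmul ((-1) ^ fst g) (basis_vec [g] * letterwise_d \<delta> w)"
proof -
  have "letterwise_d \<delta> (g # w) = (if fst g = 0 then 0 else basis_vec (\<delta> g # w)) +
     (\<Sum>i<length w. if fst (w ! i) = 0 then 0
        else Poly_Mapping.single (g # w[i := \<delta> (w ! i)]) ((-1) ^ (fst g + wdeg (take i w))))"
    unfolding letterwise_d_def length_Cons sum.lessThan_Suc_shift
    by (simp add: wdeg_def cong: if_cong)
  also have "(\<Sum>i<length w. if fst (w ! i) = 0 then 0
        else Poly_Mapping.single (g # w[i := \<delta> (w ! i)]) ((-1) ^ (fst g + wdeg (take i w)))) =
      psmul ((-1) ^ fst g) (basis_vec [g] * letterwise_d \<delta> w)"
    unfolding letterwise_d_def sum_distrib_left psmul.scale_sum_right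
    by (rule sum.cong) (simp_all add: mult_single plus_list_def psmul_single power_add)
  finally show ?thesis .
qed

lemma gr_sum_rep_cx_keys:
  assumes "x \<in> gr_sum (ch (rep_cx R E))"
  shows "Poly_Mapping.keys x \<subseteq> lists (rep_gens R E)"
proof -
  obtain N f where x: "x = (\<Sum>n<N. f n)" and f: "\<And>n. f n \<in> ch (rep_cx R E) n"
    using assms by (auto simp: gr_sum_def)
  have "Poly_Mapping.keys (f n) \<subseteq> lists (rep_gens R E)" for n
    using f[of n] by (auto simp: rep_cx_def)
  then show ?thesis
    unfolding x using Poly_Mapping.keys_sum[of f "{..<N}"] by blast
qed

lemma rep_cx_universal:
  fixes R :: "('k::field, 'r::ring) dga" and C :: "('k, 'c::ring) dga" and E :: "'v set"
  assumes C: "dg_algebra C" "graded_commutative C" and E: "finite E"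
    and \<phi>: "dg_rep R E C \<phi>"
  shows "\<exists>\<psi>. rep_cx_hom R E C \<psi> \<and>
           (\<forall>(m, x, i, j)\<in>rep_gens R E. \<psi> (basis_vec [(m, x, i, j)]) = \<phi> x i j)" (is ?ex)
    and "rep_cx_hom R E C \<psi> \<Longrightarrow> rep_cx_hom R E C \<psi>' \<Longrightarrow>
           \<forall>g\<in>rep_gens R E. \<psi> (basis_vec [g]) = \<psi>' (basis_vec [g]) \<Longrightarrow>
           x \<in> gr_sum (ch (rep_cx R E)) \<Longrightarrow> \<psi> x = \<psi>' x"
proof -
  interpret C: dg_algebra C by fact
  have vs: "vector_space (smul C)" by unfold_locales
  define h where "h = (\<lambda>(m::nat, x, i, j). \<phi> x i j)"
  define \<Psi> where "\<Psi> = alg_ext (smul C) (unt C) h"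
  interpret Psi: Vector_Spaces.linear psmul "smul C" \<Psi>
    unfolding \<Psi>_def alg_ext_def by (rule linear_lext[OF vs])
  interpret D: Vector_Spaces.linear "smul C" "smul C" "dif C" by (rule C.dif_linear)
  have mult: "\<Psi> (x * y) = \<Psi> x * \<Psi> y" for x y
    unfolding \<Psi>_def by (rule C.alg_ext_mult)
  have word: "\<Psi> (basis_vec w) = foldr (\<lambda>g y. h g * y) w (unt C)" for w
    by (simp add: \<Psi>_def alg_ext_def lext_single[OF vs])
  have one: "\<Psi> 1 = unt C"
    using word[of "[]"] by (simp add: basis_vec_Nil)
  have letter: "\<Psi> (basis_vec [g]) = h g" for g
    by (simp add: word C.unit_right)
  have h_lin: "Vector_Spaces.linear (smul R) (smul C) (\<lambda>x. \<phi> x i j)" if "i \<in> E" "j \<in> E" for i j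
    using \<phi> that unfolding dg_rep_def by blast
  have \<phi>_mult: "\<phi> (x * y) i j = (\<Sum>l\<in>E. \<phi> x i l * \<phi> y l j)" if "i \<in> E" "j \<in> E" for x y i j
    using \<phi> that unfolding dg_rep_def by blast
  have \<phi>_unt: "\<phi> (unt R) i j = (if i = j then unt C else 0)" if "i \<in> E" "j \<in> E" for i j
    using \<phi> that unfolding dg_rep_def by blast
  have \<phi>_gr: "\<phi> x i j \<in> gr C n" if "i \<in> E" "j \<in> E" "x \<in> gr R n" for x i j n
    using \<phi> that unfolding dg_rep_def by blast
  have \<phi>_dif: "\<phi> (dif R x) i j = dif C (\<phi> x i j)" if "i \<in> E" "j \<in> E" for x i j
    using \<phi> that unfolding dg_rep_def by blast
  have h_gr: "h g \<in> gr C (fst g)" if "g \<in> rep_gens R E" for g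
    using that by (auto simp: rep_gens_def h_def intro: \<phi>_gr)
  have comm: "h g * h g' = smul C ((-1) ^ (fst g * fst g')) (h g' * h g)"
    if "g \<in> rep_gens R E" "g' \<in> rep_gens R E" for g g'
    using C(2) h_gr[OF that(1)] h_gr[OF that(2)] unfolding graded_commutative_def by blast
  have relator: "\<Psi> r = 0" if "r \<in> rep_rel R E" for r
  proof -
    have "\<Psi> (basis_vec [(m, x + y, i, j)] - basis_vec [(m, x, i, j)] - basis_vec [(m, y, i, j)]) = 0"
      if "i \<in> E" "j \<in> E" for m x y i j
    proof -
      interpret l: Vector_Spaces.linear "smul R" "smul C" "\<lambda>x. \<phi> x i j" by (rule h_lin[OF that])
      show ?thesis by (simp add: Psi.diff letter h_def l.add)
    qed
    moreover have "\<Psi> (basis_vec [(m, smul R c x, i, j)] - psmul c (basis_vec [(m, x, i, j)])) = 0"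
      if "i \<in> E" "j \<in> E" for m c x i j
    proof -
      interpret l: Vector_Spaces.linear "smul R" "smul C" "\<lambda>x. \<phi> x i j" by (rule h_lin[OF that])
      show ?thesis by (simp add: Psi.diff Psi.scale letter h_def l.scale)
    qed
    moreover have "\<Psi> (basis_vec [(m + n, x * y, i, j)] -
        (\<Sum>l\<in>E. basis_vec [(m, x, i, l), (n, y, l, j)])) = 0"
      if "i \<in> E" "j \<in> E" for m n x y i j
      using that by (simp add: Psi.diff Psi.sum word h_def C.unit_right \<phi>_mult)
    moreover have "\<Psi> (basis_vec [(0, unt R, i, j)] - (if i = j then 1 else 0)) = 0"
      if "i \<in> E" "j \<in> E" for i j
      using that by (simp add: Psi.diff Psi.zero one letter h_def \<phi>_unt)
    moreover have "\<Psi> s = 0" if s_in: "s \<in> comm_rel (rep_gens R E)" for s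
    proof -
      obtain g g' where s: "s = basis_vec [g, g'] - psmul ((-1) ^ (fst g * fst g')) (basis_vec [g', g])"
        and g: "g \<in> rep_gens R E" "g' \<in> rep_gens R E"
        using s_in unfolding comm_rel_def by blast
      have "\<Psi> s = h g * h g' - smul C ((-1) ^ (fst g * fst g')) (h g' * h g)"
        unfolding s by (simp add: Psi.diff Psi.scale word C.unit_right)
      also have "\<dots> = 0" by (subst comm[OF g]) simp
      finally show ?thesis .
    qed
    ultimately show ?thesis using that unfolding rep_rel_def by blast
  qed
  have rel: "\<Psi> x = 0" if "x \<in> rel (rep_cx R E)" for x
  proof -
    have "x \<in> pspan {basis_vec u * r * basis_vec v | u r v.
        u \<in> lists (rep_gens R E) \<and> r \<in> rep_rel R E \<and> v \<in> lists (rep_gens R E)}"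
      using that by (simp add: rep_cx_def ideal_gen_def)
    then show ?thesis
      by (rule psmul.span_induct_alt) (auto simp: mult relator Psi.add Psi.scale Psi.zero)
  qed
  have word_gr: "\<Psi> (basis_vec w) \<in> gr C (wdeg w)" if "w \<in> lists (rep_gens R E)" for w
    using that
  proof induction
    case Nil then show ?case by (simp add: word wdeg_def C.unt_gr)
  next
    case (Cons g w)
    then show ?case using C.mult_gr[OF h_gr] by (simp add: word wdeg_def)
  qed
  have ch: "\<Psi> x \<in> gr C n" if "x \<in> ch (rep_cx R E) n" for x n
  proof -
    have "\<Psi> x = (\<Sum>w\<in>Poly_Mapping.keys x. smul C (Poly_Mapping.lookup x w) (\<Psi> (basis_vec w)))"
      by (subst psmul_basis_expansion[of x]) (simp only: Psi.sum Psi.scale)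
    also have "\<dots> \<in> gr C n"
    proof (intro C.subspace_sum C.gr_subspace C.subspace_scale)
      fix w assume "w \<in> Poly_Mapping.keys x"
      then have "w \<in> lists (rep_gens R E)" "wdeg w = n" using that by (auto simp: rep_cx_def)
      then show "\<Psi> (basis_vec w) \<in> gr C n" using word_gr by blast
    qed
    finally show ?thesis .
  qed
  define \<delta> where "\<delta> = (\<lambda>(m::nat, x, i::'v, j::'v). (m - 1, dif R x, i, j))"
  have h_\<delta>: "(if fst g = 0 then 0 else h (\<delta> g)) = dif C (h g)" if "g \<in> rep_gens R E" for g
  proof (cases "fst g = 0")
    case True
    then show ?thesis using h_gr[OF that] C.dif_gr_0 by simp
  next
    case False
    then show ?thesis using that by (auto simp: rep_gens_def h_def \<delta>_def \<phi>_dif)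
  qed
  have d_word: "\<Psi> (letterwise_d \<delta> w) = dif C (\<Psi> (basis_vec w))" if "w \<in> lists (rep_gens R E)" for w
    using that
  proof induction
    case Nil
    have "dif C (unt C) = 0" by (rule C.dif_gr_0[OF C.unt_gr])
    then show ?case by (simp add: letterwise_d_def word Psi.zero)
  next
    case (Cons g w)
    have cons: "\<Psi> (basis_vec (g # w)) = h g * \<Psi> (basis_vec w)" for g by (simp add: word)
    have "\<Psi> (letterwise_d \<delta> (g # w)) = (if fst g = 0 then 0 else h (\<delta> g)) * \<Psi> (basis_vec w) +
        smul C ((-1) ^ fst g) (h g * \<Psi> (letterwise_d \<delta> w))"
      by (simp add: letterwise_d_Cons Psi.add Psi.scale mult letter Psi.zero cons)
    also have "\<dots> = dif C (h g * \<Psi> (basis_vec w))"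
      using Cons by (simp add: h_\<delta> C.dif_mult[OF h_gr])
    finally show ?case by (simp add: cons)
  qed
  have bdry: "\<Psi> (bdry (rep_cx R E) x) = dif C (\<Psi> x)" if "x \<in> gr_sum (ch (rep_cx R E))" for x
  proof -
    have keys: "w \<in> lists (rep_gens R E)" if "w \<in> Poly_Mapping.keys x" for w
      using that gr_sum_rep_cx_keys[OF \<open>x \<in> gr_sum _\<close>] by (rule subsetD[rotated])
    have "\<Psi> (bdry (rep_cx R E) x) =
        (\<Sum>w\<in>Poly_Mapping.keys x. smul C (Poly_Mapping.lookup x w) (\<Psi> (letterwise_d \<delta> w)))"
      by (simp add: rep_cx_def lext_def Psi.sum Psi.scale \<delta>_def)
    also have "\<dots> = (\<Sum>w\<in>Poly_Mapping.keys x. smul C (Poly_Mapping.lookup x w) (dif C (\<Psi> (basis_vec w))))"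
      using keys by (simp add: d_word)
    also have "\<dots> = dif C (\<Psi> (\<Sum>w\<in>Poly_Mapping.keys x. psmul (Poly_Mapping.lookup x w) (basis_vec w)))"
      by (simp add: Psi.sum Psi.scale D.sum D.scale)
    finally show ?thesis by (simp flip: psmul_basis_expansion)
  qed
  have "rep_cx_hom R E C \<Psi>"
    unfolding rep_cx_hom_def
    using mult one ch bdry rel by (auto intro: Psi.linear_axioms)
  then show ?ex using letter by (auto simp: h_def)

  show "\<psi> x = \<psi>' x"
    if a: "rep_cx_hom R E C \<psi>" and b: "rep_cx_hom R E C \<psi>'"
      and eq: "\<forall>g\<in>rep_gens R E. \<psi> (basis_vec [g]) = \<psi>' (basis_vec [g])"
      and x: "x \<in> gr_sum (ch (rep_cx R E))"
  proof -
    interpret a: Vector_Spaces.linear psmul "smul C" \<psi> using a by (simp add: rep_cx_hom_def)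
    interpret b: Vector_Spaces.linear psmul "smul C" \<psi>' using b by (simp add: rep_cx_hom_def)
    have w: "\<psi> (basis_vec w) = \<psi>' (basis_vec w)" if "w \<in> lists (rep_gens R E)" for w
      using that
    proof induction
      case Nil
      show ?case using a b by (simp add: rep_cx_hom_def basis_vec_Nil)
    next
      case (Cons g w)
      have gw: "basis_vec (g # w) = basis_vec [g] * (basis_vec w :: _ \<Rightarrow>\<^sub>0 'k)"
        by (simp add: mult_single plus_list_def)
      have mult: "\<psi> (x * y) = \<psi> x * \<psi> y" for x y using a unfolding rep_cx_hom_def by blast
      have mult': "\<psi>' (x * y) = \<psi>' x * \<psi>' y" for x y using b unfolding rep_cx_hom_def by blast
      have "\<psi> (basis_vec [g]) = \<psi>' (basis_vec [g])" using eq Cons by blast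
      then show ?case unfolding gw mult mult' by (simp only: Cons)
    qed
    have "\<psi> x = (\<Sum>w\<in>Poly_Mapping.keys x. smul C (Poly_Mapping.lookup x w) (\<psi> (basis_vec w)))"
      by (subst psmul_basis_expansion[of x]) (simp only: a.sum a.scale)
    also have "\<dots> = (\<Sum>w\<in>Poly_Mapping.keys x. smul C (Poly_Mapping.lookup x w) (\<psi>' (basis_vec w)))"
      by (rule sum.cong[OF refl]) (simp only: w[OF subsetD[OF gr_sum_rep_cx_keys[OF x]]])
    also have "\<dots> = \<psi>' (\<Sum>w\<in>Poly_Mapping.keys x. psmul (Poly_Mapping.lookup x w) (basis_vec w))"
      by (simp only: b.sum b.scale)
    also have "\<dots> = \<psi>' x" by (simp only: psmul_basis_expansion[of x, symmetric])
    finally show ?thesis .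
  qed
qed

text \<open>
  The matrix of \<open>g \<in> GL(V)\<close> has entries \<open>g\<^sub>i\<^sub>j\<close>, \<open>g j = (\<Sum>i. g\<^sub>i\<^sub>j i)\<close>. The action of \<open>g\<close>
  on \<open>R\<^sub>V\<close> is the algebra map whose composite with the universal representation \<open>\<pi>\<close> is the
  representation \<open>x \<mapsto> g\<^sup>-\<^sup>1 \<pi>(x) g\<close>.
\<close>

definition general_linear :: "('k::field \<Rightarrow> 'v::ab_group_add \<Rightarrow> 'v) \<Rightarrow> ('v \<Rightarrow> 'v) set" where
  "general_linear s = {g. Vector_Spaces.linear s s g \<and> bij g}"

definition mat_entry :: "('k::field \<Rightarrow> 'v::ab_group_add \<Rightarrow> 'v) \<Rightarrow> 'v set \<Rightarrow> ('v \<Rightarrow> 'v) \<Rightarrow> 'v \<Rightarrow> 'v \<Rightarrow> 'k" where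
  "mat_entry s E g i j = module.representation s E (g j) i"

definition GL_act ::
  "('k::field \<Rightarrow> 'v::ab_group_add \<Rightarrow> 'v) \<Rightarrow> 'v set \<Rightarrow> ('v \<Rightarrow> 'v) \<Rightarrow>
   ((nat \<times> 'r \<times> 'v \<times> 'v) list \<Rightarrow>\<^sub>0 'k) \<Rightarrow> ((nat \<times> 'r \<times> 'v \<times> 'v) list \<Rightarrow>\<^sub>0 'k)" where
  "GL_act s E g = alg_ext psmul 1 (\<lambda>(m, x, i, j).
     \<Sum>a\<in>E. \<Sum>b\<in>E. psmul (mat_entry s E (inv g) i a * mat_entry s E g b j) (basis_vec [(m, x, a, b)]))"

definition GL_invariants ::
  "('k::field \<Rightarrow> 'v::ab_group_add \<Rightarrow> 'v) \<Rightarrow> 'v set \<Rightarrow> ('k, 'r::ring) dga \<Rightarrow>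
   ((nat \<times> 'r \<times> 'v \<times> 'v) list \<Rightarrow>\<^sub>0 'k) set set" where
  "GL_invariants s E R = {X \<in> homology_tot (rep_cx R E).
     \<forall>g\<in>general_linear s. induced_tot (GL_act s E g) (rep_cx R E) X = X}"


section \<open>Trace maps\<close>

definition trace_entry ::
  "'v set \<Rightarrow> nat \<Rightarrow> 'r \<Rightarrow> ((nat \<times> 'r \<times> 'v \<times> 'v) list \<Rightarrow>\<^sub>0 'k::field)" where
  "trace_entry E n x = (\<Sum>i\<in>E. basis_vec [(n, x, i, i)])"

text \<open>The usual trace from \<open>A / [A, A]\<close> to \<open>A\<^sub>V\<close>. Here \<open>A\<^sub>V\<close> is \<open>rep_cx A E\<close>, which is
  concentrated in degree 0.\<close>

definition usual_trace ::
  "('k::field, 'a::ring) dga \<Rightarrow> 'v set \<Rightarrow> ((nat \<times> 'a) list \<Rightarrow>\<^sub>0 'k) set \<Rightarrow>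
   ((nat \<times> 'a \<times> 'v \<times> 'v) list \<Rightarrow>\<^sub>0 'k) set" where
  "usual_trace A E = induced
     (lext psmul (\<lambda>w. if length w = 1 then trace_entry E (fst (hd w)) (snd (hd w)) else 0)) (rep_cx A E) 0"

text \<open>The isomorphism from \<open>H\<^sub>0(R\<^sub>V)\<close> to \<open>A\<^sub>V\<close> is induced by \<open>x\<^sub>i\<^sub>j \<mapsto> p(x)\<^sub>i\<^sub>j\<close>.\<close>

definition rep_map ::
  "('r \<Rightarrow> 'a) \<Rightarrow> ((nat \<times> 'r \<times> 'v \<times> 'v) list \<Rightarrow>\<^sub>0 'k::field) \<Rightarrow> ((nat \<times> 'a \<times> 'v \<times> 'v) list \<Rightarrow>\<^sub>0 'k)" where
  "rep_map p = lext psmul (\<lambda>w. basis_vec (map (\<lambda>(m, x, i, j). (m, p x, i, j)) w))"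

definition trace_0 ::
  "('k::field, 'r::ring) dga \<Rightarrow> ('k, 'a::ring) dga \<Rightarrow> ('r \<Rightarrow> 'a) \<Rightarrow> 'v set \<Rightarrow>
   ((nat \<times> 'a) list \<Rightarrow>\<^sub>0 'k) set \<Rightarrow> ((nat \<times> 'r \<times> 'v \<times> 'v) list \<Rightarrow>\<^sub>0 'k) set" where
  "trace_0 R A p E \<alpha> =
     the_inv_into (homology (rep_cx R E) 0) (induced (rep_map p) (rep_cx A E) 0) (usual_trace A E \<alpha>)"

text \<open>
  The trace on reduced cyclic homology in degree \<open>n \<ge> 1\<close>: the Feigin--Tsygan isomorphism, then the map
  \<open>H\<^sub>n(R\<^sub>\<natural>/k) \<rightarrow> H\<^sub>n(R\<^sub>V/k)\<close>, then the inverse of \<open>H\<^sub>n(R\<^sub>V) \<rightarrow> H\<^sub>n(R\<^sub>V/k)\<close>, which is an isomorphism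
  unless \<open>R\<^sub>V\<close> is acyclic.
\<close>

definition reduced_trace ::
  "('k::field, 'r::ring) dga \<Rightarrow> ('r \<Rightarrow> 'a::ring) \<Rightarrow> 'v set \<Rightarrow> nat \<Rightarrow>
   ((nat \<times> 'a) list \<Rightarrow>\<^sub>0 'k) set \<Rightarrow> ((nat \<times> 'r \<times> 'v \<times> 'v) list \<Rightarrow>\<^sub>0 'k) set" where
  "reduced_trace R p E n \<alpha> =
     (if \<forall>m. homology (rep_cx R E) m = {boundaries (rep_cx R E) m}
      then boundaries (rep_cx R E) n
      else the_inv_into (homology (rep_cx R E) n) (induced id (reduced_rep_cx R E) n)
             (induced (trace_entry E n) (reduced_rep_cx R E) n (feigin_tsygan R p n \<alpha>)))"

definition cyclic_trace ::
  "('k::field, 'r::ring) dga \<Rightarrow> ('k, 'a::ring) dga \<Rightarrow> ('r \<Rightarrow> 'a) \<Rightarrow> 'v set \<Rightarrow> nat \<Rightarrow>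
   ((nat \<times> 'a) list \<Rightarrow>\<^sub>0 'k) set \<Rightarrow> ((nat \<times> 'r \<times> 'v \<times> 'v) list \<Rightarrow>\<^sub>0 'k) set" where
  "cyclic_trace R A p E n \<alpha> =
     (if n = 0 then trace_0 R A p E \<alpha>
      else reduced_trace R p E n (induced id (reduced_cyclic_cx A) n \<alpha>))"


section \<open>Graded symmetric algebras and the extended trace maps\<close>

text \<open>
  \<open>gsym N K\<close> is the graded symmetric algebra of the direct sum of the \<open>homology K n\<close>, \<open>n \<in> N\<close>,
  as a set of cosets of \<open>gsym_ideal N K\<close> in the free algebra. The sum of two cosets is their
  element-wise sum.
\<close>

definition gsym_gens :: "nat set \<Rightarrow> 'x::ab_group_add cx \<Rightarrow> (nat \<times> 'x set) set" where
  "gsym_gens N K = {(n, X). n \<in> N \<and> X \<in> homology K n}"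

definition gsym_ideal ::
  "nat set \<Rightarrow> ('x \<Rightarrow>\<^sub>0 'k::field) cx \<Rightarrow> ((nat \<times> ('x \<Rightarrow>\<^sub>0 'k) set) list \<Rightarrow>\<^sub>0 'k) set" where
  "gsym_ideal N K = ideal_gen (gsym_gens N K)
     ({basis_vec [(n, X + Y)] - basis_vec [(n, X)] - basis_vec [(n, Y)]
        | n X Y. n \<in> N \<and> X \<in> homology K n \<and> Y \<in> homology K n} \<union>
      {basis_vec [(n, induced (psmul c) K n X)] - psmul c (basis_vec [(n, X)])
        | n c X. n \<in> N \<and> X \<in> homology K n} \<union>
      comm_rel (gsym_gens N K))"

definition gsym ::
  "nat set \<Rightarrow> ('x \<Rightarrow>\<^sub>0 'k::field) cx \<Rightarrow> ((nat \<times> ('x \<Rightarrow>\<^sub>0 'k) set) list \<Rightarrow>\<^sub>0 'k) set set" where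
  "gsym N K = {x +o gsym_ideal N K | x. Poly_Mapping.keys x \<subseteq> lists (gsym_gens N K)}"

text \<open>Tensor product of \<open>U\<close> and \<open>V\<close>, spaces of cosets of \<open>I\<close> and \<open>J\<close>.\<close>

definition tensor_rel ::
  "('x \<Rightarrow>\<^sub>0 'k::field) set \<Rightarrow> ('x \<Rightarrow>\<^sub>0 'k) set set \<Rightarrow> ('y \<Rightarrow>\<^sub>0 'k) set \<Rightarrow> ('y \<Rightarrow>\<^sub>0 'k) set set \<Rightarrow>
   (('x \<Rightarrow>\<^sub>0 'k) set \<times> ('y \<Rightarrow>\<^sub>0 'k) set \<Rightarrow>\<^sub>0 'k) set" where
  "tensor_rel I U J V = pspan
     ({basis_vec (a + a', b) - basis_vec (a, b) - basis_vec (a', b)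
        | a a' b. a \<in> U \<and> a' \<in> U \<and> b \<in> V} \<union>
      {basis_vec (a, b + b') - basis_vec (a, b) - basis_vec (a, b')
        | a b b'. a \<in> U \<and> b \<in> V \<and> b' \<in> V} \<union>
      {basis_vec (\<Union>x\<in>a. psmul c x +o I, b) - psmul c (basis_vec (a, b))
        | c a b. a \<in> U \<and> b \<in> V} \<union>
      {basis_vec (a, \<Union>y\<in>b. psmul c y +o J) - psmul c (basis_vec (a, b))
        | c a b. a \<in> U \<and> b \<in> V})"

definition tensor ::
  "('x \<Rightarrow>\<^sub>0 'k::field) set \<Rightarrow> ('x \<Rightarrow>\<^sub>0 'k) set set \<Rightarrow> ('y \<Rightarrow>\<^sub>0 'k) set \<Rightarrow> ('y \<Rightarrow>\<^sub>0 'k) set set \<Rightarrow>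
   (('x \<Rightarrow>\<^sub>0 'k) set \<times> ('y \<Rightarrow>\<^sub>0 'k) set \<Rightarrow>\<^sub>0 'k) set set" where
  "tensor I U J V = {x +o tensor_rel I U J V | x. Poly_Mapping.keys x \<subseteq> U \<times> V}"

text \<open>
  The algebra map out of \<open>gsym N K\<close> extending maps \<open>T n\<close> from \<open>homology K n\<close> to the homology of
  the free algebra modulo relations. It is computed on representatives: \<open>gsym_ext_rep T\<close>
  yields a cycle representing the value. The class of that cycle does not
  depend on the choices made, if the maps \<open>T n\<close> are linear.
\<close>

definition gsym_ext_rep ::
  "(nat \<Rightarrow> 'x set \<Rightarrow> ('g list \<Rightarrow>\<^sub>0 'k::field) set) \<Rightarrow>
   ((nat \<times> 'x set) list \<Rightarrow>\<^sub>0 'k) set \<Rightarrow> ('g list \<Rightarrow>\<^sub>0 'k)" where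
  "gsym_ext_rep T Q = alg_ext psmul 1 (\<lambda>(n, X). SOME z. z \<in> T n X) (SOME q. q \<in> Q)"

definition Lambda_HC where
  "Lambda_HC A = gsym UNIV (cyclic_cx A)"

definition Lambda_Tr ::
  "('k::field, 'r::ring) dga \<Rightarrow> ('k, 'a::ring) dga \<Rightarrow> ('r \<Rightarrow> 'a) \<Rightarrow> 'v set \<Rightarrow>
   ((nat \<times> ((nat \<times> 'a) list \<Rightarrow>\<^sub>0 'k) set) list \<Rightarrow>\<^sub>0 'k) set \<Rightarrow>
   ((nat \<times> 'r \<times> 'v \<times> 'v) list \<Rightarrow>\<^sub>0 'k) set" where
  "Lambda_Tr R A p E Q =
     gsym_ext_rep (cyclic_trace R A p E) Q +o boundaries_tot (rep_cx R E)"

definition Sym_tensor_Lambda where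
  "Sym_tensor_Lambda A =
     tensor (gsym_ideal {0} (cyclic_cx A)) (gsym {0} (cyclic_cx A))
            (gsym_ideal {1..} (reduced_cyclic_cx A)) (gsym {1..} (reduced_cyclic_cx A))"

definition Tr_bar ::
  "('k::field, 'r::ring) dga \<Rightarrow> ('k, 'a::ring) dga \<Rightarrow> ('r \<Rightarrow> 'a) \<Rightarrow> 'v set \<Rightarrow>
   (((nat \<times> ((nat \<times> 'a) list \<Rightarrow>\<^sub>0 'k) set) list \<Rightarrow>\<^sub>0 'k) set \<times>
    ((nat \<times> ((nat \<times> 'a) list \<Rightarrow>\<^sub>0 'k) set) list \<Rightarrow>\<^sub>0 'k) set \<Rightarrow>\<^sub>0 'k) set \<Rightarrow>
   ((nat \<times> 'r \<times> 'v \<times> 'v) list \<Rightarrow>\<^sub>0 'k) set" where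
  "Tr_bar R A p E Q =
     lext psmul (\<lambda>(a, b). gsym_ext_rep (\<lambda>_. trace_0 R A p E) a * gsym_ext_rep (reduced_trace R p E) b)
       (SOME q. q \<in> Q) +o boundaries_tot (rep_cx R E)"

end

theory Submission
  imports Defs
begin

text \<open>
  The homology of \<open>R\<^sub>V\<close> is an algebra on which \<open>GL(V)\<close> acts by algebra automorphisms, so its
  invariants form a subalgebra. Both maps of the theorem are multiplicative; hence it is enough to
  see that the generators, the elements of (reduced) cyclic homology, have invariant images. They
  have because the image is represented by a trace \<open>\<Sum>i. x\<^sub>i\<^sub>i\<close>, and \<open>tr (g\<^sup>-\<^sup>1 X g) = tr X\<close> holds
  on the nose: \<open>\<Sum>i. (g\<^sup>-\<^sup>1)\<^sub>i\<^sub>a g\<^sub>b\<^sub>i = \<delta>\<^sub>a\<^sub>b\<close> (\<open>act_trace_entry\<close>).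

  The maps are computed by choosing representatives, so the argument takes place on representatives.
  \<open>R\<^sub>V\<close> is the free algebra on the matrix entries modulo an ideal \<open>I\<close>. The differential and the
  action of \<open>g\<close> are defined on the free algebra; both preserve \<open>I\<close>, they commute, the differential
  satisfies the Leibniz rule and its square maps into \<open>I\<close> (\<open>d_I\<close>, \<open>act_I\<close>, \<open>act_d\<close>, \<open>d_mult\<close>, \<open>d_d\<close>).
  It follows that the boundaries are an ideal in the cycles, and that the cycles \<open>z\<close> with
  \<open>g z - z\<close> a boundary for all \<open>g\<close> are a subalgebra, \<open>invariant_cycles\<close>
  (\<open>invariant_cycles_mult\<close>). The class of such a cycle lies in the invariants
  (\<open>invariant_cycle_class\<close>).

  It remains to see that the trace maps take values in classes of invariant cycles. Both are defined
  by inverting an isomorphism, and a value is only determined once the map to be inverted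
  is known to be injective and to hit the element in question.

  In degree \<open>n \<ge> 1\<close> the Feigin--Tsygan isomorphism produces some class of \<open>R / (k + [R, R])\<close>. If \<open>r\<close>
  represents it, the trace of \<open>r\<close> is a cycle modulo \<open>k\<close>: the trace of a graded
  commutator lies in \<open>I\<close>, the trace of the unit is a number (\<open>trace_nat_rel\<close>). Unless \<open>R\<^sub>V\<close> is acyclic
  it is a cycle in \<open>R\<^sub>V\<close> itself, as otherwise the unit would be a boundary
  (\<open>unit_boundary_acyclic\<close>), and \<open>H\<^sub>n(R\<^sub>V) \<rightarrow> H\<^sub>n(R\<^sub>V/k)\<close> is injective because \<open>k\<close> sits in degree 0.
  So the value is the class of this trace (\<open>reduced_trace_invariant\<close>).

  In degree 0 the map to be inverted is \<open>H\<^sub>0(R\<^sub>V) \<rightarrow> A\<^sub>V\<close>. Elements of \<open>R\<close> of degree 0 with the same image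
  in \<open>A\<close> differ by a boundary, since \<open>R \<rightarrow> A\<close> is a quasi-isomorphism. Thus lifting the entries of a
  matrix from \<open>A\<close> to \<open>R\<close> in any way defines a left inverse modulo boundaries
  (\<open>entry_lift_I\<close>, \<open>entry_lift_rep_map\<close>), and the value on the class of \<open>a\<close> is the class of the trace
  of a lift of \<open>a\<close> (\<open>trace_0_invariant\<close>).
\<close>

section \<open>The free algebra on a graded set of letters\<close>

lemma basis_vec_append:
  "basis_vec (u @ v) = basis_vec u * (basis_vec v :: 'g list \<Rightarrow>\<^sub>0 'k::field)"
  by (simp add: mult_single plus_list_def)

lemma basis_vec_Cons:
  "basis_vec (g # v) = basis_vec [g] * (basis_vec v :: 'g list \<Rightarrow>\<^sub>0 'k::field)"
  by (simp add: mult_single plus_list_def)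

lemma linear_comb_in_subspace:
  fixes x :: "'x \<Rightarrow>\<^sub>0 'k::field"
  assumes "psmul.subspace U" "\<And>w. w \<in> Poly_Mapping.keys x \<Longrightarrow> basis_vec w \<in> U"
  shows "x \<in> U"
  by (subst psmul_basis_expansion) (intro psmul.subspace_sum psmul.subspace_scale assms)

lemma free_induct [case_names zero add scale word]:
  fixes x :: "'x \<Rightarrow>\<^sub>0 'k::field"
  assumes "P 0" "\<And>x y. P x \<Longrightarrow> P y \<Longrightarrow> P (x + y)" "\<And>c x. P x \<Longrightarrow> P (psmul c x)"
    and "\<And>w. w \<in> Poly_Mapping.keys x \<Longrightarrow> P (basis_vec w)"
  shows "P x"
proof -
  have "psmul.subspace {x. P x}"
    using assms(1-3) by (auto intro!: psmul.subspaceI)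
  then show ?thesis
    using linear_comb_in_subspace[of "{x. P x}" x] assms(4) by simp
qed

lemma unital_algebra_psmul:
  "unital_algebra (psmul :: 'k::field \<Rightarrow> ('g list \<Rightarrow>\<^sub>0 'k) \<Rightarrow> _) 1"
proof -
  have single: "x = (\<Sum>w\<in>Poly_Mapping.keys x. Poly_Mapping.single w (Poly_Mapping.lookup x w))"
    for x :: "'g list \<Rightarrow>\<^sub>0 'k"
    using psmul_basis_expansion[of x] by (simp add: psmul_single)
  have left: "psmul c x = Poly_Mapping.single 0 c * x" for c and x :: "'g list \<Rightarrow>\<^sub>0 'k"
    by (subst (1 2) single) (simp add: psmul.scale_sum_right sum_distrib_left psmul_single mult_single)
  have right: "x * Poly_Mapping.single 0 c = Poly_Mapping.single 0 c * x"
    for c and x :: "'g list \<Rightarrow>\<^sub>0 'k"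
    by (subst (1 2) single) (simp add: sum_distrib_left sum_distrib_right mult_single mult.commute)
  show ?thesis
  proof unfold_locales
    show "psmul c x * y = psmul c (x * y)" for c and x y :: "'g list \<Rightarrow>\<^sub>0 'k"
      by (simp add: left mult.assoc)
    show "x * psmul c y = psmul c (x * y)" for c and x y :: "'g list \<Rightarrow>\<^sub>0 'k"
      using right[of x c] by (simp add: left flip: mult.assoc)
  qed auto
qed

interpretation free: unital_algebra "psmul :: 'k::field \<Rightarrow> ('g list \<Rightarrow>\<^sub>0 'k) \<Rightarrow> _" 1
  by (rule unital_algebra_psmul)

lemmas linear_lext_psmul = linear_lext[OF vector_space_psmul]
lemmas lext_psmul_single = lext_single[OF vector_space_psmul]

lemma lext_psmul_basis: "lext psmul f (basis_vec w) = f w"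
  by (simp add: lext_psmul_single)

lemma
  shows lext_add: "lext psmul f (x + y) = lext psmul f x + lext psmul f y"
    and lext_diff: "lext psmul f (x - y) = lext psmul f x - lext psmul f y"
    and lext_scale: "lext psmul f (psmul c x) = psmul c (lext psmul f x)"
    and lext_zero: "lext psmul f 0 = 0"
    and lext_sum: "lext psmul f (sum h S) = (\<Sum>s\<in>S. lext psmul f (h s))"
proof -
  interpret f: Vector_Spaces.linear psmul psmul "lext psmul f" by (rule linear_lext_psmul)
  show "lext psmul f (x + y) = lext psmul f x + lext psmul f y" by (rule f.add)
  show "lext psmul f (x - y) = lext psmul f x - lext psmul f y" by (rule f.diff)
  show "lext psmul f (psmul c x) = psmul c (lext psmul f x)" by (rule f.scale)
  show "lext psmul f 0 = 0" by (rule f.zero)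
  show "lext psmul f (sum h S) = (\<Sum>s\<in>S. lext psmul f (h s))" by (rule f.sum)
qed

lemmas lext_simps = lext_add lext_diff lext_scale lext_zero lext_sum lext_psmul_basis

lemma lext_in_subspace:
  assumes "psmul.subspace U" "\<And>w. w \<in> Poly_Mapping.keys x \<Longrightarrow> f w \<in> U"
  shows "lext psmul f x \<in> U"
  unfolding lext_def by (intro psmul.subspace_sum psmul.subspace_scale assms)

lemma alg_ext_letter: "alg_ext psmul 1 f (basis_vec [g]) = f g"
  by (simp add: alg_ext_def lext_psmul_basis)

lemma alg_ext_one: "alg_ext psmul 1 f 1 = 1"
  by (simp add: alg_ext_def lext_psmul_basis flip: basis_vec_Nil)

lemmas alg_ext_hom = free.alg_ext_mult alg_ext_letter alg_ext_one

lemma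
  shows alg_ext_add: "alg_ext psmul u f (x + y) = alg_ext psmul u f x + alg_ext psmul u f y"
    and alg_ext_diff: "alg_ext psmul u f (x - y) = alg_ext psmul u f x - alg_ext psmul u f y"
    and alg_ext_scale: "alg_ext psmul u f (psmul c x) = psmul c (alg_ext psmul u f x)"
    and alg_ext_zero: "alg_ext psmul u f 0 = 0"
    and alg_ext_sum: "alg_ext psmul u f (sum h S) = (\<Sum>s\<in>S. alg_ext psmul u f (h s))"
  by (simp_all add: alg_ext_def lext_simps)

lemmas alg_ext_linear = alg_ext_add alg_ext_diff alg_ext_scale alg_ext_zero alg_ext_sum

text \<open>
  A letter stands for an element of a graded piece only if its degree and its entry fit together,
  so all statements about relations are confined to words over such letters.
\<close>

definition words_over :: "'g set \<Rightarrow> ('g list \<Rightarrow>\<^sub>0 'k::field) set" where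
  "words_over G = {x. Poly_Mapping.keys x \<subseteq> lists G}"

lemma subspace_keys_subset: "psmul.subspace {x :: 'x \<Rightarrow>\<^sub>0 'k::field. Poly_Mapping.keys x \<subseteq> K}"
proof (rule psmul.subspaceI)
  fix x y :: "'x \<Rightarrow>\<^sub>0 'k"
  assume "x \<in> {x. Poly_Mapping.keys x \<subseteq> K}" "y \<in> {x. Poly_Mapping.keys x \<subseteq> K}"
  then show "x + y \<in> {x. Poly_Mapping.keys x \<subseteq> K}"
    using Poly_Mapping.keys_add[of x y] by blast
qed (auto simp: in_keys_iff lookup_psmul)

lemma subspace_words_over: "psmul.subspace (words_over G)"
  unfolding words_over_def by (rule subspace_keys_subset)

lemma words_over_basis: "basis_vec w \<in> words_over G \<longleftrightarrow> w \<in> lists G"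
  by (auto simp: words_over_def)

lemma words_over_one: "1 \<in> words_over G"
  by (simp add: words_over_basis flip: basis_vec_Nil)

lemma words_over_mult:
  assumes "x \<in> words_over G" "y \<in> words_over G"
  shows "x * y \<in> words_over G"
  using assms keys_mult[of x y] unfolding words_over_def plus_list_def by fastforce

lemmas words_over_closed = words_over_one words_over_mult subspace_words_over[THEN psmul.subspace_0]
  subspace_words_over[THEN psmul.subspace_add] subspace_words_over[THEN psmul.subspace_diff]
  subspace_words_over[THEN psmul.subspace_scale] subspace_words_over[THEN psmul.subspace_sum]

text \<open>
  Applied to the homogeneous parts of degree 0 of a representation algebra, and to the algebra of
  invariant cycles.
\<close>

lemma alg_ext_in_subalgebra:
  assumes U: "psmul.subspace U" "1 \<in> U" "\<And>x y. x \<in> U \<Longrightarrow> y \<in> U \<Longrightarrow> x * y \<in> U"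
    and f: "\<And>g. g \<in> G \<Longrightarrow> f g \<in> U" and x: "x \<in> words_over G"
  shows "alg_ext psmul 1 f x \<in> U"
  unfolding alg_ext_def
proof (rule lext_in_subspace[OF U(1)])
  fix w assume "w \<in> Poly_Mapping.keys x"
  then have "w \<in> lists G" using x by (auto simp: words_over_def)
  then show "foldr (\<lambda>g y. f g * y) w 1 \<in> U"
    by induction (auto intro: U f)
qed

lemma alg_ext_words_over:
  assumes "\<And>g. g \<in> G \<Longrightarrow> f g \<in> words_over H" "x \<in> words_over G"
  shows "alg_ext psmul 1 f x \<in> words_over H"
  using subspace_words_over words_over_one words_over_mult assms by (rule alg_ext_in_subalgebra)

section \<open>Grading operators and derivations\<close>

text \<open>
  Operators that are scalar on each graded piece: the Koszul sign and the projections to the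
  pieces are treated together, because a homogeneous ideal is stable under all of them.
\<close>

definition deg_scale :: "(nat \<Rightarrow> 'k) \<Rightarrow> ((nat \<times> 'b) list \<Rightarrow>\<^sub>0 'k::field) \<Rightarrow> ((nat \<times> 'b) list \<Rightarrow>\<^sub>0 'k)" where
  "deg_scale c = lext psmul (\<lambda>w. psmul (c (wdeg w)) (basis_vec w))"

abbreviation koszul :: "((nat \<times> 'b) list \<Rightarrow>\<^sub>0 'k::field) \<Rightarrow> ((nat \<times> 'b) list \<Rightarrow>\<^sub>0 'k)" where
  "koszul \<equiv> deg_scale (\<lambda>n. (-1) ^ n)"

abbreviation component :: "nat \<Rightarrow> ((nat \<times> 'b) list \<Rightarrow>\<^sub>0 'k::field) \<Rightarrow> ((nat \<times> 'b) list \<Rightarrow>\<^sub>0 'k)" where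
  "component n \<equiv> deg_scale (\<lambda>m. of_bool (m = n))"

definition of_wdeg :: "nat \<Rightarrow> ((nat \<times> 'b) list \<Rightarrow>\<^sub>0 'k::field) set" where
  "of_wdeg n = {x. \<forall>w\<in>Poly_Mapping.keys x. wdeg w = n}"

lemma wdeg_simps [simp]: "wdeg [] = 0" "wdeg (g # w) = fst g + wdeg w" "wdeg (u @ v) = wdeg u + wdeg v"
  by (simp_all add: wdeg_def)

lemma subspace_of_wdeg: "psmul.subspace (of_wdeg n)"
proof -
  have "of_wdeg n = {x. Poly_Mapping.keys x \<subseteq> {w. wdeg w = n}}" by (auto simp: of_wdeg_def)
  then show ?thesis using subspace_keys_subset by metis
qed

lemma of_wdeg_basis: "basis_vec w \<in> of_wdeg n \<longleftrightarrow> wdeg w = n"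
  by (simp add: of_wdeg_def)

lemma of_wdeg_one: "1 \<in> of_wdeg 0"
  by (simp add: of_wdeg_basis flip: basis_vec_Nil)

lemma of_wdeg_mult:
  assumes "x \<in> of_wdeg m" "y \<in> of_wdeg n"
  shows "x * y \<in> of_wdeg (m + n)"
  using assms keys_mult[of x y] unfolding of_wdeg_def plus_list_def by fastforce

lemma lookup_deg_scale:
  "Poly_Mapping.lookup (deg_scale c x) w = c (wdeg w) * Poly_Mapping.lookup x w"
  unfolding deg_scale_def lext_def
  by (auto simp: lookup_sum lookup_psmul lookup_single when_def in_keys_iff sum.delta' if_distrib
      cong: if_cong)

lemma deg_scale_of_wdeg: "x \<in> of_wdeg n \<Longrightarrow> deg_scale c x = psmul (c n) x"
  by (rule poly_mapping_eqI) (auto simp: lookup_deg_scale lookup_psmul of_wdeg_def in_keys_iff)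

lemma keys_deg_scale: "Poly_Mapping.keys (deg_scale c x) \<subseteq> Poly_Mapping.keys x"
  by (auto simp: in_keys_iff lookup_deg_scale)

lemma deg_scale_words_over: "x \<in> words_over G \<Longrightarrow> deg_scale c x \<in> words_over G"
  using keys_deg_scale unfolding words_over_def by blast

lemma component_of_wdeg: "component n x \<in> of_wdeg n"
  by (auto simp: of_wdeg_def in_keys_iff lookup_deg_scale)

lemma component_self: "x \<in> of_wdeg n \<Longrightarrow> component n x = x"
  by (simp add: deg_scale_of_wdeg)

lemma
  shows deg_scale_add: "deg_scale c (x + y) = deg_scale c x + deg_scale c y"
    and deg_scale_diff: "deg_scale c (x - y) = deg_scale c x - deg_scale c y"
    and deg_scale_scale: "deg_scale c (psmul a x) = psmul a (deg_scale c x)"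
    and deg_scale_zero: "deg_scale c 0 = 0"
    and deg_scale_sum: "deg_scale c (sum h S) = (\<Sum>s\<in>S. deg_scale c (h s))"
    and deg_scale_basis: "deg_scale c (basis_vec w) = psmul (c (wdeg w)) (basis_vec w)"
  unfolding deg_scale_def by (simp_all only: lext_simps)

lemmas deg_scale_simps = deg_scale_add deg_scale_diff deg_scale_scale deg_scale_zero deg_scale_sum
  deg_scale_basis

lemma koszul_koszul: "koszul (koszul x) = x"
  by (rule poly_mapping_eqI) (simp add: lookup_deg_scale flip: mult.assoc power_mult_distrib)

lemma koszul_one: "koszul 1 = 1"
  by (rule poly_mapping_eqI) (simp add: lookup_deg_scale lookup_one zero_list_def when_def)

lemma koszul_mult: "koszul (x * y) = koszul x * koszul y"
proof -
  have "koszul (basis_vec u * y) = koszul (basis_vec u) * koszul y" for u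
  proof (induction y rule: free_induct)
    case (word v)
    show ?case
      by (simp add: deg_scale_basis free.scale_mult_left free.scale_mult_right power_add
          flip: basis_vec_append)
  qed (simp_all add: deg_scale_simps distrib_left free.scale_mult_right)
  then show ?thesis
    by (induction x rule: free_induct)
      (simp_all add: deg_scale_simps distrib_right free.scale_mult_left)
qed

abbreviation free_deriv ::
  "(nat \<times> 'b \<Rightarrow> nat \<times> 'b) \<Rightarrow> ((nat \<times> 'b) list \<Rightarrow>\<^sub>0 'k::field) \<Rightarrow> ((nat \<times> 'b) list \<Rightarrow>\<^sub>0 'k)" where
  "free_deriv \<delta> \<equiv> lext psmul (letterwise_d \<delta>)"

text \<open>
  The value of a derivation on a letter. Degree 0 is special as \<open>\<delta>\<close> lowers
  degrees by truncated subtraction.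
\<close>

definition letter_value :: "(nat \<times> 'b \<Rightarrow> nat \<times> 'b) \<Rightarrow> nat \<times> 'b \<Rightarrow> ((nat \<times> 'b) list \<Rightarrow>\<^sub>0 'k::field)" where
  "letter_value \<delta> g = (if fst g = 0 then 0 else basis_vec [\<delta> g])"

lemma free_deriv_one: "free_deriv \<delta> 1 = 0"
  by (simp add: lext_simps letterwise_d_def flip: basis_vec_Nil)

lemma free_deriv_Cons:
  "free_deriv \<delta> (basis_vec [g] * x) =
    letter_value \<delta> g * x + psmul ((-1) ^ fst g) (basis_vec [g] * free_deriv \<delta> x)"
proof (induction x rule: free_induct)
  case (word w)
  show ?case
    by (simp add: lext_simps letterwise_d_Cons letter_value_def flip: basis_vec_Cons)
qed (simp_all add: lext_simps distrib_left psmul.scale_right_distrib free.scale_mult_right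
      psmul.scale_left_commute)

lemma free_deriv_letter: "free_deriv \<delta> (basis_vec [g]) = letter_value \<delta> g"
  using free_deriv_Cons[of \<delta> g 1] by (simp add: free_deriv_one)

text \<open>
  Writing the sign as an operator on the left factor makes the Leibniz rule valid for
  inhomogeneous elements.
\<close>

lemma free_deriv_mult:
  "free_deriv \<delta> (x * y) = free_deriv \<delta> x * y + koszul x * free_deriv \<delta> y"
proof (induction x rule: free_induct)
  case (word w)
  show ?case
  proof (induction w)
    case Nil
    show ?case by (simp add: basis_vec_Nil free_deriv_one koszul_one)
  next
    case (Cons g w)
    show ?case
      by (simp add: basis_vec_Cons[of g w] mult.assoc free_deriv_Cons Cons koszul_mult
          deg_scale_basis distrib_left distrib_right psmul.scale_right_distrib free.scale_mult_left free.scale_mult_right)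
  qed
qed (simp_all add: lext_simps deg_scale_simps distrib_right psmul.scale_right_distrib free.scale_mult_left)

lemma free_deriv_words_over:
  assumes "\<And>g. g \<in> G \<Longrightarrow> fst g \<noteq> 0 \<Longrightarrow> \<delta> g \<in> G" "x \<in> words_over G"
  shows "free_deriv \<delta> x \<in> words_over G"
proof (rule lext_in_subspace[OF subspace_words_over])
  fix w assume "w \<in> Poly_Mapping.keys x"
  then have "w \<in> lists G" using assms(2) by (auto simp: words_over_def)
  then show "letterwise_d \<delta> w \<in> words_over G"
  proof induction
    case Nil show ?case by (simp add: letterwise_d_def words_over_closed)
  next
    case (Cons g w)
    then show ?case
      by (auto simp: letterwise_d_Cons words_over_basis intro!: words_over_closed assms(1))
  qed
qed

text \<open>The differential lowers the degree by one, so it anticommutes with the sign operator.\<close>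

lemma koszul_free_deriv:
  assumes "\<And>g. fst (\<delta> g) = fst g - 1"
  shows "koszul (free_deriv \<delta> x) = - free_deriv \<delta> (koszul x)"
proof (induction x rule: free_induct)
  case (word w)
  have letter: "koszul (letter_value \<delta> g) = - psmul ((-1) ^ fst g) (letter_value \<delta> g)" for g
    by (cases "fst g") (simp_all add: letter_value_def deg_scale_simps assms)
  show ?case
  proof (induction w)
    case Nil
    show ?case by (simp add: basis_vec_Nil free_deriv_one deg_scale_zero koszul_one)
  next
    case (Cons g w)
    show ?case
      by (simp add: basis_vec_Cons[of g w] free_deriv_Cons Cons koszul_mult
          deg_scale_simps lext_scale letter free.scale_mult_left free.scale_mult_right
          psmul.scale_right_distrib mult.assoc)
  qed
qed (simp_all add: lext_simps deg_scale_simps)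

text \<open>
  Truncated subtraction does no harm: in a word of degree 0 all letters have degree 0, and the
  derivation kills it.
\<close>

lemma free_deriv_of_wdeg:
  fixes x :: "(nat \<times> 'b) list \<Rightarrow>\<^sub>0 'k::field"
  assumes "\<And>g. fst (\<delta> g) = fst g - 1" "x \<in> of_wdeg n"
  shows "free_deriv \<delta> x \<in> of_wdeg (n - 1)"
proof (rule lext_in_subspace[OF subspace_of_wdeg])
  fix w assume "w \<in> Poly_Mapping.keys x"
  then have "wdeg w = n" using assms(2) by (auto simp: of_wdeg_def)
  then show "(letterwise_d \<delta> w :: _ \<Rightarrow>\<^sub>0 'k) \<in> of_wdeg (n - 1)"
  proof (induction w arbitrary: n)
    case Nil show ?case by (simp add: letterwise_d_def psmul.subspace_0 subspace_of_wdeg)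
  next
    case (Cons g w)
    have "basis_vec [g] * (letterwise_d \<delta> w :: _ \<Rightarrow>\<^sub>0 'k) \<in> of_wdeg (n - 1)"
    proof (cases "wdeg w = 0")
      case True
      then have "(letterwise_d \<delta> w :: _ \<Rightarrow>\<^sub>0 'k) = 0"
        unfolding letterwise_d_def by (intro sum.neutral) (simp add: wdeg_def)
      then show ?thesis using psmul.subspace_0[OF subspace_of_wdeg] by simp
    next
      case False
      have "basis_vec [g] * (letterwise_d \<delta> w :: _ \<Rightarrow>\<^sub>0 'k) \<in> of_wdeg (fst g + (wdeg w - 1))"
        using Cons.IH[OF refl] by (intro of_wdeg_mult) (simp_all add: of_wdeg_basis)
      then show ?thesis using False Cons.prems by simp
    qed
    then show ?case using Cons.prems
      by (auto simp: letterwise_d_Cons of_wdeg_basis assms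
          intro!: psmul.subspace_add psmul.subspace_scale psmul.subspace_0 subspace_of_wdeg)
  qed
qed

section \<open>Ideals\<close>

lemma subspace_ideal_gen: "psmul.subspace (ideal_gen G S)"
  by (simp add: ideal_gen_def psmul.subspace_span)

lemmas ideal_gen_closed = subspace_ideal_gen[THEN psmul.subspace_0]
  subspace_ideal_gen[THEN psmul.subspace_add] subspace_ideal_gen[THEN psmul.subspace_diff]
  subspace_ideal_gen[THEN psmul.subspace_neg]
  subspace_ideal_gen[THEN psmul.subspace_scale] subspace_ideal_gen[THEN psmul.subspace_sum]

lemma ideal_gen_word:
  "u \<in> lists G \<Longrightarrow> r \<in> S \<Longrightarrow> v \<in> lists G \<Longrightarrow> basis_vec u * r * basis_vec v \<in> ideal_gen G S"
  unfolding ideal_gen_def by (rule psmul.span_base) blast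

lemma ideal_gen_superset: "r \<in> S \<Longrightarrow> r \<in> ideal_gen G S"
  using ideal_gen_word[of "[]" G r S "[]"] by (simp add: basis_vec_Nil)

lemma ideal_gen_induct [consumes 1, case_names generator zero add scale]:
  assumes "x \<in> ideal_gen G S"
    and "\<And>u r v. u \<in> lists G \<Longrightarrow> r \<in> S \<Longrightarrow> v \<in> lists G \<Longrightarrow> P (basis_vec u * r * basis_vec v)"
    and "P 0" "\<And>x y. P x \<Longrightarrow> P y \<Longrightarrow> P (x + y)" "\<And>c x. P x \<Longrightarrow> P (psmul c x)"
  shows "P x"
  using assms(1) unfolding ideal_gen_def
proof (induction rule: psmul.span_induct_alt)
  case base show ?case by fact
next
  case (step c y z)
  then obtain u r v where y: "y = basis_vec u * r * basis_vec v" "u \<in> lists G" "r \<in> S" "v \<in> lists G"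
    by blast
  show ?case
    unfolding y(1) by (rule assms(4)[OF assms(5)[OF assms(2)[OF y(2-4)]] step(2)])
qed

lemma ideal_gen_mult_left:
  assumes "r \<in> ideal_gen G S" "x \<in> words_over G"
  shows "x * r \<in> ideal_gen G S"
proof -
  have "basis_vec w * r \<in> ideal_gen G S" if "w \<in> lists G" for w
    using assms(1)
  proof (induction rule: ideal_gen_induct)
    case (generator u r v)
    have "basis_vec w * (basis_vec u * r * basis_vec v) = basis_vec (w @ u) * r * basis_vec v"
      unfolding basis_vec_append by (simp add: mult.assoc)
    then show ?case using generator that
      by (metis ideal_gen_word append_in_lists_conv)
  qed (auto simp: distrib_left free.scale_mult_right intro: ideal_gen_closed)
  moreover have "w \<in> lists G" if "w \<in> Poly_Mapping.keys x" for w
    using assms(2) that by (auto simp: words_over_def)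
  ultimately show ?thesis
    by (intro free_induct[where P = "\<lambda>x. x * r \<in> ideal_gen G S" and x = x])
      (simp_all add: distrib_right free.scale_mult_left ideal_gen_closed)
qed

lemma ideal_gen_mult_right:
  assumes "r \<in> ideal_gen G S" "x \<in> words_over G"
  shows "r * x \<in> ideal_gen G S"
proof -
  have "r * basis_vec w \<in> ideal_gen G S" if "w \<in> lists G" for w
    using assms(1)
  proof (induction rule: ideal_gen_induct)
    case (generator u r v)
    have "(basis_vec u * r * basis_vec v) * basis_vec w = basis_vec u * r * basis_vec (v @ w)"
      unfolding basis_vec_append by (simp add: mult.assoc)
    then show ?case using generator that
      by (metis ideal_gen_word append_in_lists_conv)
  qed (auto simp: distrib_right free.scale_mult_left intro: ideal_gen_closed)
  moreover have "w \<in> lists G" if "w \<in> Poly_Mapping.keys x" for w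
    using assms(2) that by (auto simp: words_over_def)
  ultimately show ?thesis
    by (intro free_induct[where P = "\<lambda>x. r * x \<in> ideal_gen G S" and x = x])
      (simp_all add: distrib_left free.scale_mult_right ideal_gen_closed)
qed

lemma ideal_gen_words_over:
  assumes "S \<subseteq> words_over G"
  shows "ideal_gen G S \<subseteq> words_over G"
proof
  fix x assume "x \<in> ideal_gen G S"
  then show "x \<in> words_over G"
    by (induction rule: ideal_gen_induct)
      (use assms in \<open>auto simp: words_over_basis intro!: words_over_closed\<close>)
qed

lemma alg_ext_ideal_gen:
  assumes "\<And>g. g \<in> G \<Longrightarrow> f g \<in> words_over H"
    and "\<And>r. r \<in> S \<Longrightarrow> alg_ext psmul 1 f r \<in> ideal_gen H S'" and "x \<in> ideal_gen G S"
  shows "alg_ext psmul 1 f x \<in> ideal_gen H S'"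
  using assms(3)
proof (induction rule: ideal_gen_induct)
  case (generator u r v)
  show ?case unfolding free.alg_ext_mult
    by (intro ideal_gen_mult_left ideal_gen_mult_right alg_ext_words_over[of G] assms generator)
      (simp_all add: words_over_basis generator)
qed (auto simp: alg_ext_linear intro: ideal_gen_closed)

text \<open>
  Homogeneous relations span the ideal together with words, which are homogeneous as well.
\<close>

lemma deg_scale_ideal_gen:
  assumes S: "\<And>r. r \<in> S \<Longrightarrow> \<exists>n. r \<in> of_wdeg n" and "x \<in> ideal_gen G S"
  shows "deg_scale c x \<in> ideal_gen G S"
  using assms(2)
proof (induction rule: ideal_gen_induct)
  case (generator u r v)
  obtain n where "r \<in> of_wdeg n" using S generator by blast
  then have "basis_vec u * r * basis_vec v \<in> of_wdeg (wdeg u + n + wdeg v)"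
    by (intro of_wdeg_mult) (simp_all add: of_wdeg_basis)
  then show ?case
    using generator by (simp add: deg_scale_of_wdeg ideal_gen_closed ideal_gen_word)
qed (auto simp: deg_scale_simps intro: ideal_gen_closed)

text \<open>
  By the Leibniz rule a derivation of \<open>u r v\<close> is a sum of three terms with a factor
  \<open>r\<close>, \<open>koszul r\<close> or \<open>d r\<close>.
\<close>

lemma free_deriv_ideal_gen:
  assumes S: "\<And>r. r \<in> S \<Longrightarrow> \<exists>n. r \<in> of_wdeg n" "\<And>r. r \<in> S \<Longrightarrow> free_deriv \<delta> r \<in> ideal_gen G S"
    and \<delta>: "\<And>g. g \<in> G \<Longrightarrow> fst g \<noteq> 0 \<Longrightarrow> \<delta> g \<in> G" and "x \<in> ideal_gen G S"
  shows "free_deriv \<delta> x \<in> ideal_gen G S"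
  using assms(4)
proof (induction rule: ideal_gen_induct)
  case (generator u r v)
  have "koszul r \<in> ideal_gen G S"
    using deg_scale_ideal_gen[OF S(1)] generator ideal_gen_superset by blast
  moreover have r: "r \<in> ideal_gen G S" "free_deriv \<delta> r \<in> ideal_gen G S"
    using generator by (auto intro: ideal_gen_superset S(2))
  moreover have u: "basis_vec u \<in> words_over G" "basis_vec v \<in> words_over G"
    using generator by (auto simp: words_over_basis)
  moreover have "koszul (basis_vec u) \<in> words_over G"
    by (rule deg_scale_words_over) fact
  moreover have "free_deriv \<delta> (basis_vec u) \<in> words_over G" "free_deriv \<delta> (basis_vec v) \<in> words_over G"
    by (rule free_deriv_words_over[OF \<delta>]; use u in simp)+
  ultimately show ?case
    unfolding free_deriv_mult koszul_mult distrib_right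
    by (intro ideal_gen_closed(2) ideal_gen_mult_left ideal_gen_mult_right)
qed (auto simp: lext_simps intro: ideal_gen_closed)

section \<open>Cosets and complexes\<close>

context vector_space
begin

lemma coset_mem_iff: "subspace B \<Longrightarrow> y \<in> x +o B \<longleftrightarrow> y - x \<in> B"
  by (auto simp: elt_set_plus_def intro: bexI[of _ "y - x"])

lemma coset_eq_iff: 
  assumes "subspace B"
  shows "x +o B = y +o B \<longleftrightarrow> x - y \<in> B"
proof
  assume "x +o B = y +o B"
  then have "x \<in> y +o B" using coset_mem_iff[OF assms, of x x] subspace_0[OF assms] by simp
  then show "x - y \<in> B" using coset_mem_iff[OF assms] by simp
next
  assume *: "x - y \<in> B"
  have "z - x \<in> B \<longleftrightarrow> z - y \<in> B" for z
    using subspace_add[OF assms _ *, of "z - x"] subspace_diff[OF assms _ *, of "z - y"] by auto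
  then show "x +o B = y +o B" using coset_mem_iff[OF assms] by blast
qed

lemma coset_add: 
  assumes "subspace B"
  shows "(x +o B) + (y +o B) = (x + y) +o B"
proof -
  have "B + B = B"
  proof
    show "B + B \<subseteq> B" using subspace_add[OF assms] by (auto elim!: set_plus_elim)
    show "B \<subseteq> B + B" using subspace_0[OF assms] set_zero_plus2 by blast
  qed
  then show ?thesis by (metis set_plus_rearrange)
qed

text \<open>
  Induced maps are unions of cosets over all representatives. The map is compared on
  \<open>x\<close> and \<open>x + c\<close> instead of being linear, because the trace
  \<open>trace_entry E n\<close> of a formal letter is linear only modulo relations.
\<close>

lemma UN_coset:
  fixes x :: "'c::ab_group_add"
  assumes "subspace B" "0 \<in> C" "\<And>c. c \<in> C \<Longrightarrow> f (x + c) - f x \<in> B"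
  shows "(\<Union>y\<in>x +o C. f y +o B) = f x +o B"
proof -
  have "f (x + c) +o B = f x +o B" if "c \<in> C" for c
    using coset_eq_iff[OF assms(1)] assms(3)[OF that] by simp
  then have "f y +o B = f x +o B" if "y \<in> x +o C" for y
    using that unfolding elt_set_plus_def[of x] by blast
  moreover have "x \<in> x +o C" using assms(2) by (auto simp: elt_set_plus_def intro: bexI[of _ 0])
  ultimately show ?thesis by blast
qed

end

text \<open>
  The hypotheses under which the homology classes of a quotient complex \<open>ch / rel\<close>
  form a vector space.
\<close>

locale linear_complex = vector_space s
  for s :: "'k::field \<Rightarrow> 'x::ab_group_add \<Rightarrow> 'x" +
  fixes K :: "'x cx"
  assumes subspace_ch: "subspace (ch K n)"
    and subspace_rel: "subspace (rel K)"
    and linear_bdry: "Vector_Spaces.linear s s (bdry K)"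
begin

lemma subspace_boundaries: "subspace (boundaries K n)"
proof -
  interpret d: Vector_Spaces.linear s s "bdry K" by (rule linear_bdry)
  note ch = subspace_0[OF subspace_ch] subspace_add[OF subspace_ch] subspace_scale[OF subspace_ch]
  note rel = subspace_0[OF subspace_rel] subspace_add[OF subspace_rel] subspace_scale[OF subspace_rel]
  have I: "bdry K y + r \<in> boundaries K n" if "y \<in> ch K (Suc n)" "r \<in> rel K" "r \<in> ch K n" for y r
    unfolding boundaries_def using that by blast
  show ?thesis
  proof (rule subspaceI)
    show "0 \<in> boundaries K n"
      using I[of 0 0] ch rel by (simp add: d.zero)
    fix x assume "x \<in> boundaries K n"
    then obtain a r where x: "x = bdry K a + r" "a \<in> ch K (Suc n)" "r \<in> rel K" "r \<in> ch K n"
      unfolding boundaries_def by blast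
    show "s c x \<in> boundaries K n" for c
      using I[of "s c a" "s c r"] x ch rel by (simp add: d.scale scale_right_distrib)
    fix y assume "y \<in> boundaries K n"
    then obtain b t where y: "y = bdry K b + t" "b \<in> ch K (Suc n)" "t \<in> rel K" "t \<in> ch K n"
      unfolding boundaries_def by blast
    show "x + y \<in> boundaries K n"
      using I[of "a + b" "r + t"] x y ch rel by (simp add: d.add add_ac)
  qed
qed

lemma homologyE:
  assumes "X \<in> homology K n"
  obtains x where "X = x +o boundaries K n" "x \<in> ch K n" "bdry K x \<in> rel K"
  using assms by (auto simp: homology_def)

lemma homologyI: "x \<in> ch K n \<Longrightarrow> bdry K x \<in> rel K \<Longrightarrow> x +o boundaries K n \<in> homology K n"
  by (auto simp: homology_def)

lemma zero_class: "boundaries K n \<in> homology K n"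
proof -
  interpret d: Vector_Spaces.linear s s "bdry K" by (rule linear_bdry)
  have "0 +o boundaries K n \<in> homology K n"
    by (rule homologyI) (simp_all add: subspace_0[OF subspace_ch] subspace_0[OF subspace_rel] d.zero)
  then show ?thesis by simp
qed

lemma homology_add:
  assumes "X \<in> homology K n" "Y \<in> homology K n"
  shows "X + Y \<in> homology K n"
proof -
  interpret d: Vector_Spaces.linear s s "bdry K" by (rule linear_bdry)
  show ?thesis using assms
    by (auto elim!: homologyE simp: coset_add[OF subspace_boundaries] d.add
        intro!: homologyI subspace_add[OF subspace_ch] subspace_add[OF subspace_rel])
qed

lemma homology_scale:
  assumes "X \<in> homology K n"
  shows "induced (s c) K n X \<in> homology K n"
proof -
  interpret d: Vector_Spaces.linear s s "bdry K" by (rule linear_bdry)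
  obtain x where x: "X = x +o boundaries K n" "x \<in> ch K n" "bdry K x \<in> rel K"
    using assms by (rule homologyE)
  have "induced (s c) K n X = s c x +o boundaries K n"
    unfolding x induced_def
    by (rule UN_coset)
      (simp_all add: subspace_boundaries subspace_0 subspace_scale scale_right_distrib)
  then show ?thesis using x
    by (auto intro!: homologyI subspace_scale[OF subspace_ch] subspace_scale[OF subspace_rel] simp: d.scale)
qed

end

section \<open>The derived representation algebra\<close>

text \<open>
  \<open>X \<mapsto> P X Q\<close> on matrices of letters. For \<open>P\<close> the matrix of
  \<open>g\<^sup>-\<^sup>1\<close> and \<open>Q\<close> that of \<open>g\<close> this is
  \<open>GL_act\<close>; with the two matrices as parameters, everything about the action reduces
  to \<open>P Q = Q P = 1\<close>.
\<close>

definition conj_act ::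
  "'v set \<Rightarrow> ('v \<Rightarrow> 'v \<Rightarrow> 'k) \<Rightarrow> ('v \<Rightarrow> 'v \<Rightarrow> 'k) \<Rightarrow>
   ((nat \<times> 'r \<times> 'v \<times> 'v) list \<Rightarrow>\<^sub>0 'k::field) \<Rightarrow> ((nat \<times> 'r \<times> 'v \<times> 'v) list \<Rightarrow>\<^sub>0 'k)" where
  "conj_act E P Q = alg_ext psmul 1 (\<lambda>(m, x, i, j).
     \<Sum>a\<in>E. \<Sum>b\<in>E. psmul (P i a * Q b j) (basis_vec [(m, x, a, b)]))"

definition inverse_matrices :: "'v set \<Rightarrow> ('v \<Rightarrow> 'v \<Rightarrow> 'k::field) \<Rightarrow> ('v \<Rightarrow> 'v \<Rightarrow> 'k) \<Rightarrow> bool" where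
  "inverse_matrices E P Q \<longleftrightarrow> (\<forall>a\<in>E. \<forall>c\<in>E.
     (\<Sum>b\<in>E. P a b * Q b c) = of_bool (a = c) \<and> (\<Sum>b\<in>E. Q a b * P b c) = of_bool (a = c))"

text \<open>
  The product of two conjugated matrices is a sum over five indices, of which the one
  inside \<open>Q P\<close> has to be summed over first.
\<close>

lemma sum_reorder5:
  "(\<Sum>l\<in>E. \<Sum>a\<in>E. \<Sum>b\<in>E. \<Sum>c\<in>E. \<Sum>e\<in>E. f l a b c e) =
   (\<Sum>a\<in>E. \<Sum>e\<in>E. \<Sum>b\<in>E. \<Sum>c\<in>E. \<Sum>l\<in>E. f l a b c e)"
  unfolding sum.cartesian_product
  by (rule sum.reindex_bij_witness[where i = "\<lambda>(a, e, b, c, l). (l, a, b, c, e)"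
        and j = "\<lambda>(l, a, b, c, e). (a, e, b, c, l)"]) auto

lemma sum_reorder4:
  "(\<Sum>c\<in>E. \<Sum>e\<in>E. \<Sum>a\<in>E. \<Sum>b\<in>E. f a b c e) = (\<Sum>a\<in>E. \<Sum>b\<in>E. \<Sum>c\<in>E. \<Sum>e\<in>E. f a b c e)"
  unfolding sum.cartesian_product
  by (rule sum.reindex_bij_witness[where i = "\<lambda>(a, b, c, e). (c, e, a, b)"
        and j = "\<lambda>(c, e, a, b). (a, b, c, e)"]) auto

locale representation_algebra = dg_algebra R
  for R :: "('k::field, 'r::ring) dga" +
  fixes E :: "'v set"
  assumes finite_E: "finite E"
begin

text \<open>
  \<open>ent m x i j\<close> is the matrix entry \<open>x\<^sub>i\<^sub>j\<close> of an
  \<open>x\<close> of degree \<open>m\<close>. \<open>R\<^sub>V\<close> is \<open>W / I\<close>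
  with differential \<open>d\<close>, and \<open>B\<close> consists of all representatives of
  boundaries.
\<close>

abbreviation ent :: "nat \<Rightarrow> 'r \<Rightarrow> 'v \<Rightarrow> 'v \<Rightarrow> ((nat \<times> 'r \<times> 'v \<times> 'v) list \<Rightarrow>\<^sub>0 'k)" where
  "ent m x i j \<equiv> basis_vec [(m, x, i, j)]"

abbreviation "letter_dif \<equiv> (\<lambda>(m :: nat, x :: 'r, i :: 'v, j :: 'v). (m - 1, dif R x, i, j))"

abbreviation "W \<equiv> words_over (rep_gens R E) :: ((nat \<times> 'r \<times> 'v \<times> 'v) list \<Rightarrow>\<^sub>0 'k) set"

abbreviation "I \<equiv> rel (rep_cx R E)"

abbreviation "d \<equiv> bdry (rep_cx R E)"

abbreviation "B \<equiv> boundaries_tot (rep_cx R E)"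

lemma rel_eq: "I = ideal_gen (rep_gens R E) (rep_rel R E)"
  by (simp add: rep_cx_def)

lemma d_eq: "d = free_deriv letter_dif"
  by (simp add: rep_cx_def)

lemma ch_eq: "ch (rep_cx R E) n = W \<inter> of_wdeg n"
  by (auto simp: rep_cx_def words_over_def of_wdeg_def)

lemma gr_sum_eq: "gr_sum (ch (rep_cx R E)) = W"
proof
  show "gr_sum (ch (rep_cx R E)) \<subseteq> W"
    using gr_sum_rep_cx_keys unfolding words_over_def by blast
  show "W \<subseteq> gr_sum (ch (rep_cx R E))"
  proof
    fix x assume x: "x \<in> W"
    define N where "N = Suc (Max (wdeg ` Poly_Mapping.keys x))"
    have N: "wdeg w < N" if "w \<in> Poly_Mapping.keys x" for w
      unfolding N_def using that by (auto simp: less_Suc_eq_le)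
    have "x = (\<Sum>n<N. component n x)"
    proof (rule poly_mapping_eqI)
      fix w
      have "(\<Sum>n<N. of_bool (wdeg w = n) * Poly_Mapping.lookup x w) = Poly_Mapping.lookup x w"
      proof (cases "w \<in> Poly_Mapping.keys x")
        case True
        then show ?thesis using N[OF True] by (simp add: of_bool_def if_distrib[where f = "\<lambda>a. a * _"] cong: if_cong)
      qed (simp add: in_keys_iff)
      then show "Poly_Mapping.lookup x w = Poly_Mapping.lookup (\<Sum>n<N. component n x) w"
        by (simp add: lookup_sum lookup_deg_scale)
    qed
    moreover have "\<forall>n. component n x \<in> ch (rep_cx R E) n"
      using deg_scale_words_over[OF x] component_of_wdeg by (auto simp: ch_eq)
    ultimately show "x \<in> gr_sum (ch (rep_cx R E))"
      unfolding gr_sum_def by blast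
  qed
qed

lemmas W_closed = words_over_closed[where G = "rep_gens R E"]

lemmas I_closed = ideal_gen_closed[where G = "rep_gens R E" and S = "rep_rel R E", folded rel_eq]

lemma I_mult_left: "r \<in> I \<Longrightarrow> x \<in> W \<Longrightarrow> x * r \<in> I"
  unfolding rel_eq by (rule ideal_gen_mult_left)

lemma I_mult_right: "r \<in> I \<Longrightarrow> x \<in> W \<Longrightarrow> r * x \<in> I"
  unfolding rel_eq by (rule ideal_gen_mult_right)

lemma gen_iff: "(m, x, i, j) \<in> rep_gens R E \<longleftrightarrow> x \<in> gr R m \<and> i \<in> E \<and> j \<in> E"
  by (simp add: rep_gens_def)

lemma ent_W: "x \<in> gr R m \<Longrightarrow> i \<in> E \<Longrightarrow> j \<in> E \<Longrightarrow> ent m x i j \<in> W"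
  by (simp add: words_over_basis gen_iff)

lemma ent_of_wdeg: "ent m x i j \<in> of_wdeg m"
  by (simp add: of_wdeg_basis)

lemma rep_rel_cases [consumes 1, case_names add scale mult unit comm]:
  assumes "r \<in> rep_rel R E"
    and "\<And>m x y i j. r = ent m (x + y) i j - ent m x i j - ent m y i j \<Longrightarrow>
      x \<in> gr R m \<Longrightarrow> y \<in> gr R m \<Longrightarrow> i \<in> E \<Longrightarrow> j \<in> E \<Longrightarrow> thesis"
    and "\<And>m c x i j. r = ent m (smul R c x) i j - psmul c (ent m x i j) \<Longrightarrow>
      x \<in> gr R m \<Longrightarrow> i \<in> E \<Longrightarrow> j \<in> E \<Longrightarrow> thesis"
    and "\<And>m n x y i j. r = ent (m + n) (x * y) i j - (\<Sum>l\<in>E. ent m x i l * ent n y l j) \<Longrightarrow>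
      x \<in> gr R m \<Longrightarrow> y \<in> gr R n \<Longrightarrow> i \<in> E \<Longrightarrow> j \<in> E \<Longrightarrow> thesis"
    and "\<And>i j. r = ent 0 (unt R) i j - of_bool (i = j) \<Longrightarrow> i \<in> E \<Longrightarrow> j \<in> E \<Longrightarrow> thesis"
    and "\<And>m x i j n y k l. r = ent m x i j * ent n y k l - psmul ((-1) ^ (m * n)) (ent n y k l * ent m x i j) \<Longrightarrow>
      x \<in> gr R m \<Longrightarrow> i \<in> E \<Longrightarrow> j \<in> E \<Longrightarrow> y \<in> gr R n \<Longrightarrow> k \<in> E \<Longrightarrow> l \<in> E \<Longrightarrow> thesis"
  shows thesis
proof -
  have two: "basis_vec [g, h] = basis_vec [g] * (basis_vec [h] :: (nat \<times> 'r \<times> 'v \<times> 'v) list \<Rightarrow>\<^sub>0 'k)" for g h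
    by (rule basis_vec_Cons)
  have "thesis" if comm: "r \<in> comm_rel (rep_gens R E)"
  proof -
    obtain g h where "r = basis_vec [g] * basis_vec [h] - psmul ((-1) ^ (fst g * fst h)) (basis_vec [h] * basis_vec [g])"
      and "g \<in> rep_gens R E" "h \<in> rep_gens R E"
      using comm unfolding comm_rel_def two by blast
    then show thesis
      unfolding rep_gens_def by (auto intro: assms(6))
  qed
  moreover have "thesis" if "r \<in> {basis_vec [(0, unt R, i, j)] - (if i = j then 1 else 0) | i j. i \<in> E \<and> j \<in> E}"
    using that assms(5) unfolding of_bool_def by blast
  moreover have "thesis" if "r \<in> {basis_vec [(m + n, x * y, i, j)] - (\<Sum>l\<in>E. basis_vec [(m, x, i, l), (n, y, l, j)])
       | m n x y i j. x \<in> gr R m \<and> y \<in> gr R n \<and> i \<in> E \<and> j \<in> E}"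
    using that assms(4) unfolding two by blast
  moreover have "thesis" if "r \<in> {basis_vec [(m, smul R c x, i, j)] - psmul c (basis_vec [(m, x, i, j)])
       | m c x i j. x \<in> gr R m \<and> i \<in> E \<and> j \<in> E}"
    using that assms(3) by blast
  moreover have "thesis" if "r \<in> {basis_vec [(m, x + y, i, j)] - basis_vec [(m, x, i, j)] - basis_vec [(m, y, i, j)]
       | m x y i j. x \<in> gr R m \<and> y \<in> gr R m \<and> i \<in> E \<and> j \<in> E}"
    using that assms(2) by blast
  ultimately show thesis
    using assms(1) unfolding rep_rel_def by (elim UnE)
qed

lemma rel_add: 
  "x \<in> gr R m \<Longrightarrow> y \<in> gr R m \<Longrightarrow> i \<in> E \<Longrightarrow> j \<in> E \<Longrightarrow>
    ent m (x + y) i j - ent m x i j - ent m y i j \<in> I"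
  unfolding rel_eq by (rule ideal_gen_superset) (unfold rep_rel_def, blast)

lemma rel_scale: 
  "x \<in> gr R m \<Longrightarrow> i \<in> E \<Longrightarrow> j \<in> E \<Longrightarrow> ent m (smul R c x) i j - psmul c (ent m x i j) \<in> I"
  unfolding rel_eq by (rule ideal_gen_superset) (unfold rep_rel_def, blast)

lemma rel_mult: 
  "x \<in> gr R m \<Longrightarrow> y \<in> gr R n \<Longrightarrow> i \<in> E \<Longrightarrow> j \<in> E \<Longrightarrow>
    ent (m + n) (x * y) i j - (\<Sum>l\<in>E. ent m x i l * ent n y l j) \<in> I"
  unfolding rel_eq basis_vec_append[symmetric]
  by (rule ideal_gen_superset) (unfold rep_rel_def append.simps, blast)

lemma rel_unit: 
  "i \<in> E \<Longrightarrow> j \<in> E \<Longrightarrow> ent 0 (unt R) i j - of_bool (i = j) \<in> I"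
  unfolding rel_eq of_bool_def
  by (rule ideal_gen_superset) (unfold rep_rel_def, blast)

lemma rel_comm: 
  assumes "x \<in> gr R m" "i \<in> E" "j \<in> E" "y \<in> gr R n" "k \<in> E" "l \<in> E"
  shows "ent m x i j * ent n y k l - psmul ((-1) ^ (m * n)) (ent n y k l * ent m x i j) \<in> I"
proof -
  have "basis_vec [(m, x, i, j), (n, y, k, l)] - psmul ((-1) ^ (fst (m, x, i, j) * fst (n, y, k, l)))
      (basis_vec [(n, y, k, l), (m, x, i, j)]) \<in> comm_rel (rep_gens R E)"
    unfolding comm_rel_def using assms gen_iff by blast
  then have "basis_vec [(m, x, i, j), (n, y, k, l)] - psmul ((-1) ^ (m * n))
      (basis_vec [(n, y, k, l), (m, x, i, j)]) \<in> rep_rel R E"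
    unfolding rep_rel_def fst_conv by blast
  then show ?thesis
    unfolding rel_eq basis_vec_append[symmetric] append.simps by (rule ideal_gen_superset)
qed

lemma rel_zero: "i \<in> E \<Longrightarrow> j \<in> E \<Longrightarrow> ent m 0 i j \<in> I"
  using rel_scale[of 0 m i j 0] subspace_0[OF gr_subspace] by simp

lemma rep_rel_homogeneous: "r \<in> rep_rel R E \<Longrightarrow> \<exists>n. r \<in> of_wdeg n"
proof (induction rule: rep_rel_cases)
  case (unit i j)
  then have "r \<in> of_wdeg 0"
    using of_wdeg_one subspace_of_wdeg[THEN psmul.subspace_0]
    by (auto simp: of_bool_def intro!: psmul.subspace_diff subspace_of_wdeg ent_of_wdeg)
  then show ?case by blast
next
  case (comm m x i j n y k l)
  have "r \<in> of_wdeg (m + n)" unfolding comm(1)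
    using of_wdeg_mult[OF ent_of_wdeg ent_of_wdeg, of m x i j n y k l]
      of_wdeg_mult[OF ent_of_wdeg ent_of_wdeg, of n y k l m x i j]
    by (intro psmul.subspace_diff psmul.subspace_scale subspace_of_wdeg) (simp_all add: add.commute)
  then show ?case by blast
qed (blast intro: psmul.subspace_diff psmul.subspace_scale psmul.subspace_sum subspace_of_wdeg ent_of_wdeg
      of_wdeg_mult)+

lemma rep_rel_W: "rep_rel R E \<subseteq> W"
proof
  fix r assume "r \<in> rep_rel R E"
  then show "r \<in> W"
    by (cases rule: rep_rel_cases)
      (auto simp: of_bool_def intro!: W_closed ent_W subspace_add[OF gr_subspace] subspace_scale[OF gr_subspace] mult_gr unt_gr)
qed

lemma I_W: "r \<in> I \<Longrightarrow> r \<in> W"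
  using ideal_gen_words_over[OF rep_rel_W] unfolding rel_eq by blast

lemma deg_scale_I: "r \<in> I \<Longrightarrow> deg_scale c r \<in> I"
  unfolding rel_eq using rep_rel_homogeneous by (rule deg_scale_ideal_gen)

lemma d_ent: "d (ent m x i j) = (if m = 0 then 0 else ent (m - 1) (dif R x) i j)"
  by (simp add: d_eq free_deriv_letter letter_value_def)

lemma letter_dif_gens: "g \<in> rep_gens R E \<Longrightarrow> fst g \<noteq> 0 \<Longrightarrow> letter_dif g \<in> rep_gens R E"
  by (cases "fst g") (auto simp: rep_gens_def intro: dif_gr)

lemma d_W: "x \<in> W \<Longrightarrow> d x \<in> W"
  unfolding d_eq by (rule free_deriv_words_over) (rule letter_dif_gens)

lemma d_mult: "d (x * y) = d x * y + koszul x * d y"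
  unfolding d_eq by (rule free_deriv_mult)

lemma
  shows d_add: "d (x + y) = d x + d y"
    and d_diff: "d (x - y) = d x - d y"
    and d_scale: "d (psmul c x) = psmul c (d x)"
    and d_zero: "d 0 = 0"
    and d_sum: "d (sum h S) = (\<Sum>s\<in>S. d (h s))"
    and d_one: "d 1 = 0"
  by (simp_all add: d_eq lext_simps free_deriv_one)

lemma koszul_d: "koszul (d x) = - d (koszul x)"
  unfolding d_eq by (rule koszul_free_deriv) auto

lemma d_of_wdeg: "x \<in> of_wdeg n \<Longrightarrow> d x \<in> of_wdeg (n - 1)"
  unfolding d_eq by (rule free_deriv_of_wdeg) auto

lemma koszul_ent: "koszul (ent m x i j) = psmul ((-1) ^ m) (ent m x i j)"
  by (simp add: deg_scale_basis)

lemma d_ent_mult: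
  "d (ent m x i j * ent n y k l) =
    d (ent m x i j) * ent n y k l + psmul ((-1) ^ m) (ent m x i j * d (ent n y k l))"
  by (simp add: d_mult koszul_ent free.scale_mult_left)

interpretation dif: Vector_Spaces.linear "smul R" "smul R" "dif R"
  by (rule dif_linear)

text \<open>
  It is enough to apply \<open>d\<close> to the relations; each image is a combination of
  relations of the same kind (and, for the multiplication relation, of those expressing
  linearity). Factors of degree 0 have to be separated, as \<open>dif\<close> kills them.
\<close>

lemma d_I:
  assumes "r \<in> I"
  shows "d r \<in> I"
proof -
  have "d r \<in> I" if "r \<in> rep_rel R E" for r
    using that
  proof (cases rule: rep_rel_cases)
    case (add m x y i j)
    show ?thesis
    proof (cases m)
      case 0 then show ?thesis using add by (simp add: d_diff d_ent I_closed)
    next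
      case (Suc n)
      then show ?thesis using add rel_add[OF dif_gr dif_gr]
        by (simp add: d_diff d_ent dif.add)
    qed
  next
    case (scale m c x i j)
    show ?thesis
    proof (cases m)
      case 0 then show ?thesis using scale by (simp add: d_diff d_scale d_ent I_closed)
    next
      case (Suc n)
      then show ?thesis using scale rel_scale[OF dif_gr]
        by (simp add: d_diff d_scale d_ent dif.scale)
    qed
  next
    case (unit i j)
    then show ?thesis by (simp add: d_diff d_ent d_zero d_one of_bool_def I_closed)
  next
    case (mult m n x y i j)
    let ?c = "(-1) ^ m :: 'k"
    have dr: "d r = d (ent (m + n) (x * y) i j) - (\<Sum>l\<in>E. d (ent m x i l) * ent n y l j) -
        psmul ?c (\<Sum>l\<in>E. ent m x i l * d (ent n y l j))"
      by (simp add: mult d_diff d_sum d_ent_mult sum.distrib psmul.scale_sum_right)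
    have dxy: "dif R (x * y) = dif R x * y + smul R ?c (x * dif R y)"
      by (rule dif_mult[OF mult(2)])
    show ?thesis
    proof (cases m)
      case 0
      have dx: "dif R x = 0" using dif_gr_0 mult(2) 0 by simp
      show ?thesis
      proof (cases n)
        case 0
        then show ?thesis using \<open>m = 0\<close> by (simp add: dr d_ent I_closed)
      next
        case (Suc n')
        then show ?thesis using rel_mult[of x 0 "dif R y" n' i j] mult(2-5) Suc \<open>m = 0\<close> dif_gr[of y n'] 
          by (simp add: dr d_ent dxy dx)
      qed
    next
      case (Suc m')
      show ?thesis
      proof (cases n)
        case 0
        have dy: "dif R y = 0" using dif_gr_0 mult(3) 0 by simp
        show ?thesis using rel_mult[of "dif R x" m' y 0 i j] mult(2-5) 0 Suc dif_gr[of x m']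
          by (simp add: dr d_ent dxy dy)
      next
        case (Suc n')
        have gr: "dif R x \<in> gr R m'" "dif R y \<in> gr R n'"
          using mult(2,3) dif_gr \<open>m = Suc m'\<close> Suc by simp_all
        have gr': "dif R x * y \<in> gr R (m' + n)" "x * dif R y \<in> gr R (m + n')" "m + n' = m' + n"
          using mult_gr[OF gr(1) mult(3)] mult_gr[OF mult(2) gr(2)] \<open>m = Suc m'\<close> Suc by simp_all
        have "d r = (ent (m' + n) (dif R x * y + smul R ?c (x * dif R y)) i j
              - ent (m' + n) (dif R x * y) i j - ent (m' + n) (smul R ?c (x * dif R y)) i j)
            + (ent (m' + n) (dif R x * y) i j - (\<Sum>l\<in>E. ent m' (dif R x) i l * ent n y l j))
            + (ent (m' + n) (smul R ?c (x * dif R y)) i j - psmul ?c (ent (m' + n) (x * dif R y) i j))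
            + psmul ?c (ent (m + n') (x * dif R y) i j - (\<Sum>l\<in>E. ent m x i l * ent n' (dif R y) l j))"
          unfolding dr using gr'(3) \<open>m = Suc m'\<close> Suc
          by (simp add: d_ent dxy psmul.scale_right_diff_distrib)
        also have "\<dots> \<in> I"
          using gr gr' mult by (intro I_closed rel_add rel_mult rel_scale subspace_scale[OF gr_subspace]) auto
        finally show ?thesis .
      qed
    qed
  next
    case (comm m x i j n y k l)
    let ?s = "(-1) ^ (m * n) :: 'k"
    have dr: "d r = (d (ent m x i j) * ent n y k l - psmul (?s * (-1) ^ n) (ent n y k l * d (ent m x i j)))
       + psmul ((-1) ^ m) (ent m x i j * d (ent n y k l) - psmul (?s * (-1) ^ m) (d (ent n y k l) * ent m x i j))"
      by (simp add: comm d_diff d_scale d_ent_mult psmul.scale_right_diff_distrib psmul.scale_right_distrib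
          mult.assoc mult.left_commute[of "(-1) ^ m"])
    have "d (ent m x i j) * ent n y k l - psmul (?s * (-1) ^ n) (ent n y k l * d (ent m x i j)) \<in> I"
    proof (cases m)
      case 0 then show ?thesis by (simp add: d_ent I_closed)
    next
      case (Suc m')
      have "?s * (-1) ^ n = (-1) ^ (m' * n)" by (simp add: Suc power_add mult.commute)
      then show ?thesis using rel_comm[OF dif_gr, of x m'] comm Suc by (simp add: d_ent)
    qed
    moreover have "ent m x i j * d (ent n y k l) - psmul (?s * (-1) ^ m) (d (ent n y k l) * ent m x i j) \<in> I"
    proof (cases n)
      case 0 then show ?thesis by (simp add: d_ent I_closed)
    next
      case (Suc n')
      have "?s * (-1) ^ m = (-1) ^ (m * n')" by (simp add: Suc power_add mult.commute)
      then show ?thesis using rel_comm[OF comm(2-4) dif_gr, of y n'] comm Suc by (simp add: d_ent)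
    qed
    ultimately show ?thesis unfolding dr by (intro I_closed(2) I_closed(5))
  qed
  then have rel: "\<And>r. r \<in> rep_rel R E \<Longrightarrow> free_deriv letter_dif r \<in> ideal_gen (rep_gens R E) (rep_rel R E)"
    by (simp only: rel_eq d_eq)
  show ?thesis
    unfolding rel_eq d_eq
    by (rule free_deriv_ideal_gen[OF rep_rel_homogeneous rel letter_dif_gens assms[unfolded rel_eq]])
qed

text \<open>
  The square of an odd derivation is a derivation, so only letters have to be checked. On a letter
  it gives the letter with entry \<open>dif (dif x) = 0\<close>; that letter is not zero in the
  free algebra, but it is a relation.
\<close>

lemma d_d:
  assumes "x \<in> W"
  shows "d (d x) \<in> I"
proof -
  have word: "d (d (basis_vec w)) \<in> I" if "w \<in> lists (rep_gens R E)" for w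
    using that
  proof induction
    case Nil
    show ?case by (simp add: basis_vec_Nil d_one d_zero I_closed)
  next
    case (Cons g w)
    obtain m x i j where g: "g = (m, x, i, j)" by (cases g)
    have cons: "basis_vec (g # w) = ent m x i j * basis_vec w"
      unfolding g by (rule basis_vec_Cons)
    have dif_dif: "d (d (ent m x i j)) \<in> I"
      using Cons by (auto simp: d_ent dif_dif g gen_iff d_zero intro: rel_zero I_closed)
    \<comment> \<open>this sign makes the two mixed terms of \<open>d (d (g w))\<close> cancel\<close>
    have "koszul (d (ent m x i j)) = - psmul ((-1) ^ m) (d (ent m x i j))"
      by (simp add: koszul_d koszul_ent d_scale)
    then have "d (d (basis_vec (g # w))) = d (d (ent m x i j)) * basis_vec w + ent m x i j * d (d (basis_vec w))"
      unfolding cons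
      by (simp add: d_mult d_add koszul_ent koszul_mult koszul_koszul d_scale free.scale_mult_left
          psmul.scale_right_distrib)
    also have "\<dots> \<in> I"
      using Cons dif_dif by (intro I_closed I_mult_left I_mult_right) (auto simp: words_over_basis g)
    finally show ?case .
  qed
  moreover have "w \<in> lists (rep_gens R E)" if "w \<in> Poly_Mapping.keys x" for w
    using assms that by (auto simp: words_over_def)
  ultimately show ?thesis
    by (intro free_induct[where P = "\<lambda>x. d (d x) \<in> I" and x = x])
      (simp_all add: d_zero d_add d_scale I_closed)
qed

subsection \<open>The action of invertible matrices\<close>

lemma act_ent: "conj_act E P Q (ent m x i j) = (\<Sum>a\<in>E. \<Sum>b\<in>E. psmul (P i a * Q b j) (ent m x a b))"
  by (simp add: conj_act_def alg_ext_letter)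

lemma
  shows act_add: "conj_act E P Q (x + y) = conj_act E P Q x + conj_act E P Q y"
    and act_diff: "conj_act E P Q (x - y) = conj_act E P Q x - conj_act E P Q y"
    and act_scale: "conj_act E P Q (psmul c x) = psmul c (conj_act E P Q x)"
    and act_zero: "conj_act E P Q 0 = 0"
    and act_sum: "conj_act E P Q (sum h S) = (\<Sum>s\<in>S. conj_act E P Q (h s))"
    and act_mult: "conj_act E P Q (x * y) = conj_act E P Q x * conj_act E P Q y"
    and act_one: "conj_act E P Q 1 = 1"
  unfolding conj_act_def by (rule alg_ext_linear alg_ext_hom)+

lemmas act_simps = act_add act_diff act_scale act_zero act_sum act_mult act_one act_ent

lemma act_letter_W:
  "g \<in> rep_gens R E \<Longrightarrow>
    (case g of (m, x, i, j) \<Rightarrow> \<Sum>a\<in>E. \<Sum>b\<in>E. psmul (P i a * Q b j) (ent m x a b)) \<in> W"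
  by (cases g) (simp add: gen_iff W_closed ent_W)

lemma act_W: "x \<in> W \<Longrightarrow> conj_act E P Q x \<in> W"
  unfolding conj_act_def using act_letter_W by (rule alg_ext_words_over)

text \<open>
  No relations are involved: the differential acts on the entry \<open>x\<close> of a letter, the
  conjugation on its indices.
\<close>

lemma act_d: "conj_act E P Q (d x) = d (conj_act E P Q x)"
proof (induction x rule: free_induct)
  case (word w)
  show ?case
  proof (induction w)
    case Nil
    show ?case by (simp add: basis_vec_Nil d_one act_simps)
  next
    case (Cons g w)
    obtain m x i j where g: "g = (m, x, i, j)" by (cases g)
    have cons: "basis_vec (g # w) = ent m x i j * basis_vec w"
      unfolding g by (rule basis_vec_Cons)
    have "conj_act E P Q (d (ent m x i j)) = d (conj_act E P Q (ent m x i j))"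
      by (simp add: d_ent act_simps d_sum d_scale)
    moreover have "conj_act E P Q (koszul (ent m x i j)) = koszul (conj_act E P Q (ent m x i j))"
      by (simp add: koszul_ent act_simps deg_scale_sum deg_scale_scale psmul.scale_sum_right mult.commute)
    ultimately show ?case
      unfolding cons by (simp only: d_mult act_mult act_add Cons)
  qed
qed (simp_all only: d_add d_scale d_zero act_simps)

text \<open>
  The unit relation uses \<open>P Q = 1\<close>, the multiplication relation \<open>Q P =
  1\<close>: \<open>(P X Q)(P Y Q) = P X Y Q\<close>. The other relations are linear or bilinear
  in the letters, so conjugation maps them to combinations of relations of the same kind.
\<close>

lemma act_I:
  assumes PQ: "inverse_matrices E P Q" and r: "r \<in> I"
  shows "conj_act E P Q r \<in> I"
proof -
  have "conj_act E P Q r \<in> I" if "r \<in> rep_rel R E" for r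
    using that
  proof (cases rule: rep_rel_cases)
    case (add m x y i j)
    have "conj_act E P Q r =
        (\<Sum>a\<in>E. \<Sum>b\<in>E. psmul (P i a * Q b j) (ent m (x + y) a b - ent m x a b - ent m y a b))"
      by (simp add: add act_simps sum_subtractf psmul.scale_right_diff_distrib)
    then show ?thesis using add by (simp add: I_closed rel_add)
  next
    case (scale m c x i j)
    have "conj_act E P Q r =
        (\<Sum>a\<in>E. \<Sum>b\<in>E. psmul (P i a * Q b j) (ent m (smul R c x) a b - psmul c (ent m x a b)))"
      by (simp add: scale act_simps sum_subtractf psmul.scale_right_diff_distrib psmul.scale_sum_right
          mult.left_commute[of c] mult.commute[of _ c])
    then show ?thesis using scale by (simp add: I_closed rel_scale)
  next
    case (unit i j)
    have "(\<Sum>a\<in>E. \<Sum>b\<in>E. psmul (P i a * Q b j) (of_bool (a = b))) =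
        (\<Sum>a\<in>E. psmul (P i a * Q a j) (1 :: (nat \<times> 'r \<times> 'v \<times> 'v) list \<Rightarrow>\<^sub>0 'k))"
      by (intro sum.cong refl)
        (simp add: of_bool_def if_distrib[where f = "psmul _"] finite_E cong: if_cong)
    also have "\<dots> = psmul (\<Sum>a\<in>E. P i a * Q a j) 1"
      by (simp add: psmul.scale_sum_left)
    also have "\<dots> = of_bool (i = j)"
      using PQ unit(2,3) by (simp add: inverse_matrices_def)
    finally have "conj_act E P Q r =
        (\<Sum>a\<in>E. \<Sum>b\<in>E. psmul (P i a * Q b j) (ent 0 (unt R) a b - of_bool (a = b)))"
      by (cases "i = j") (simp_all add: unit act_simps sum_subtractf psmul.scale_right_diff_distrib)
    also have "\<dots> \<in> I" by (intro I_closed rel_unit)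
    finally show ?thesis .
  next
    case (mult m n x y i j)
    have contract: "(\<Sum>l\<in>E. Q b l * P l c) = of_bool (b = c)" if "b \<in> E" "c \<in> E" for b c
      using PQ that by (simp add: inverse_matrices_def)
    have "(\<Sum>l\<in>E. conj_act E P Q (ent m x i l) * conj_act E P Q (ent n y l j)) =
        (\<Sum>l\<in>E. \<Sum>a\<in>E. \<Sum>b\<in>E. \<Sum>c\<in>E. \<Sum>e\<in>E.
          psmul (P i a * Q b l * (P l c * Q e j)) (ent m x a b * ent n y c e))"
      by (simp only: act_ent sum_distrib_right, simp only: sum_distrib_left)
        (simp add: free.scale_mult_left free.scale_mult_right mult.commute)
    also have "\<dots> = (\<Sum>a\<in>E. \<Sum>e\<in>E. \<Sum>b\<in>E. \<Sum>c\<in>E. \<Sum>l\<in>E.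
          psmul (P i a * Q b l * (P l c * Q e j)) (ent m x a b * ent n y c e))"
      by (rule sum_reorder5)
    also have "\<dots> = (\<Sum>a\<in>E. \<Sum>e\<in>E. \<Sum>b\<in>E. \<Sum>c\<in>E.
          psmul (P i a * Q e j) (psmul (\<Sum>l\<in>E. Q b l * P l c) (ent m x a b * ent n y c e)))"
      by (simp add: psmul.scale_sum_left psmul.scale_sum_right mult_ac)
    also have "\<dots> = (\<Sum>a\<in>E. \<Sum>e\<in>E. psmul (P i a * Q e j) (\<Sum>b\<in>E. ent m x a b * ent n y b e))"
      by (simp add: contract psmul.scale_sum_right of_bool_def if_distrib[where f = "\<lambda>c. psmul c _"]
          if_distrib[where f = "psmul _"] finite_E cong: if_cong)
    finally have "conj_act E P Q r = (\<Sum>a\<in>E. \<Sum>e\<in>E. psmul (P i a * Q e j)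
        (ent (m + n) (x * y) a e - (\<Sum>b\<in>E. ent m x a b * ent n y b e)))"
      by (simp add: mult act_diff act_sum act_mult act_ent[of _ _ "m + n"] sum_subtractf psmul.scale_right_diff_distrib)
    also have "\<dots> \<in> I" using mult by (intro I_closed rel_mult)
    finally show ?thesis .
  next
    case (comm m x i j n y k l)
    have prod: "conj_act E P Q (ent m x i j) * conj_act E P Q (ent n y k l) =
        (\<Sum>a\<in>E. \<Sum>b\<in>E. \<Sum>c\<in>E. \<Sum>e\<in>E. psmul (P i a * Q b j * (P k c * Q e l)) (ent m x a b * ent n y c e))"
      for m n :: nat and x y :: 'r and i j k l
      by (simp only: act_ent sum_distrib_right, simp only: sum_distrib_left)
        (simp add: free.scale_mult_left free.scale_mult_right mult.commute)
    have prod': "conj_act E P Q (ent n y k l) * conj_act E P Q (ent m x i j) =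
        (\<Sum>a\<in>E. \<Sum>b\<in>E. \<Sum>c\<in>E. \<Sum>e\<in>E. psmul (P i a * Q b j * (P k c * Q e l)) (ent n y c e * ent m x a b))"
      unfolding prod[of n y k l m x i j] by (subst sum_reorder4) (simp only: mult.commute)
    have "conj_act E P Q r = conj_act E P Q (ent m x i j) * conj_act E P Q (ent n y k l) -
        psmul ((-1) ^ (m * n)) (conj_act E P Q (ent n y k l) * conj_act E P Q (ent m x i j))"
      by (simp only: comm(1) act_diff act_scale act_mult)
    also have "\<dots> = (\<Sum>a\<in>E. \<Sum>b\<in>E. \<Sum>c\<in>E. \<Sum>e\<in>E. psmul (P i a * Q b j * (P k c * Q e l))
        (ent m x a b * ent n y c e - psmul ((-1) ^ (m * n)) (ent n y c e * ent m x a b)))"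
      unfolding prod' unfolding prod
      by (simp only: psmul.scale_right_diff_distrib sum_subtractf psmul.scale_sum_right psmul.scale_left_commute)
    also have "\<dots> \<in> I" using comm by (intro I_closed rel_comm)
    finally show ?thesis .
  qed
  then have rel: "\<And>r. r \<in> rep_rel R E \<Longrightarrow> conj_act E P Q r \<in> ideal_gen (rep_gens R E) (rep_rel R E)"
    by (simp only: rel_eq)
  show ?thesis
    unfolding rel_eq conj_act_def
    by (rule alg_ext_ideal_gen[OF act_letter_W rel[unfolded conj_act_def] r[unfolded rel_eq]])
qed

text \<open>
  Conjugation invariance of the trace, already in the free algebra.
\<close>

lemma act_trace_entry:
  fixes x :: 'r and P Q :: "'v \<Rightarrow> 'v \<Rightarrow> 'k"
  assumes "inverse_matrices E P Q"
  shows "conj_act E P Q (trace_entry E m x) = trace_entry E m x"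
proof -
  have "conj_act E P Q (trace_entry E m x) =
      (\<Sum>i\<in>E. \<Sum>a\<in>E. \<Sum>b\<in>E. psmul (P i a * Q b i) (ent m x a b))"
    by (simp add: trace_entry_def act_simps)
  also have "\<dots> = (\<Sum>a\<in>E. \<Sum>b\<in>E. \<Sum>i\<in>E. psmul (Q b i * P i a) (ent m x a b))"
    by (rule trans[OF sum.swap], rule sum.cong[OF refl], rule trans[OF sum.swap]) (simp only: mult.commute)
  also have "\<dots> = (\<Sum>a\<in>E. \<Sum>b\<in>E. psmul (of_bool (b = a)) (ent m x a b))"
    using assms by (simp add: inverse_matrices_def flip: psmul.scale_sum_left)
  also have "\<dots> = trace_entry E m x"
    by (simp add: trace_entry_def of_bool_def if_distrib[where f = "\<lambda>c. psmul c _"] finite_E cong: if_cong)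
  finally show ?thesis .
qed

end

context representation_algebra
begin

subsection \<open>Invariant cycles\<close>

lemma linear_complex_rep_cx: "linear_complex psmul (rep_cx R E)"
proof (intro linear_complex.intro vector_space_psmul linear_complex_axioms.intro)
  show "psmul.subspace (ch (rep_cx R E) n)" for n
    unfolding ch_eq by (intro psmul.subspace_inter subspace_words_over subspace_of_wdeg)
  show "psmul.subspace I"
    unfolding rel_eq by (rule subspace_ideal_gen)
  show "Vector_Spaces.linear psmul psmul d"
    unfolding d_eq by (rule linear_lext_psmul)
qed

interpretation K: linear_complex psmul "rep_cx R E" by (rule linear_complex_rep_cx)

lemma B_I: "y \<in> W \<Longrightarrow> r \<in> I \<Longrightarrow> d y + r \<in> B"
  unfolding boundaries_tot_def gr_sum_eq by blast

lemma B_E: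
  assumes "b \<in> B"
  obtains y r where "b = d y + r" "y \<in> W" "r \<in> I"
  using assms unfolding boundaries_tot_def gr_sum_eq by blast

lemma subspace_B: "psmul.subspace B"
proof (rule psmul.subspaceI)
  show "0 \<in> B" using B_I[of 0 0] by (simp add: W_closed I_closed d_zero)
  fix x assume "x \<in> B"
  then obtain y r where x: "x = d y + r" "y \<in> W" "r \<in> I" by (rule B_E)
  show "psmul c x \<in> B" for c
    using B_I[of "psmul c y" "psmul c r"] x
    by (simp add: W_closed I_closed d_scale psmul.scale_right_distrib)
  fix x' assume "x' \<in> B"
  then obtain y' r' where x': "x' = d y' + r'" "y' \<in> W" "r' \<in> I" by (rule B_E)
  show "x + x' \<in> B"
    using B_I[of "y + y'" "r + r'"] x x' by (simp add: W_closed I_closed d_add add_ac)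
qed

lemmas B_closed = subspace_B[THEN psmul.subspace_0] subspace_B[THEN psmul.subspace_add]
  subspace_B[THEN psmul.subspace_diff] subspace_B[THEN psmul.subspace_neg]
  subspace_B[THEN psmul.subspace_scale] subspace_B[THEN psmul.subspace_sum]

lemma boundaries_subset_B: "boundaries (rep_cx R E) n \<subseteq> B"
  unfolding boundaries_def ch_eq using B_I by blast

lemma B_W: "b \<in> B \<Longrightarrow> b \<in> W"
  by (elim B_E) (simp add: W_closed(4) d_W I_W)

lemma B_cycle: "b \<in> B \<Longrightarrow> d b \<in> I"
  by (elim B_E) (simp add: d_add I_closed(2) d_d d_I)

lemma B_mult_right:
  assumes "b \<in> B" "z \<in> W" "d z \<in> I"
  shows "b * z \<in> B"
proof -
  obtain y r where b: "b = d y + r" "y \<in> W" "r \<in> I" using assms(1) by (rule B_E)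
  have "b * z = d (y * z) + (r * z - koszul y * d z)"
    by (simp add: b d_mult distrib_right)
  also have "\<dots> \<in> B"
    using assms b
    by (intro B_I W_closed I_closed(3) I_mult_left I_mult_right deg_scale_words_over)
  finally show ?thesis .
qed

text \<open>
  On the left the Leibniz rule is corrected by the sign operator, \<open>z * d y = d (koszul z *
  y)\<close> modulo \<open>d z\<close>. Together with \<open>B_mult_right\<close> this makes the
  boundaries an ideal in the cycles.
\<close>

lemma B_mult_left:
  assumes "b \<in> B" "z \<in> W" "d z \<in> I"
  shows "z * b \<in> B"
proof -
  obtain y r where b: "b = d y + r" "y \<in> W" "r \<in> I" using assms(1) by (rule B_E)
  have "koszul (d z) = - d (koszul z)" by (rule koszul_d)
  then have "d (koszul z) = - koszul (d z)" by simp
  then have "z * b = d (koszul z * y) + (z * r + koszul (d z) * y)"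
    by (simp add: b d_mult koszul_koszul distrib_left)
  also have "\<dots> \<in> B"
    using assms b
    by (intro B_I W_closed I_closed(2) I_mult_left I_mult_right deg_scale_words_over deg_scale_I)
  finally show ?thesis .
qed

lemma act_B: "inverse_matrices E P Q \<Longrightarrow> b \<in> B \<Longrightarrow> conj_act E P Q b \<in> B"
  by (elim B_E) (simp add: act_add act_d B_I act_W act_I)

text \<open>
  Representatives of invariant classes. They are the subalgebra in which all computations with
  chosen representatives stay.
\<close>

definition invariant_cycles :: "((nat \<times> 'r \<times> 'v \<times> 'v) list \<Rightarrow>\<^sub>0 'k) set" where
  "invariant_cycles = {z \<in> W. d z \<in> I \<and>
     (\<forall>P Q. inverse_matrices E P Q \<longrightarrow> conj_act E P Q z - z \<in> B)}"

lemma B_invariant: "b \<in> B \<Longrightarrow> b \<in> invariant_cycles"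
  by (simp add: invariant_cycles_def B_W B_cycle B_closed act_B)

lemma subspace_invariant_cycles: "psmul.subspace invariant_cycles"
proof (rule psmul.subspaceI)
  show "0 \<in> invariant_cycles" by (intro B_invariant B_closed)
next
  fix x y assume *: "x \<in> invariant_cycles" "y \<in> invariant_cycles"
  have "conj_act E P Q (x + y) - (x + y) \<in> B" if "inverse_matrices E P Q" for P Q
  proof -
    have "conj_act E P Q (x + y) - (x + y) = (conj_act E P Q x - x) + (conj_act E P Q y - y)"
      by (simp add: act_add)
    also have "\<dots> \<in> B" using * that by (simp add: invariant_cycles_def B_closed)
    finally show ?thesis .
  qed
  then show "x + y \<in> invariant_cycles"
    using * by (simp add: invariant_cycles_def W_closed d_add I_closed)
next
  fix c x assume "x \<in> invariant_cycles"
  moreover have "conj_act E P Q (psmul c x) - psmul c x = psmul c (conj_act E P Q x - x)" for P Q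
    by (simp add: act_scale psmul.scale_right_diff_distrib)
  ultimately show "psmul c x \<in> invariant_cycles"
    by (simp add: invariant_cycles_def W_closed d_scale I_closed B_closed)
qed

lemma invariant_cycles_one: "1 \<in> invariant_cycles"
  by (simp add: invariant_cycles_def W_closed d_one I_closed act_one B_closed)

text \<open>
  \<open>g (x y) - x y = (g x - x) (g y) + x (g y - y)\<close>, and the boundaries are an ideal in
  the cycles.
\<close>

lemma invariant_cycles_mult:
  assumes x: "x \<in> invariant_cycles" and y: "y \<in> invariant_cycles"
  shows "x * y \<in> invariant_cycles"
proof -
  have "x \<in> W" "d x \<in> I" "y \<in> W" "d y \<in> I" using x y by (auto simp: invariant_cycles_def)
  then have "d (x * y) \<in> I"
    unfolding d_mult by (intro I_closed(2) I_mult_left I_mult_right deg_scale_words_over)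
  moreover have "conj_act E P Q (x * y) - x * y \<in> B" if PQ: "inverse_matrices E P Q" for P Q
  proof -
    have "conj_act E P Q (x * y) - x * y =
        (conj_act E P Q x - x) * conj_act E P Q y + x * (conj_act E P Q y - y)"
      by (simp add: act_mult algebra_simps)
    moreover have "conj_act E P Q y \<in> W" "d (conj_act E P Q y) \<in> I"
      using \<open>y \<in> W\<close> \<open>d y \<in> I\<close> PQ by (auto simp: act_W act_I simp flip: act_d)
    moreover have "conj_act E P Q x - x \<in> B" "conj_act E P Q y - y \<in> B"
      using x y PQ by (auto simp: invariant_cycles_def)
    ultimately show ?thesis
      using \<open>x \<in> W\<close> \<open>d x \<in> I\<close> by (simp add: B_closed(2) B_mult_left B_mult_right)
  qed
  ultimately show ?thesis
    using \<open>x \<in> W\<close> \<open>y \<in> W\<close> by (simp add: invariant_cycles_def W_closed)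
qed

lemma coset_of_invariant_cycle:
  assumes "z \<in> invariant_cycles"
  shows "z +o boundaries (rep_cx R E) n \<subseteq> invariant_cycles"
    and "z +o boundaries (rep_cx R E) n \<noteq> {}"
proof -
  show "z +o boundaries (rep_cx R E) n \<subseteq> invariant_cycles"
    using assms boundaries_subset_B B_invariant psmul.subspace_add[OF subspace_invariant_cycles]
    unfolding elt_set_plus_def by blast
  show "z +o boundaries (rep_cx R E) n \<noteq> {}"
    using psmul.subspace_0[OF K.subspace_boundaries] by (auto simp: elt_set_plus_def)
qed

subsection \<open>Traces of homogeneous elements\<close>

lemma trace_W: "x \<in> gr R m \<Longrightarrow> trace_entry E m x \<in> W"
  unfolding trace_entry_def by (intro W_closed ent_W)

lemma trace_of_wdeg: "(trace_entry E m x :: _ \<Rightarrow>\<^sub>0 'k) \<in> of_wdeg m"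
  for x :: 'r
  unfolding trace_entry_def by (intro psmul.subspace_sum subspace_of_wdeg ent_of_wdeg)

lemma trace_add: 
  "x \<in> gr R m \<Longrightarrow> y \<in> gr R m \<Longrightarrow>
    trace_entry E m (x + y) - trace_entry E m x - trace_entry E m y \<in> I"
  unfolding trace_entry_def sum_subtractf[symmetric] by (intro I_closed rel_add)

lemma trace_scale:
  "x \<in> gr R m \<Longrightarrow> trace_entry E m (smul R c x) - psmul c (trace_entry E m x) \<in> I"
  unfolding trace_entry_def psmul.scale_sum_right sum_subtractf[symmetric] by (intro I_closed rel_scale)

lemma trace_zero: "trace_entry E m 0 \<in> I"
  unfolding trace_entry_def by (intro I_closed rel_zero)

lemma d_trace: "d (trace_entry E (Suc n) x) = trace_entry E n (dif R x)"
  by (simp add: trace_entry_def d_sum d_ent)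

lemma trace_mult:
  assumes "x \<in> gr R m" "y \<in> gr R n"
  shows "trace_entry E (m + n) (x * y) - (\<Sum>i\<in>E. \<Sum>l\<in>E. ent m x i l * ent n y l i) \<in> I"
  unfolding trace_entry_def sum_subtractf[symmetric] using assms by (intro I_closed rel_mult)

text \<open>
  Modulo relations \<open>tr (x y) = \<Sum>i l. x\<^sub>i\<^sub>l y\<^sub>l\<^sub>i\<close>, and
  graded commutativity exchanges the two factors.
\<close>

lemma trace_commutator:
  assumes x: "x \<in> gr R m" and y: "y \<in> gr R n"
  shows "trace_entry E (m + n) (x * y - smul R ((-1) ^ (m * n)) (y * x)) \<in> I"
proof -
  let ?c = "(-1) ^ (m * n) :: 'k"
  let ?T = "trace_entry E (m + n) :: 'r \<Rightarrow> _"
  have gr: "x * y \<in> gr R (m + n)" "y * x \<in> gr R (m + n)"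
    using mult_gr[OF x y] mult_gr[OF y x] by (simp_all add: add.commute)
  have gr': "smul R (- ?c) (y * x) \<in> gr R (m + n)"
    by (rule subspace_scale[OF gr_subspace gr(2)])
  have "?T (x * y - smul R ?c (y * x)) = ?T (x * y + smul R (- ?c) (y * x))" by simp
  also have "\<dots> = (?T (x * y + smul R (- ?c) (y * x)) - ?T (x * y) - ?T (smul R (- ?c) (y * x)))
      + (?T (smul R (- ?c) (y * x)) - psmul (- ?c) (?T (y * x)))
      + (?T (x * y) - (\<Sum>i\<in>E. \<Sum>l\<in>E. ent m x i l * ent n y l i))
      + psmul (- ?c) (?T (y * x) - (\<Sum>l\<in>E. \<Sum>i\<in>E. ent n y l i * ent m x i l))
      + (\<Sum>i\<in>E. \<Sum>l\<in>E. ent m x i l * ent n y l i - psmul ?c (ent n y l i * ent m x i l))"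
    unfolding sum.swap[of "\<lambda>l i. ent n y l i * ent m x i l" E E]
    by (simp add: sum_subtractf sum_negf psmul.scale_sum_right psmul.scale_right_diff_distrib)
  also have "\<dots> \<in> I"
    using x y gr gr' trace_mult[OF y x]
    by (intro I_closed(2,5) trace_add trace_scale trace_mult I_closed(6) rel_comm) (simp_all add: add.commute)
  finally show ?thesis .
qed

lemma trace_unit: "trace_entry E 0 (unt R) - of_nat (card E) \<in> I"
proof -
  have "trace_entry E 0 (unt R) - of_nat (card E) = (\<Sum>i\<in>E. ent 0 (unt R) i i - of_bool (i = i))"
    by (simp add: trace_entry_def sum_subtractf)
  then show ?thesis by (simp only:) (intro I_closed rel_unit)
qed

lemma trace_invariant:
  assumes "x \<in> gr R n" "d (trace_entry E n x) \<in> I"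
  shows "trace_entry E n x \<in> invariant_cycles"
  using assms by (simp add: invariant_cycles_def trace_W act_trace_entry B_closed)

subsection \<open>The trace in positive degrees\<close>

text \<open>
  \<open>R\<^sub>V / k\<close> is \<open>W / J\<close>.
\<close>

abbreviation "J \<equiv> rel (reduced_rep_cx R E)"

lemma J_eq: "J = pspan (I \<union> {1})"
  by (simp add: reduced_rep_cx_def)

lemma reduced_eq [simp]: "ch (reduced_rep_cx R E) = ch (rep_cx R E)" "bdry (reduced_rep_cx R E) = d"
  by (simp_all add: reduced_rep_cx_def)

lemma subspace_J: "psmul.subspace J"
  by (simp add: J_eq psmul.subspace_span)

lemma I_subset_J: "r \<in> I \<Longrightarrow> r \<in> J" and one_J: "1 \<in> J"
  by (auto simp: J_eq intro: psmul.span_base)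

interpretation J: linear_complex psmul "reduced_rep_cx R E"
  using K.linear_complex_axioms subspace_J
  by (simp add: linear_complex_def linear_complex_axioms_def)

lemma J_cases:
  assumes "x \<in> J"
  obtains c where "x - psmul c 1 \<in> I"
proof -
  have "x \<in> pspan (insert 1 I)" using assms by (simp add: J_eq)
  then obtain c where "x - psmul c 1 \<in> pspan I" by (auto simp: psmul.span_insert)
  moreover have "pspan I = I"
    using subspace_ideal_gen by (simp add: rel_eq psmul.span_eq_iff)
  ultimately show ?thesis using that by simp
qed

lemma J_positive_degree:
  assumes "x \<in> J" "x \<in> of_wdeg n" "n > 0"
  shows "x \<in> I"
proof -
  obtain c where c: "x - psmul c 1 \<in> I" using assms(1) by (rule J_cases)
  have "component n (x - psmul c 1) = x"
    using assms(2,3) by (simp add: deg_scale_diff deg_scale_scale component_self deg_scale_of_wdeg[OF of_wdeg_one])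
  then show ?thesis using deg_scale_I[OF c] by metis
qed

text \<open>
  If \<open>d y = 1\<close> modulo relations, then a cycle \<open>z\<close> is the boundary of
  \<open>y z\<close>.
\<close>

lemma unit_boundary_acyclic:
  assumes y: "y \<in> W" "y \<in> of_wdeg 1" and "c \<noteq> 0" and c: "d y - psmul c 1 \<in> I"
  shows "homology (rep_cx R E) n = {boundaries (rep_cx R E) n}"
proof -
  define y' where "y' = psmul (1 / c) y"
  have y': "y' \<in> W" "y' \<in> of_wdeg 1"
    using y by (auto simp: y'_def intro: W_closed psmul.subspace_scale subspace_of_wdeg)
  have "d y' - 1 = psmul (1 / c) (d y - psmul c 1)"
    using \<open>c \<noteq> 0\<close> by (simp add: y'_def d_scale psmul.scale_right_diff_distrib)
  then have dy': "d y' - 1 \<in> I" using c by (simp add: I_closed)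
  have "z \<in> boundaries (rep_cx R E) n" if z: "z \<in> ch (rep_cx R E) n" "d z \<in> I" for z
  proof -
    \<comment> \<open>the correction in \<open>z = d (y' z) + ?r\<close>\<close>
    let ?r = "- ((d y' - 1) * z) - koszul y' * d z"
    have z': "z \<in> W" "z \<in> of_wdeg n" using z by (auto simp: ch_eq)
    have "z = d (y' * z) + ?r" by (simp add: d_mult algebra_simps)
    moreover have "y' * z \<in> of_wdeg (Suc n)" using of_wdeg_mult[OF y'(2) z'(2)] by simp
    then have "y' * z \<in> ch (rep_cx R E) (Suc n)" "z - d (y' * z) \<in> of_wdeg n"
      using y' z' W_closed d_of_wdeg[of "y' * z" "Suc n"]
      by (auto simp: ch_eq intro: psmul.subspace_diff subspace_of_wdeg)
    moreover have "?r \<in> I"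
      using I_mult_right[OF dy' z'(1)] I_mult_left[OF z(2) deg_scale_words_over[OF y'(1)]]
      by (intro I_closed(3,4))
    moreover have "?r = z - d (y' * z)" by (simp add: d_mult algebra_simps)
    ultimately show ?thesis
      unfolding boundaries_def ch_eq using I_W[of ?r]
      by (intro CollectI exI[of _ "y' * z"] exI[of _ ?r] conjI IntI) simp_all
  qed
  then have "z +o boundaries (rep_cx R E) n = boundaries (rep_cx R E) n"
    if "z \<in> ch (rep_cx R E) n" "d z \<in> I" for z
    using psmul.coset_eq_iff[OF K.subspace_boundaries, of z n 0] that by simp
  then show ?thesis
    using K.zero_class by (auto elim!: K.homologyE)
qed

text \<open>
  Surjectivity of \<open>H\<^sub>n(R\<^sub>V) \<rightarrow> H\<^sub>n(R\<^sub>V/k)\<close>. Only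
  \<open>n = 1\<close> is critical: then \<open>d z\<close> has degree 0 and could be a nonzero
  number.
\<close>

lemma unreduced_cycle:
  assumes "\<not> (\<forall>m. homology (rep_cx R E) m = {boundaries (rep_cx R E) m})"
    and z: "z \<in> ch (rep_cx R E) n" "d z \<in> J" and "n > 0"
  shows "d z \<in> I"
proof (cases "n = 1")
  case True
  obtain c where c: "d z - psmul c 1 \<in> I" using z(2) by (rule J_cases)
  then have "c = 0"
    using unit_boundary_acyclic[of z c] assms(1) z True by (auto simp: ch_eq)
  then show ?thesis using c by simp
next
  case False
  then show ?thesis
    using J_positive_degree[OF z(2)] d_of_wdeg[of z n] z(1) \<open>n > 0\<close> by (auto simp: ch_eq)
qed

lemma induced_id_reduced:
  "induced id (reduced_rep_cx R E) n (x +o boundaries (rep_cx R E) n) =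
   x +o boundaries (reduced_rep_cx R E) n"
proof -
  have "boundaries (rep_cx R E) n \<subseteq> boundaries (reduced_rep_cx R E) n"
    using I_subset_J by (auto simp: boundaries_def)
  then show ?thesis
    unfolding induced_def
    by (subst psmul.UN_coset[where f = id])
      (auto simp: J.subspace_boundaries psmul.subspace_0[OF K.subspace_boundaries])
qed

lemma inj_on_unreduced_homology:
  assumes "n > 0"
  shows "inj_on (induced id (reduced_rep_cx R E) n) (homology (rep_cx R E) n)"
proof (rule inj_onI)
  fix X Y assume "X \<in> homology (rep_cx R E) n" "Y \<in> homology (rep_cx R E) n"
    and eq: "induced id (reduced_rep_cx R E) n X = induced id (reduced_rep_cx R E) n Y"
  then obtain x y where X: "X = x +o boundaries (rep_cx R E) n" and Y: "Y = y +o boundaries (rep_cx R E) n"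
    by (metis K.homologyE)
  have "x - y \<in> boundaries (reduced_rep_cx R E) n"
    using eq unfolding X Y induced_id_reduced by (simp add: psmul.coset_eq_iff[OF J.subspace_boundaries])
  then obtain u r where "x - y = d u + r" "u \<in> ch (rep_cx R E) (Suc n)" "r \<in> J" "r \<in> ch (rep_cx R E) n"
    unfolding boundaries_def by auto
  then have "x - y \<in> boundaries (rep_cx R E) n"
    using J_positive_degree[of r n] \<open>n > 0\<close> unfolding boundaries_def by (auto simp: ch_eq)
  then show "X = Y" unfolding X Y by (simp add: psmul.coset_eq_iff[OF K.subspace_boundaries])
qed

lemma linear_complex_nat_cx: "linear_complex (smul R) (nat_cx R)"
  by (intro linear_complex.intro vector_space_axioms linear_complex_axioms.intro)
    (simp_all add: nat_cx_def gr_subspace subspace_span dif_linear)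

interpretation N: linear_complex "smul R" "nat_cx R" by (rule linear_complex_nat_cx)

text \<open>
  Commutators of homogeneous elements and the unit have traces in \<open>J\<close>, but an element
  of degree \<open>n\<close> of their span is a priori a combination of elements of various
  degrees. The set \<open>T\<close> in the proof keeps track of the homogeneous components, and it
  is a subspace because the trace is linear modulo \<open>I\<close>.
\<close>

lemma trace_nat_rel:
  assumes x: "x \<in> rel (nat_cx R)" "x \<in> gr R n"
  shows "trace_entry E n x \<in> J"
proof -
  define T where "T = {x. \<exists>f N. (\<forall>i. f i \<in> gr R i \<and> trace_entry E i (f i) \<in> J) \<and>
    (\<forall>i\<ge>N. f i = 0) \<and> x = (\<Sum>i<N. f i)}"
  have extend: "(\<Sum>i<N. f i) = (\<Sum>i<M. f i)" if "\<forall>i\<ge>N. f i = 0" "N \<le> M" for f :: "nat \<Rightarrow> 'r" and N M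
    using that by (intro sum.mono_neutral_left) auto
  note gr = subspace_0[OF gr_subspace] subspace_add[OF gr_subspace] subspace_scale[OF gr_subspace]
    subspace_diff[OF gr_subspace]
  note Jc = psmul.subspace_0[OF subspace_J] psmul.subspace_add[OF subspace_J] psmul.subspace_scale[OF subspace_J]
  have trJ_add: "trace_entry E i (a + b) \<in> J"
    if "a \<in> gr R i" "b \<in> gr R i" "trace_entry E i a \<in> J" "trace_entry E i b \<in> J" for i a b
  proof -
    have "trace_entry E i (a + b) = (trace_entry E i (a + b) - trace_entry E i a - trace_entry E i b)
        + (trace_entry E i a + trace_entry E i b)" by simp
    also have "\<dots> \<in> J" by (intro Jc(2) that I_subset_J[OF trace_add[OF that(1,2)]])
    finally show ?thesis .
  qed
  have trJ_scale: "trace_entry E i (smul R c a) \<in> J"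
    if "a \<in> gr R i" "trace_entry E i a \<in> J" for i c a
  proof -
    have "trace_entry E i (smul R c a) = (trace_entry E i (smul R c a) - psmul c (trace_entry E i a))
        + psmul c (trace_entry E i a)" by simp
    also have "\<dots> \<in> J" by (intro Jc(2,3) that I_subset_J[OF trace_scale[OF that(1)]])
    finally show ?thesis .
  qed
  have homogeneous: "a \<in> T" if "a \<in> gr R m" "trace_entry E m a \<in> J" for a m
    unfolding T_def using that gr(1) trace_zero I_subset_J
    by (intro CollectI exI[of _ "\<lambda>i. if i = m then a else 0"] exI[of _ "Suc m"]) auto
  have "subspace T"
  proof (rule subspaceI)
    show "0 \<in> T" using homogeneous[of 0 0] gr(1) trace_zero I_subset_J by blast
    fix a assume "a \<in> T"
    then obtain f N where f: "\<And>i. f i \<in> gr R i" "\<And>i. trace_entry E i (f i) \<in> J" "\<forall>i\<ge>N. f i = 0" "a = (\<Sum>i<N. f i)"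
      unfolding T_def by blast
    show "smul R c a \<in> T" for c
      unfolding T_def using f
      by (intro CollectI exI[of _ "\<lambda>i. smul R c (f i)"] exI[of _ N]) (simp add: gr trJ_scale scale_sum_right)
    fix b assume "b \<in> T"
    then obtain g M where g: "\<And>i. g i \<in> gr R i" "\<And>i. trace_entry E i (g i) \<in> J" "\<forall>i\<ge>M. g i = 0" "b = (\<Sum>i<M. g i)"
      unfolding T_def by blast
    have "a + b = (\<Sum>i<max N M. f i + g i)"
      using extend[OF f(3), of "max N M"] extend[OF g(3), of "max N M"] f(4) g(4) by (simp add: sum.distrib)
    then show "a + b \<in> T"
      unfolding T_def using f g
      by (intro CollectI exI[of _ "\<lambda>i. f i + g i"] exI[of _ "max N M"]) (simp add: gr trJ_add)
  qed
  moreover have "x * y - smul R ((-1) ^ (m * n)) (y * x) \<in> T" if "x \<in> gr R m" "y \<in> gr R n" for m n x y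
    using that mult_gr[of x m y n] mult_gr[of y n x m]
    by (intro homogeneous[of _ "m + n"] gr I_subset_J trace_commutator) (simp_all add: add.commute)
  moreover have "unt R \<in> T"
  proof (rule homogeneous[OF unt_gr])
    have "of_nat (card E) = (\<Sum>i\<in>E. 1 :: (nat \<times> 'r \<times> 'v \<times> 'v) list \<Rightarrow>\<^sub>0 'k)" by simp
    also have "\<dots> \<in> J" by (intro psmul.subspace_sum subspace_J one_J)
    finally have "(trace_entry E 0 (unt R) - of_nat (card E)) + of_nat (card E) \<in> J"
      by (intro Jc(2) I_subset_J[OF trace_unit])
    then show "trace_entry E 0 (unt R) \<in> J" by simp
  qed
  ultimately have "rel (nat_cx R) \<subseteq> T"
    unfolding nat_cx_def cx.simps by (intro span_minimal) blast+
  then obtain f N where f: "\<And>i. f i \<in> gr R i" "\<And>i. trace_entry E i (f i) \<in> J" "\<forall>i\<ge>N. f i = 0" "x = (\<Sum>i<N. f i)"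
    using x(1) unfolding T_def by blast
  \<comment> \<open>uniqueness of homogeneous components gives \<open>f n = x\<close>\<close>
  define h where "h i = f i - (if i = n then x else 0)" for i
  have "(\<Sum>i<max N (Suc n). f i) = x"
    unfolding f(4) by (rule extend[symmetric]) (use f(3) in auto)
  then have "(\<Sum>i<max N (Suc n). h i) = 0"
    unfolding h_def sum_subtractf by (subst sum.delta) auto
  moreover have "\<forall>i. h i \<in> gr R i"
    using f(1) x(2) gr by (simp add: h_def)
  ultimately have "h n = 0" using gr_direct[of h "max N (Suc n)" n] by simp
  then show ?thesis using f(2)[of n] by (simp add: h_def)
qed

text \<open>
  Whichever branch of the definition applies, the value is a homology class. So it is represented
  by some \<open>r\<close> with \<open>dif r\<close> a combination of commutators and the unit.
\<close>

lemma feigin_tsygan_class: "feigin_tsygan R p n \<alpha> \<in> homology (nat_cx R) n"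
  unfolding feigin_tsygan_def
  by (auto intro: N.zero_class dest!: theI')

lemma induced_trace:
  assumes "r \<in> gr R n"
  shows "induced (trace_entry E n) (reduced_rep_cx R E) n (r +o boundaries (nat_cx R) n) =
    trace_entry E n r +o boundaries (reduced_rep_cx R E) n"
  unfolding induced_def
proof (rule psmul.UN_coset[OF J.subspace_boundaries])
  show "0 \<in> boundaries (nat_cx R) n" by (rule subspace_0[OF N.subspace_boundaries])
  fix c assume "c \<in> boundaries (nat_cx R) n"
  then obtain y s where c: "c = dif R y + s" and y: "y \<in> gr R (Suc n)"
    and s: "s \<in> rel (nat_cx R)" "s \<in> gr R n"
    unfolding boundaries_def by (auto simp: nat_cx_def)
  have gr: "dif R y \<in> gr R n" "c \<in> gr R n"
    using y s c dif_gr subspace_add[OF gr_subspace] by auto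
  let ?T = "trace_entry E n :: 'r \<Rightarrow> (nat \<times> 'r \<times> 'v \<times> 'v) list \<Rightarrow>\<^sub>0 'k"
  let ?t = "(?T (r + c) - ?T r - ?T c) + (?T c - ?T (dif R y) - ?T s) + ?T s"
  have "trace_entry E n (r + c) - trace_entry E n r = d (trace_entry E (Suc n) y) + ?t"
    by (simp add: d_trace)
  moreover have "?t \<in> J"
    unfolding c[symmetric] using assms gr s
    by (intro psmul.subspace_add[OF subspace_J] I_subset_J trace_nat_rel trace_add
        trace_add[of "dif R y" n s, folded c])
  moreover have "?t \<in> W" "?t \<in> of_wdeg n"
    using assms gr s subspace_add[OF gr_subspace]
    by (intro W_closed(4,5) trace_W psmul.subspace_add psmul.subspace_diff subspace_of_wdeg trace_of_wdeg; simp)+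
  ultimately show "trace_entry E n (r + c) - trace_entry E n r \<in> boundaries (reduced_rep_cx R E) n"
    unfolding boundaries_def using trace_W[OF y] trace_of_wdeg[of "Suc n" y]
    by (intro CollectI exI[of _ "trace_entry E (Suc n) y"] exI[of _ ?t]) (simp add: ch_eq)
qed

text \<open>
  If \<open>R\<^sub>V\<close> is acyclic, the value is the zero class. Otherwise it is the class
  of the trace of \<open>r\<close>, where \<open>r\<close> represents the class given by the
  Feigin--Tsygan isomorphism.
\<close>

lemma reduced_trace_invariant:
  assumes "n > 0"
  shows "reduced_trace R p E n \<alpha> \<subseteq> invariant_cycles \<and> reduced_trace R p E n \<alpha> \<noteq> {}"
proof (cases "\<forall>m. homology (rep_cx R E) m = {boundaries (rep_cx R E) m}")
  case True
  then show ?thesis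
    using coset_of_invariant_cycle[of 0 n] psmul.subspace_0[OF subspace_invariant_cycles]
    by (simp add: reduced_trace_def)
next
  case False
  obtain r where r: "feigin_tsygan R p n \<alpha> = r +o boundaries (nat_cx R) n" "r \<in> gr R n"
    "dif R r \<in> rel (nat_cx R)"
    using feigin_tsygan_class[of p n \<alpha>] by (elim N.homologyE) (auto simp: nat_cx_def)
  let ?t = "trace_entry E n r"
  have "d ?t \<in> J"
    using r \<open>n > 0\<close> trace_nat_rel[OF r(3), of "n - 1"] dif_gr[of r "n - 1"] d_trace[of "n - 1" r] by simp
  moreover have "?t \<in> ch (rep_cx R E) n"
    using r trace_W trace_of_wdeg by (simp add: ch_eq)
  ultimately have dt: "d ?t \<in> I"
    using unreduced_cycle[OF False] \<open>n > 0\<close> by blast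
  have "reduced_trace R p E n \<alpha> = ?t +o boundaries (rep_cx R E) n"
  proof -
    have "the_inv_into (homology (rep_cx R E) n) (induced id (reduced_rep_cx R E) n)
        (?t +o boundaries (reduced_rep_cx R E) n) = ?t +o boundaries (rep_cx R E) n"
      by (intro the_inv_into_f_eq inj_on_unreduced_homology \<open>n > 0\<close> induced_id_reduced K.homologyI dt) fact
    then show ?thesis
      by (simp only: reduced_trace_def if_not_P[OF False] r(1) induced_trace[OF r(2)])
  qed
  then show ?thesis
    using coset_of_invariant_cycle[OF trace_invariant[OF r(2) dt], of n] by simp
qed

end

section \<open>Conjugation by GL(V)\<close>

lemma mat_entry_compose:
  fixes E :: "'v::ab_group_add set" and s :: "'k::field \<Rightarrow> 'v \<Rightarrow> 'v"
  assumes V: "finite_dimensional_vector_space s E"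
    and g: "Vector_Spaces.linear s s g" and h: "\<And>v. g (h v) = v"
    and "a \<in> E" "c \<in> E"
  shows "(\<Sum>b\<in>E. mat_entry s E g a b * mat_entry s E h b c) = of_bool (a = c)"
proof -
  interpret V: finite_dimensional_vector_space s E by (rule V)
  interpret g: Vector_Spaces.linear s s g by (rule g)
  have span: "v \<in> V.span E" for v by (simp add: V.span_Basis)
  have "(\<Sum>b\<in>E. s (V.representation E (h c) b) b) = h c"
    by (rule V.sum_representation_eq) (simp_all add: V.independent_Basis V.finite_Basis span)
  then have "g (\<Sum>b\<in>E. s (V.representation E (h c) b) b) = c" by (simp add: h)
  then have "(\<Sum>b\<in>E. s (mat_entry s E h b c) (g b)) = c"
    by (simp add: g.sum g.scale mat_entry_def)
  then have "V.representation E (\<Sum>b\<in>E. s (mat_entry s E h b c) (g b)) a = V.representation E c a"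
    by simp
  moreover have "V.representation E (\<Sum>b\<in>E. s (mat_entry s E h b c) (g b)) a =
      (\<Sum>b\<in>E. mat_entry s E h b c * mat_entry s E g a b)"
    by (simp add: V.representation_sum V.representation_scale V.independent_Basis span mat_entry_def)
  moreover have "V.representation E c a = of_bool (a = c)"
    using V.representation_basis[OF V.independent_Basis \<open>c \<in> E\<close>] by auto
  ultimately show ?thesis by (simp add: mult.commute)
qed

lemma inverse_matrices_general_linear:
  fixes E :: "'v::ab_group_add set" and s :: "'k::field \<Rightarrow> 'v \<Rightarrow> 'v"
  assumes V: "finite_dimensional_vector_space s E" and g: "g \<in> general_linear s"
  shows "inverse_matrices E (mat_entry s E (inv g)) (mat_entry s E g)"
proof -
  interpret V: finite_dimensional_vector_space s E by (rule V)
  have lin: "Vector_Spaces.linear s s g" and bij: "bij g"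
    using g by (auto simp: general_linear_def)
  interpret g: Vector_Spaces.linear s s g by (rule lin)
  have g_inv: "g (inv g v) = v" and inv_g: "inv g (g v) = v" for v
    using bij by (simp_all add: bij_is_surj surj_f_inv_f bij_is_inj)
  have "inv g (u + v) = inv g u + inv g v" for u v
    by (metis g.add g_inv inv_g)
  moreover have "inv g (s c v) = s c (inv g v)" for c v
    by (metis g.scale g_inv inv_g)
  ultimately have "Vector_Spaces.linear s s (inv g)"
    by unfold_locales
  then show ?thesis
    unfolding inverse_matrices_def
    using mat_entry_compose[OF V lin] mat_entry_compose[OF V] g_inv inv_g by simp
qed

text \<open>
  The passage from representatives to \<open>GL_invariants\<close>.
\<close>

lemma invariant_cycle_class:
  fixes R :: "('k::field, 'r::ring) dga" and E :: "'v::ab_group_add set"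
  assumes R: "representation_algebra R E" and V: "finite_dimensional_vector_space s E" 
    and z: "z \<in> representation_algebra.invariant_cycles R E"
  shows "z +o boundaries_tot (rep_cx R E) \<in> GL_invariants s E R"
proof -
  interpret representation_algebra R E by (rule R)
  have "z +o B \<in> homology_tot (rep_cx R E)"
    using z by (auto simp: homology_tot_def gr_sum_eq invariant_cycles_def)
  moreover have "induced_tot (GL_act s E g) (rep_cx R E) (z +o B) = z +o B"
    if g: "g \<in> general_linear s" for g
  proof -
    note inverse = inverse_matrices_general_linear[OF V g]
    have GL_act: "GL_act s E g = conj_act E (mat_entry s E (inv g)) (mat_entry s E g)"
      by (simp add: GL_act_def conj_act_def fun_eq_iff)
    have "induced_tot (GL_act s E g) (rep_cx R E) (z +o B) = GL_act s E g z +o B"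
      unfolding induced_tot_def
      by (rule psmul.UN_coset) (simp_all add: subspace_B B_closed GL_act act_add act_B[OF inverse])
    also have "\<dots> = z +o B"
      using z inverse unfolding GL_act psmul.coset_eq_iff[OF subspace_B] invariant_cycles_def by blast
    finally show ?thesis .
  qed
  ultimately show ?thesis by (simp add: GL_invariants_def)
qed

lemma linear_complex_cyclic_cx: "linear_complex psmul (cyclic_cx R)"
proof (intro linear_complex.intro vector_space_psmul linear_complex_axioms.intro)
  have ch: "ch (cyclic_cx R) n = {x. Poly_Mapping.keys x \<subseteq>
      {w. w \<in> hom_words R \<and> w \<noteq> [] \<and> length w - 1 + wdeg w = n}}" for n
    by (auto simp: cyclic_cx_def)
  show "psmul.subspace (ch (cyclic_cx R) n)" for n
    unfolding ch by (rule subspace_keys_subset)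
qed (simp_all add: cyclic_cx_def psmul.subspace_span linear_lext_psmul)

lemma linear_complex_reduced_cyclic_cx: "linear_complex psmul (reduced_cyclic_cx R)"
  using linear_complex_cyclic_cx[of R]
  by (simp add: linear_complex_def linear_complex_axioms_def reduced_cyclic_cx_def psmul.subspace_span)

section \<open>The trace in degree 0\<close>

lemma (in unital_algebra) dg_algebra_in_degree_0: "dg_algebra (in_degree_0 scale e)"
proof (intro dg_algebra.intro dg_algebra_axioms.intro)
  show "unital_algebra (smul (in_degree_0 scale e)) (unt (in_degree_0 scale e))"
    using unital_algebra_axioms by (simp add: in_degree_0_def)
  show "gr_sum (gr (in_degree_0 scale e)) = UNIV"
  proof -
    have "x \<in> gr_sum (gr (in_degree_0 scale e))" for x
      unfolding gr_sum_def in_degree_0_def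
      by (intro CollectI exI[of _ 1] exI[of _ "\<lambda>n. if n = 0 then x else 0"]) simp
    then show ?thesis by blast
  qed
  fix f :: "nat \<Rightarrow> 'a" and N n
  assume f: "\<forall>i. f i \<in> gr (in_degree_0 scale e) i" "(\<Sum>i<N. f i) = 0" "n < N"
  have f0: "f i = 0" if "i \<noteq> 0" for i
    using spec[OF f(1), of i] that by (simp add: in_degree_0_def)
  have "(\<Sum>i<N. f i) = f 0"
    using f(3) f0 by (subst sum.mono_neutral_right[of _ "{0}"]) auto
  then show "f n = 0" using f(2) f0 by (cases "n = 0") auto
next
  show "Vector_Spaces.linear (smul (in_degree_0 scale e)) (smul (in_degree_0 scale e)) (dif (in_degree_0 scale e))"
    unfolding in_degree_0_def dga.simps by unfold_locales simp_all
qed (auto simp: in_degree_0_def subspace_single_0 subspace_UNIV)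

lemma free_deriv_degree_0: "x \<in> of_wdeg 0 \<Longrightarrow> free_deriv \<delta> x = 0"
proof -
  assume x: "x \<in> of_wdeg 0"
  have "free_deriv \<delta> x \<in> {0}"
  proof (rule lext_in_subspace[OF psmul.subspace_single_0])
    fix w assume "w \<in> Poly_Mapping.keys x"
    then have "wdeg w = 0" using x by (auto simp: of_wdeg_def)
    then show "letterwise_d \<delta> w \<in> {0}"
      unfolding letterwise_d_def by (intro singletonI iffD2[OF singleton_iff] sum.neutral) (auto simp: wdeg_def)
  qed
  then show ?thesis by simp
qed

locale degree_0_resolution =
  representation_algebra R E + alg: unital_algebra scA e
  for R :: "('k::field, 'r::ring) dga" and E :: "'v set"
    and scA :: "'k \<Rightarrow> 'a::ring \<Rightarrow> 'a" and e :: 'a +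
  fixes p :: "'r \<Rightarrow> 'a"
  assumes resolution: "almost_free_resolution R (in_degree_0 scA e) p"
begin

abbreviation "A \<equiv> in_degree_0 scA e"

lemma A_simps [simp]: "smul A = scA" "unt A = e" "gr A n = (if n = 0 then UNIV else {0})" "dif A x = 0"
  by (simp_all add: in_degree_0_def)

sublocale A: representation_algebra A E
  using alg.dg_algebra_in_degree_0 finite_E
  by (simp add: representation_algebra_def representation_algebra_axioms_def)

lemma p_hom: "dg_hom R A p" and surj_p: "surj p" and p_quasi_iso: "quasi_iso p (dga_cx R) (dga_cx A)"
  using resolution by (auto simp: almost_free_resolution_def)

lemma p_linear: "Vector_Spaces.linear (smul R) scA p"
  using p_hom by (simp add: dg_hom_def)

interpretation p: Vector_Spaces.linear "smul R" scA p by (rule p_linear)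

lemma p_mult: "p (x * y) = p x * p y" and p_unt: "p (unt R) = e" and p_dif: "p (dif R x) = 0"
  using p_hom by (auto simp: dg_hom_def)

lemma p_gr: "x \<in> gr R n \<Longrightarrow> p x \<in> gr A n"
  using p_hom unfolding dg_hom_def by blast

lemma p_positive: "x \<in> gr R n \<Longrightarrow> n > 0 \<Longrightarrow> p x = 0"
  using p_gr[of x n] by simp

text \<open>
  \<open>p\<close> is surjective and kills all positive degrees, as \<open>A\<close> lives in
  degree 0.
\<close>

lemma degree_0_lift: "\<exists>r\<in>gr R 0. p r = a"
proof -
  obtain x where x: "a = p x" using surj_p by blast
  have "x \<in> gr_sum (gr R)" by (simp add: gr_sum_UNIV)
  then obtain N f where f: "x = (\<Sum>n<N. f n)" "\<forall>n. f n \<in> gr R n" unfolding gr_sum_def by blast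
  show ?thesis
  proof (cases N)
    case 0
    then show ?thesis using x f subspace_0[OF gr_subspace]
      by (intro bexI[of _ 0]) auto
  next
    case (Suc M)
    have "p x = p (f 0) + (\<Sum>n<M. p (f (Suc n)))"
      unfolding f(1) Suc p.sum by (rule sum.lessThan_Suc_shift)
    also have "(\<Sum>n<M. p (f (Suc n))) = 0"
      using f(2) p_positive by (intro sum.neutral) blast
    finally show ?thesis using x f(2) by auto
  qed
qed

definition lift :: "'a \<Rightarrow> 'r" where "lift a = (SOME r. r \<in> gr R 0 \<and> p r = a)"

lemma lift_gr: "lift a \<in> gr R 0" and p_lift: "p (lift a) = a"
  using someI_ex[of "\<lambda>r. r \<in> gr R 0 \<and> p r = a"] degree_0_lift[of a] by (auto simp: lift_def)

text \<open>
  Injectivity of the isomorphism \<open>H\<^sub>0(R) \<rightarrow> A\<close>.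
\<close>

lemma kernel_p:
  assumes r: "r \<in> gr R 0" and "p r = 0"
  shows "\<exists>y\<in>gr R 1. r = dif R y"
proof -
  have "linear_complex (smul R) (dga_cx R)"
    by (intro linear_complex.intro vector_space_axioms linear_complex_axioms.intro)
      (simp_all add: dga_cx_def gr_subspace subspace_single_0 dif_linear)
  then interpret C: linear_complex "smul R" "dga_cx R" .
  let ?b = "boundaries (dga_cx R) 0"
  have bA: "boundaries (dga_cx A) 0 = {0}"
    by (auto simp: boundaries_def dga_cx_def)
  have b: "?b = dif R ` gr R 1"
    using subspace_0[OF gr_subspace] by (auto simp: boundaries_def dga_cx_def)
  have "induced p (dga_cx A) 0 (x +o ?b) = p x +o {0}" for x
    unfolding induced_def bA
  proof (rule alg.UN_coset[OF alg.subspace_single_0])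
    show "0 \<in> ?b" by (rule subspace_0[OF C.subspace_boundaries])
    show "p (x + c) - p x \<in> {0}" if "c \<in> ?b" for c
      using that by (auto simp: b p.add p_dif)
  qed
  then have "induced p (dga_cx A) 0 (r +o ?b) = induced p (dga_cx A) 0 (0 +o ?b)"
    using \<open>p r = 0\<close> by (simp only: p.zero)
  moreover have "r +o ?b \<in> homology (dga_cx R) 0" "0 +o ?b \<in> homology (dga_cx R) 0"
    using r dif_gr_0 subspace_0[OF gr_subspace] by (intro C.homologyI; simp add: dga_cx_def)+
  ultimately have "r +o ?b = 0 +o ?b"
    using p_quasi_iso unfolding quasi_iso_def bij_betw_def by (meson inj_onD)
  then have "r - 0 \<in> ?b" by (simp only: coset_eq_iff[OF C.subspace_boundaries])
  then show ?thesis by (auto simp: b)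
qed

abbreviation "B0 \<equiv> boundaries (rep_cx R E) 0"

lemma subspace_B0: "psmul.subspace B0"
  by (rule linear_complex.subspace_boundaries[OF linear_complex_rep_cx])

lemmas B0_closed = subspace_B0[THEN psmul.subspace_0] subspace_B0[THEN psmul.subspace_add]
  subspace_B0[THEN psmul.subspace_diff] subspace_B0[THEN psmul.subspace_scale] subspace_B0[THEN psmul.subspace_sum]

lemma B0_I: "y \<in> W \<Longrightarrow> y \<in> of_wdeg 1 \<Longrightarrow> r \<in> I \<Longrightarrow> r \<in> of_wdeg 0 \<Longrightarrow> d y + r \<in> B0"
  unfolding boundaries_def ch_eq using I_W by auto

lemma B0_E:
  assumes "b \<in> B0"
  obtains y r where "b = d y + r" "y \<in> W" "y \<in> of_wdeg 1" "r \<in> I" "r \<in> of_wdeg 0"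
  using assms unfolding boundaries_def ch_eq by auto

lemma I_degree_0_B0: "r \<in> I \<Longrightarrow> r \<in> of_wdeg 0 \<Longrightarrow> r \<in> B0"
  using B0_I[of 0 r] by (simp add: W_closed d_zero psmul.subspace_0[OF subspace_of_wdeg])

lemma d_degree_0: "x \<in> of_wdeg 0 \<Longrightarrow> d x = 0"
  unfolding d_eq by (rule free_deriv_degree_0)

text \<open>
  In degree 0 every element is a cycle, so the boundaries of degree 0 are an ideal of the degree 0
  part.
\<close>

lemma B0_mult_left:
  assumes "b \<in> B0" "u \<in> W" "u \<in> of_wdeg 0"
  shows "u * b \<in> B0"
proof -
  obtain y r where b: "b = d y + r" "y \<in> W" "y \<in> of_wdeg 1" "r \<in> I" "r \<in> of_wdeg 0"
    using assms(1) by (rule B0_E)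
  have "u * b = d (u * y) + u * r"
    using assms(3) by (simp add: b(1) d_mult d_degree_0 deg_scale_of_wdeg distrib_left)
  then show ?thesis
    using b assms of_wdeg_mult[of u 0 y 1] of_wdeg_mult[of u 0 r 0] by (simp add: B0_I W_closed I_mult_left)
qed

lemma B0_mult_right:
  assumes "b \<in> B0" "u \<in> W" "u \<in> of_wdeg 0"
  shows "b * u \<in> B0"
proof -
  obtain y r where b: "b = d y + r" "y \<in> W" "y \<in> of_wdeg 1" "r \<in> I" "r \<in> of_wdeg 0"
    using assms(1) by (rule B0_E)
  have "b * u = d (y * u) + r * u"
    using assms(3) by (simp add: b(1) d_mult d_degree_0 distrib_right)
  then show ?thesis
    using b assms of_wdeg_mult[of y 1 u 0] of_wdeg_mult[of r 0 u 0] by (simp add: B0_I W_closed I_mult_right)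
qed

text \<open>
  Two lifts of the same element of \<open>A\<close> differ by some \<open>dif u\<close>, and
  \<open>(dif u)\<^sub>i\<^sub>j = d u\<^sub>i\<^sub>j\<close>.
\<close>

lemma ent_diff_B0:
  assumes "x \<in> gr R 0" "y \<in> gr R 0" "p x = p y" "i \<in> E" "j \<in> E"
  shows "ent 0 x i j - ent 0 y i j \<in> B0"
proof -
  have gr: "x - y \<in> gr R 0" by (rule subspace_diff[OF gr_subspace assms(1,2)])
  then obtain u where u: "u \<in> gr R 1" "x - y = dif R u"
    using kernel_p[of "x - y"] assms(3) by (auto simp: p.diff)
  have "ent 0 ((x - y) + y) i j - ent 0 (x - y) i j - ent 0 y i j \<in> I"
    by (rule rel_add[OF gr assms(2,4,5)])
  then have I: "ent 0 x i j - ent 0 (x - y) i j - ent 0 y i j \<in> I" by simp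
  have "ent 0 x i j - ent 0 y i j = d (ent 1 u i j) + (ent 0 x i j - ent 0 (x - y) i j - ent 0 y i j)"
    by (simp add: d_ent u(2))
  also have "\<dots> \<in> B0"
    using u assms(4,5)
    by (intro B0_I I ent_W ent_of_wdeg psmul.subspace_diff subspace_of_wdeg)
  finally show ?thesis .
qed

text \<open>
  Lifts matrix entries from \<open>A\<close> to \<open>R\<close>. The function \<open>lift\<close>
  is an arbitrary choice, not a ring homomorphism. Letters of positive degree in
  \<open>A\<^sub>V\<close> have entry 0 and are sent to 0.
\<close>

definition entry_lift :: "((nat \<times> 'a \<times> 'v \<times> 'v) list \<Rightarrow>\<^sub>0 'k) \<Rightarrow> ((nat \<times> 'r \<times> 'v \<times> 'v) list \<Rightarrow>\<^sub>0 'k)" where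
  "entry_lift = alg_ext psmul 1 (\<lambda>(m, a, i, j). if m = 0 then ent 0 (lift a) i j else 0)"

lemma entry_lift_ent: "entry_lift (A.ent m a i j) = (if m = 0 then ent 0 (lift a) i j else 0)"
  by (simp add: entry_lift_def alg_ext_letter)

lemma
  shows entry_lift_add: "entry_lift (x + y) = entry_lift x + entry_lift y"
    and entry_lift_diff: "entry_lift (x - y) = entry_lift x - entry_lift y"
    and entry_lift_scale: "entry_lift (psmul c x) = psmul c (entry_lift x)"
    and entry_lift_zero: "entry_lift 0 = 0"
    and entry_lift_sum: "entry_lift (sum h S) = (\<Sum>s\<in>S. entry_lift (h s))"
    and entry_lift_mult: "entry_lift (x * y) = entry_lift x * entry_lift y"
    and entry_lift_one: "entry_lift 1 = 1"
  unfolding entry_lift_def by (rule alg_ext_linear alg_ext_hom)+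

lemmas entry_lift_simps = entry_lift_add entry_lift_diff entry_lift_scale entry_lift_zero entry_lift_sum entry_lift_mult entry_lift_one entry_lift_ent

lemma entry_lift_W:
  assumes "x \<in> A.W"
  shows "entry_lift x \<in> W \<inter> of_wdeg 0"
  unfolding entry_lift_def
proof (rule alg_ext_in_subalgebra[OF _ _ _ _ assms])
  show "psmul.subspace (W \<inter> of_wdeg 0)"
    by (intro psmul.subspace_inter subspace_words_over subspace_of_wdeg)
  then have "0 \<in> W \<inter> of_wdeg 0" by (rule psmul.subspace_0)
  then show "(case g of (m, a, i, j) \<Rightarrow> if m = 0 then ent 0 (lift a) i j else 0) \<in> W \<inter> of_wdeg 0"
    if "g \<in> rep_gens A E" for g
    using that by (cases g) (auto simp: A.gen_iff ent_of_wdeg intro: ent_W lift_gr)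
  show "x * y \<in> W \<inter> of_wdeg 0" if "x \<in> W \<inter> of_wdeg 0" "y \<in> W \<inter> of_wdeg 0" for x y
    using that of_wdeg_mult[of x 0 y 0] by (simp add: W_closed)
  show "1 \<in> W \<inter> of_wdeg 0" by (simp add: W_closed of_wdeg_one)
qed

text \<open>
  The lift satisfies the relations of \<open>A\<^sub>V\<close> up to boundaries: \<open>lift (x +
  y)\<close> and \<open>lift x + lift y\<close>, for instance, are lifts of the same element. A
  relation with a letter of positive degree becomes 0, because all its terms contain such a
  letter.
\<close>

lemma entry_lift_I:
  assumes "r \<in> A.I"
  shows "entry_lift r \<in> B0"
proof -
  note gr = lift_gr subspace_add[OF gr_subspace lift_gr lift_gr] subspace_scale[OF gr_subspace lift_gr]
  have rel: "entry_lift r \<in> B0" if "r \<in> rep_rel A E" for r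
    using that
  proof (cases rule: A.rep_rel_cases)
    case (add m x y i j)
    show ?thesis
    proof (cases "m = 0")
      case True
      have "entry_lift r = (ent 0 (lift (x + y)) i j - ent 0 (lift x + lift y) i j)
          + (ent 0 (lift x + lift y) i j - ent 0 (lift x) i j - ent 0 (lift y) i j)"
        by (simp add: add(1) True entry_lift_simps)
      also have "\<dots> \<in> B0"
        using add(4,5)
        by (intro B0_closed(2) ent_diff_B0 I_degree_0_B0 rel_add gr psmul.subspace_diff subspace_of_wdeg
            ent_of_wdeg) (simp_all add: p_lift p.add)
      finally show ?thesis .
    qed (simp add: add(1) entry_lift_simps B0_closed)
  next
    case (scale m c x i j)
    show ?thesis
    proof (cases "m = 0")
      case True
      have "entry_lift r = (ent 0 (lift (scA c x)) i j - ent 0 (smul R c (lift x)) i j)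
          + (ent 0 (smul R c (lift x)) i j - psmul c (ent 0 (lift x) i j))"
        by (simp add: scale(1) True entry_lift_simps)
      also have "\<dots> \<in> B0"
        using scale(3,4)
        by (intro B0_closed(2) ent_diff_B0 I_degree_0_B0 rel_scale gr psmul.subspace_diff psmul.subspace_scale
            subspace_of_wdeg ent_of_wdeg) (simp_all add: p_lift p.scale)
      finally show ?thesis .
    qed (simp add: scale(1) entry_lift_simps B0_closed)
  next
    case (mult m n x y i j)
    show ?thesis
    proof (cases "m + n = 0")
      case True
      have gr': "lift x * lift y \<in> gr R 0" using mult_gr[OF lift_gr lift_gr, of x y] by simp
      have I: "ent 0 (lift x * lift y) i j - (\<Sum>l\<in>E. ent 0 (lift x) i l * ent 0 (lift y) l j) \<in> I"
        using rel_mult[OF lift_gr lift_gr mult(4,5), of x y] by simp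
      have deg: "ent 0 (lift x * lift y) i j - (\<Sum>l\<in>E. ent 0 (lift x) i l * ent 0 (lift y) l j) \<in> of_wdeg 0"
        using of_wdeg_mult[OF ent_of_wdeg ent_of_wdeg, of 0 _ _ _ 0]
        by (intro psmul.subspace_diff psmul.subspace_sum subspace_of_wdeg ent_of_wdeg) simp
      have "entry_lift r = (ent 0 (lift (x * y)) i j - ent 0 (lift x * lift y) i j)
          + (ent 0 (lift x * lift y) i j - (\<Sum>l\<in>E. ent 0 (lift x) i l * ent 0 (lift y) l j))"
        using True by (simp add: mult(1) entry_lift_simps)
      also have "\<dots> \<in> B0"
        using mult(4,5)
        by (intro B0_closed(2) ent_diff_B0 I_degree_0_B0 I deg gr gr') (simp_all add: p_lift p_mult)
      finally show ?thesis .
    next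
      case False
      then have "entry_lift r = 0" by (auto simp: mult(1) entry_lift_simps)
      then show ?thesis by (simp add: B0_closed)
    qed
  next
    case (unit i j)
    have "of_bool (i = j) \<in> (of_wdeg 0 :: ((nat \<times> 'r \<times> 'v \<times> 'v) list \<Rightarrow>\<^sub>0 'k) set)"
      using of_wdeg_one psmul.subspace_0[OF subspace_of_wdeg] by (cases "i = j") auto
    then have "ent 0 (unt R) i j - of_bool (i = j) \<in> B0"
      using unit by (intro I_degree_0_B0 rel_unit psmul.subspace_diff subspace_of_wdeg ent_of_wdeg)
    moreover have "ent 0 (lift e) i j - ent 0 (unt R) i j \<in> B0"
      by (rule ent_diff_B0[OF lift_gr unt_gr _ unit(2,3)]) (simp add: p_lift p_unt)
    moreover have "entry_lift r = (ent 0 (lift e) i j - ent 0 (unt R) i j) + (ent 0 (unt R) i j - of_bool (i = j))"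
      by (cases "i = j") (simp_all add: unit(1) entry_lift_simps)
    ultimately show ?thesis
      by (simp only: B0_closed(2))
  next
    case (comm m x i j n y k l)
    show ?thesis
    proof (cases "m = 0 \<and> n = 0")
      case True
      have "entry_lift r = ent 0 (lift x) i j * ent 0 (lift y) k l - psmul ((-1) ^ (0 * 0)) (ent 0 (lift y) k l * ent 0 (lift x) i j)"
        using True by (simp add: comm(1) entry_lift_simps)
      also have "\<dots> \<in> B0"
        using of_wdeg_mult[OF ent_of_wdeg ent_of_wdeg, of 0 _ _ _ 0] comm
        by (intro I_degree_0_B0 rel_comm lift_gr psmul.subspace_diff psmul.subspace_scale subspace_of_wdeg) simp_all
      finally show ?thesis .
    next
      case False
      then have "entry_lift r = 0" by (auto simp: comm(1) entry_lift_simps)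
      then show ?thesis by (simp add: B0_closed)
    qed
  qed
  show ?thesis
    using assms unfolding A.rel_eq
  proof (induction rule: ideal_gen_induct)
    case (generator u r v)
    have "entry_lift (basis_vec u) \<in> W \<inter> of_wdeg 0" "entry_lift (basis_vec v) \<in> W \<inter> of_wdeg 0"
      using generator by (intro entry_lift_W; simp add: words_over_basis)+
    then show ?case
      using rel[OF generator(2)] by (simp add: entry_lift_mult B0_mult_left B0_mult_right)
  qed (simp_all add: entry_lift_simps B0_closed)
qed

text \<open>
  The algebra map \<open>R\<^sub>V \<rightarrow> A\<^sub>V\<close> induced by \<open>p\<close>, at
  the types of this locale.
\<close>

abbreviation p_V :: "((nat \<times> 'r \<times> 'v \<times> 'v) list \<Rightarrow>\<^sub>0 'k) \<Rightarrow> ((nat \<times> 'a \<times> 'v \<times> 'v) list \<Rightarrow>\<^sub>0 'k)" where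
  "p_V \<equiv> rep_map p"

lemma rep_map_eq_alg_ext: "p_V = alg_ext psmul 1 (\<lambda>(m, x, i, j). A.ent m (p x) i j)"
proof -
  have "basis_vec (map (\<lambda>(m, x, i, j). (m, p x, i, j)) w) =
      foldr (\<lambda>g y. (case g of (m, x, i, j) \<Rightarrow> A.ent m (p x) i j) * y) w 1" for w :: "(nat \<times> 'r \<times> 'v \<times> 'v) list"
  proof (induction w)
    case Nil show ?case by (simp add: basis_vec_Nil)
  next
    case (Cons g w)
    obtain m x i j where g: "g = (m, x, i, j)" by (cases g)
    show ?case using Cons
      by (simp add: g basis_vec_Cons[of "(m, p x, i, j)" "map _ w"])
  qed
  then show ?thesis by (simp only: rep_map_def alg_ext_def)
qed

lemma rep_map_ent: "p_V (ent m x i j) = A.ent m (p x) i j"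
  by (simp add: rep_map_eq_alg_ext alg_ext_letter)

lemma
  shows rep_map_add: "p_V (x + y) = p_V x + p_V y"
    and rep_map_diff: "p_V (x - y) = p_V x - p_V y"
    and rep_map_scale: "p_V (psmul c x) = psmul c (p_V x)"
    and rep_map_zero: "p_V 0 = 0"
    and rep_map_sum: "p_V (sum h S) = (\<Sum>s\<in>S. p_V (h s))"
    and rep_map_mult: "p_V (x * y) = p_V x * p_V y"
    and rep_map_one: "p_V 1 = 1"
  unfolding rep_map_eq_alg_ext by (rule alg_ext_linear alg_ext_hom)+

lemmas rep_map_simps = rep_map_add rep_map_diff rep_map_scale rep_map_zero rep_map_sum rep_map_mult
  rep_map_one rep_map_ent

lemma rep_map_letter: "g \<in> rep_gens R E \<Longrightarrow> (case g of (m, x, i, j) \<Rightarrow> A.ent m (p x) i j) \<in> A.W"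
  by (cases g) (auto simp: gen_iff intro!: A.ent_W dest: p_gr)

lemma rep_map_W: "x \<in> W \<Longrightarrow> p_V x \<in> A.W"
  unfolding rep_map_eq_alg_ext using rep_map_letter by (rule alg_ext_words_over)

lemma rep_map_of_wdeg: "x \<in> of_wdeg n \<Longrightarrow> p_V x \<in> of_wdeg n"
  unfolding rep_map_def
proof (rule lext_in_subspace[OF subspace_of_wdeg])
  fix w assume "x \<in> of_wdeg n" "w \<in> Poly_Mapping.keys x"
  then have "wdeg w = n" by (simp add: of_wdeg_def)
  moreover have "wdeg (map (\<lambda>(m, x, i, j). (m, p x, i, j)) w) = wdeg w"
    unfolding wdeg_def map_map by (rule arg_cong[where f = sum_list]) auto
  ultimately show "basis_vec (map (\<lambda>(m, x, i, j). (m, p x, i, j)) w) \<in> of_wdeg n"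
    by (simp add: of_wdeg_basis)
qed

lemma rep_map_d: "p_V (d x) = A.d (p_V x)"
proof (induction x rule: free_induct)
  case (word w)
  show ?case
  proof (induction w)
    case Nil
    show ?case by (simp add: basis_vec_Nil d_one A.d_one rep_map_simps)
  next
    case (Cons g w)
    obtain m x i j where g: "g = (m, x, i, j)" by (cases g)
    have cons: "basis_vec (g # w) = ent m x i j * basis_vec w"
      unfolding g by (rule basis_vec_Cons)
    have "p_V (d (ent m x i j)) = A.d (p_V (ent m x i j))"
      by (simp add: d_ent A.d_ent rep_map_simps p_dif)
    moreover have "p_V (koszul (ent m x i j)) = koszul (p_V (ent m x i j))"
      by (simp add: koszul_ent A.koszul_ent rep_map_simps)
    ultimately show ?case
      unfolding cons by (simp only: d_mult A.d_mult rep_map_mult rep_map_add Cons)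
  qed
qed (simp_all only: d_add d_scale d_zero A.d_add A.d_scale A.d_zero rep_map_simps)

lemma rep_map_I:
  assumes "r \<in> I"
  shows "p_V r \<in> A.I"
proof -
  have rel: "p_V r \<in> A.I" if "r \<in> rep_rel R E" for r
    using that
  proof (cases rule: rep_rel_cases)
    case (add m x y i j)
    then show ?thesis using A.rel_add[OF p_gr p_gr] by (simp add: rep_map_simps p.add)
  next
    case (scale m c x i j)
    then show ?thesis using A.rel_scale[OF p_gr, of x m i j c] by (simp add: rep_map_simps p.scale)
  next
    case (mult m n x y i j)
    then show ?thesis using A.rel_mult[OF p_gr p_gr, of x m y n i j] by (simp add: rep_map_simps p_mult)
  next
    case (unit i j)
    then show ?thesis using A.rel_unit[of i j] by (cases "i = j") (simp_all add: rep_map_simps p_unt)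
  next
    case (comm m x i j n y k l)
    then show ?thesis using A.rel_comm[OF p_gr _ _ p_gr, of x m i j y n k l] by (simp add: rep_map_simps)
  qed
  show ?thesis
    using alg_ext_ideal_gen[OF rep_map_letter rel[unfolded rep_map_eq_alg_ext A.rel_eq] assms[unfolded rel_eq]]
    by (simp add: rep_map_eq_alg_ext A.rel_eq)
qed

text \<open>
  Both maps are multiplicative and the boundaries are an ideal, so this reduces to letters, where
  it is \<open>ent_diff_B0\<close>.
\<close>

lemma entry_lift_rep_map:
  assumes "x \<in> W" "x \<in> of_wdeg 0"
  shows "entry_lift (rep_map p x) - x \<in> B0"
proof -
  have word: "entry_lift (rep_map p (basis_vec w)) - basis_vec w \<in> B0"
    if "w \<in> lists (rep_gens R E)" "wdeg w = 0" for w
    using that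
  proof induction
    case Nil
    show ?case by (simp add: basis_vec_Nil rep_map_simps entry_lift_simps B0_closed)
  next
    case (Cons g w)
    obtain m x i j where g: "g = (m, x, i, j)" by (cases g)
    have m: "m = 0" and "wdeg w = 0" using Cons.prems by (auto simp: g)
    have x: "x \<in> gr R 0" "i \<in> E" "j \<in> E" using Cons.hyps by (auto simp: g gen_iff m)
    have w: "basis_vec w \<in> W" "basis_vec w \<in> of_wdeg 0"
      using Cons.hyps \<open>wdeg w = 0\<close> by (auto simp: words_over_basis of_wdeg_basis)
    have cons: "basis_vec (g # w) = ent 0 x i j * basis_vec w"
      unfolding g m by (rule basis_vec_Cons)
    have letter: "ent 0 (lift (p x)) i j \<in> W" "ent 0 (lift (p x)) i j \<in> of_wdeg 0"
      using x by (auto intro: ent_W lift_gr ent_of_wdeg)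
    have "entry_lift (rep_map p (basis_vec (g # w))) - basis_vec (g # w) =
        ent 0 (lift (p x)) i j * (entry_lift (rep_map p (basis_vec w)) - basis_vec w)
        + (ent 0 (lift (p x)) i j - ent 0 x i j) * basis_vec w"
      unfolding cons by (simp add: rep_map_simps entry_lift_simps right_diff_distrib left_diff_distrib)
    also have "\<dots> \<in> B0"
      using Cons.IH[OF \<open>wdeg w = 0\<close>] ent_diff_B0[OF lift_gr x(1) _ x(2,3), of "p x"] w letter
      by (intro B0_closed(2) B0_mult_left B0_mult_right) (simp_all add: p_lift)
    finally show ?case .
  qed
  have "basis_vec w \<in> {x. entry_lift (rep_map p x) - x \<in> B0}" if "w \<in> Poly_Mapping.keys x" for w
  proof -
    have "w \<in> lists (rep_gens R E)" "wdeg w = 0"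
      using that assms unfolding words_over_def of_wdeg_def by blast+
    then show ?thesis using word by simp
  qed
  then have "entry_lift (rep_map p x) - x \<in> B0" if "psmul.subspace {x. entry_lift (rep_map p x) - x \<in> B0}"
    using linear_comb_in_subspace[OF that] by blast
  moreover have "psmul.subspace {x. entry_lift (rep_map p x) - x \<in> B0}"
  proof (rule psmul.subspaceI)
    fix x y assume xy: "x \<in> {x. entry_lift (rep_map p x) - x \<in> B0}" "y \<in> {x. entry_lift (rep_map p x) - x \<in> B0}"
    have "entry_lift (rep_map p (x + y)) - (x + y) = (entry_lift (rep_map p x) - x) + (entry_lift (rep_map p y) - y)"
      by (simp add: rep_map_simps entry_lift_simps)
    then show "x + y \<in> {x. entry_lift (rep_map p x) - x \<in> B0}"
      using xy by (simp only: mem_Collect_eq B0_closed(2))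
  next
    fix c x assume x: "x \<in> {x. entry_lift (rep_map p x) - x \<in> B0}"
    have "entry_lift (rep_map p (psmul c x)) - psmul c x = psmul c (entry_lift (rep_map p x) - x)"
      by (simp add: rep_map_simps entry_lift_simps psmul.scale_right_diff_distrib)
    then show "psmul c x \<in> {x. entry_lift (rep_map p x) - x \<in> B0}"
      using x by (simp only: mem_Collect_eq B0_closed(4))
  qed (simp add: rep_map_simps entry_lift_simps B0_closed)
  ultimately show ?thesis by blast
qed

text \<open>
  The differential of \<open>A\<close> is 0, hence that of \<open>A\<^sub>V\<close> is 0 modulo
  relations.
\<close>

lemma A_d_I:
  assumes "x \<in> A.W"
  shows "A.d x \<in> A.I"
proof -
  have word: "A.d (basis_vec w) \<in> A.I" if "w \<in> lists (rep_gens A E)" for w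
    using that
  proof induction
    case Nil
    show ?case by (simp add: basis_vec_Nil A.d_one A.I_closed)
  next
    case (Cons g w)
    obtain m x i j where g: "g = (m, x, i, j)" by (cases g)
    have cons: "basis_vec (g # w) = A.ent m x i j * basis_vec w"
      unfolding g by (rule basis_vec_Cons)
    have letter: "A.d (A.ent m x i j) \<in> A.I" "koszul (A.ent m x i j) \<in> A.W"
      using Cons.hyps(1)
      by (auto simp: g A.gen_iff A.d_ent A.I_closed A.rel_zero intro!: deg_scale_words_over A.ent_W)
    show ?case
      unfolding cons A.d_mult using Cons letter
      by (intro A.I_closed(2) A.I_mult_left A.I_mult_right) (auto simp: words_over_basis)
  qed
  moreover have "w \<in> lists (rep_gens A E)" if "w \<in> Poly_Mapping.keys x" for w
    using assms that by (auto simp: words_over_def)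
  ultimately show ?thesis
    by (intro free_induct[where P = "\<lambda>x. A.d x \<in> A.I" and x = x])
      (simp_all add: A.d_zero A.d_add A.d_scale A.I_closed)
qed

abbreviation "BA0 \<equiv> boundaries (rep_cx A E) 0"

lemma subspace_BA0: "psmul.subspace BA0"
  by (rule linear_complex.subspace_boundaries[OF A.linear_complex_rep_cx])

lemma BA0_iff: "x \<in> BA0 \<longleftrightarrow> x \<in> A.I \<and> x \<in> of_wdeg 0"
proof
  assume "x \<in> BA0"
  then obtain y r where x: "x = A.d y + r" "y \<in> A.W" "y \<in> of_wdeg 1" "r \<in> A.I" "r \<in> of_wdeg 0"
    unfolding boundaries_def A.ch_eq by auto
  have "A.d y \<in> of_wdeg 0" using A.d_of_wdeg[OF x(3)] by simp
  then show "x \<in> A.I \<and> x \<in> of_wdeg 0"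
    unfolding x(1) using x A_d_I by (auto intro: A.I_closed psmul.subspace_add subspace_of_wdeg)
next
  assume "x \<in> A.I \<and> x \<in> of_wdeg 0"
  moreover have "0 \<in> A.W \<inter> of_wdeg (Suc 0)"
    by (intro IntI A.W_closed psmul.subspace_0 subspace_of_wdeg)
  ultimately show "x \<in> BA0"
    unfolding boundaries_def A.ch_eq using A.I_W[of x]
    by (intro CollectI, rule_tac x = 0 in exI, rule_tac x = x in exI) (simp add: A.d_zero)
qed

lemma induced_rep_map:
  "induced (rep_map p) (rep_cx A E) 0 (x +o B0) = rep_map p x +o BA0"
  unfolding induced_def
proof (rule psmul.UN_coset[OF subspace_BA0])
  show "0 \<in> B0" by (rule B0_closed)
  fix c assume "c \<in> B0"
  then obtain y r where c: "c = d y + r" "y \<in> W" "y \<in> of_wdeg 1" "r \<in> I" "r \<in> of_wdeg 0"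
    by (rule B0_E)
  have "c \<in> of_wdeg 0"
    unfolding c(1) using d_of_wdeg[OF c(3)] c(5) by (intro psmul.subspace_add subspace_of_wdeg) simp_all
  moreover have "rep_map p c \<in> A.I"
    using c by (simp add: rep_map_add rep_map_d A_d_I rep_map_W rep_map_I A.I_closed)
  ultimately show "rep_map p (x + c) - rep_map p x \<in> BA0"
    by (simp add: BA0_iff rep_map_add rep_map_of_wdeg)
qed

text \<open>
  \<open>entry_lift\<close> is a left inverse modulo boundaries.
\<close>

lemma inj_on_induced_rep_map:
  "inj_on (induced (rep_map p) (rep_cx A E) 0) (homology (rep_cx R E) 0)"
proof (rule inj_onI)
  fix X Y assume "X \<in> homology (rep_cx R E) 0" "Y \<in> homology (rep_cx R E) 0"
    and eq: "induced (rep_map p) (rep_cx A E) 0 X = induced (rep_map p) (rep_cx A E) 0 Y"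
  then obtain x y where x: "X = x +o B0" "x \<in> W" "x \<in> of_wdeg 0" and y: "Y = y +o B0" "y \<in> W" "y \<in> of_wdeg 0"
    by (auto simp: homology_def ch_eq)
  \<comment> \<open>the difference is a boundary in \<open>A\<^sub>V\<close>, and lifting it gives \<open>x - y\<close> up to a boundary\<close>
  have "rep_map p (x - y) \<in> BA0"
    using eq unfolding x(1) y(1) induced_rep_map psmul.coset_eq_iff[OF subspace_BA0] rep_map_diff .
  then have "entry_lift (rep_map p (x - y)) \<in> B0"
    by (simp add: BA0_iff entry_lift_I)
  moreover have "entry_lift (rep_map p (x - y)) - (x - y) \<in> B0"
    using x y by (intro entry_lift_rep_map W_closed psmul.subspace_diff subspace_of_wdeg)
  ultimately have "entry_lift (rep_map p (x - y)) - (entry_lift (rep_map p (x - y)) - (x - y)) \<in> B0"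
    by (rule B0_closed(3))
  then show "X = Y" unfolding x(1) y(1) psmul.coset_eq_iff[OF subspace_B0] by simp
qed

abbreviation trace_word :: "(nat \<times> 'a) list \<Rightarrow> ((nat \<times> 'a \<times> 'v \<times> 'v) list \<Rightarrow>\<^sub>0 'k)" where
  "trace_word \<equiv> \<lambda>w. if length w = 1 then trace_entry E (fst (hd w)) (snd (hd w)) else 0"

lemma trace_cyclic_rel:
  assumes "r \<in> rel (cyclic_cx A)"
  shows "lext psmul trace_word r \<in> A.I"
proof -
  have "psmul.subspace {x. lext psmul trace_word x \<in> A.I}"
    by (rule psmul.subspaceI) (simp_all add: lext_add lext_scale lext_zero A.I_closed)
  moreover have "multilin_rel A \<union> cyclic_rel A \<subseteq> {x. lext psmul trace_word x \<in> A.I}"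
  proof (intro subsetI CollectI)
    fix x assume "x \<in> multilin_rel A \<union> cyclic_rel A"
    then consider
      (add) u v m a b where "x = basis_vec (u @ (m, a + b) # v) - basis_vec (u @ (m, a) # v) - basis_vec (u @ (m, b) # v)"
        "a \<in> gr A m" "b \<in> gr A m"
    | (scale) u v m c a where "x = basis_vec (u @ (m, scA c a) # v) - psmul c (basis_vec (u @ (m, a) # v))"
        "a \<in> gr A m"
    | (cyc) w where "x = basis_vec w - cyclic_perm w" "w \<noteq> []"
      unfolding multilin_rel_def cyclic_rel_def A_simps(1) by blast
    then show "lext psmul trace_word x \<in> A.I"
    proof cases
      case add
      then show ?thesis
        using A.trace_add[OF add(2,3)]
        by (cases "u = [] \<and> v = []") (auto simp: lext_simps A.I_closed simp del: A_simps)
    next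
      case scale
      then show ?thesis
        using A.trace_scale[OF scale(2), of c]
        by (cases "u = [] \<and> v = []") (auto simp: lext_simps A.I_closed)
    next
      case cyc
      show ?thesis
      proof (cases "length w = 1")
        case True
        then obtain g where "w = [g]" by (metis One_nat_def length_0_conv length_Suc_conv)
        then show ?thesis by (simp add: cyc cyclic_perm_def lext_simps lext_psmul_single A.I_closed)
      next
        case False
        then show ?thesis
          using cyc(2) by (simp add: cyc cyclic_perm_def lext_simps lext_psmul_single A.I_closed)
      qed
    qed
  qed
  ultimately have "pspan (multilin_rel A \<union> cyclic_rel A) \<subseteq> {x. lext psmul trace_word x \<in> A.I}"
    by (rule psmul.span_minimal[rotated])
  then show ?thesis using assms by (auto simp: cyclic_cx_def)
qed

text \<open>
  In degree 1 the words are \<open>(a, b)\<close>, with boundary \<open>a b - b a\<close>, and the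
  degenerate ones consisting of a single letter of degree 1, which must be 0.
\<close>

lemma trace_cyclic_bdry:
  assumes "y \<in> ch (cyclic_cx A) 1"
  shows "lext psmul trace_word (bdry (cyclic_cx A) y) \<in> BA0"
proof -
  have "psmul.subspace {x. lext psmul trace_word x \<in> BA0}"
    by (rule psmul.subspaceI)
      (simp_all add: lext_add lext_scale lext_zero psmul.subspace_0 psmul.subspace_add psmul.subspace_scale subspace_BA0)
  then have "bdry (cyclic_cx A) y \<in> {x. lext psmul trace_word x \<in> BA0}"
    unfolding cyclic_cx_def cx.simps
  proof (rule lext_in_subspace, goal_cases)
    case (1 w)
    then have w: "w \<in> hom_words A" "w \<noteq> []" "length w - 1 + wdeg w = 1"
      using assms by (auto simp: cyclic_cx_def)
    let ?d = "letterwise_d (\<lambda>(m, x). (m - 1, dif A x)) w :: (nat \<times> 'a) list \<Rightarrow>\<^sub>0 'k"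
    have deg: "(trace_entry E 0 x :: (nat \<times> 'a \<times> 'v \<times> 'v) list \<Rightarrow>\<^sub>0 'k) \<in> of_wdeg 0" for x
      by (rule A.trace_of_wdeg)
    obtain g v where gv: "w = g # v" using w(2) by (cases w) auto
    show ?case
    proof (cases v)
      case Nil
      obtain a where w1: "w = [(1, a)]" using w(3) gv Nil by (cases g) auto
      have "?d = basis_vec [(0, 0)]"
        by (simp add: w1 letterwise_d_def)
      moreover have "(hochschild_d w :: (nat \<times> 'a) list \<Rightarrow>\<^sub>0 'k) = 0" by (simp add: w1 hochschild_d_def)
      ultimately show ?thesis
        using A.trace_zero[of 0] deg by (simp add: w1 lext_simps BA0_iff)
    next
      case (Cons h v')
      then obtain a b where w2: "w = [(0, a), (0, b)]"
        using w(3) gv by (cases g; cases h; cases v') auto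
      have "?d = 0" by (simp add: w2 letterwise_d_def lessThan_Suc)
      moreover have "hochschild_d w = basis_vec [(0, a * b)] + Poly_Mapping.single [(0, b * a)] (- 1 :: 'k)"
        by (simp add: w2 hochschild_d_def)
      moreover have "trace_entry E 0 (a * b) - trace_entry E 0 (b * a) \<in> A.I"
      proof -
        have "trace_entry E 0 (a * b - b * a) \<in> A.I"
          using A.trace_commutator[of a 0 b 0] by simp
        moreover have "trace_entry E 0 ((a * b - b * a) + b * a) - trace_entry E 0 (a * b - b * a) - trace_entry E 0 (b * a) \<in> A.I"
          by (rule A.trace_add) simp_all
        ultimately show ?thesis using A.I_closed(2) by fastforce
      qed
      ultimately show ?thesis
        using deg by (simp add: lext_simps lext_psmul_single BA0_iff psmul.subspace_diff subspace_of_wdeg)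
    qed
  qed
  then show ?thesis by simp
qed

text \<open>
  The preimage under \<open>H\<^sub>0(R\<^sub>V) \<rightarrow> A\<^sub>V\<close> of the trace of
  \<open>a\<close> is the trace of a lift of \<open>a\<close>.
\<close>

lemma trace_0_invariant:
  assumes "\<alpha> \<in> homology (cyclic_cx A) 0"
  shows "trace_0 R A p E \<alpha> \<subseteq> invariant_cycles \<and> trace_0 R A p E \<alpha> \<noteq> {}"
proof -
  obtain x where \<alpha>: "\<alpha> = x +o boundaries (cyclic_cx A) 0" and x: "x \<in> ch (cyclic_cx A) 0"
    using assms by (auto simp: homology_def)
  have word: "\<exists>a. w = [(0, a)]" if "w \<in> Poly_Mapping.keys z" "z \<in> ch (cyclic_cx A) 0" for w z
  proof -
    have "w \<noteq> []" "length w - 1 + wdeg w = 0" using that by (auto simp: cyclic_cx_def)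
    then show ?thesis by (cases w) (auto simp: prod_eq_iff)
  qed
  interpret C: linear_complex psmul "cyclic_cx A" by (rule linear_complex_cyclic_cx)
  have usual: "usual_trace A E \<alpha> = lext psmul trace_word x +o BA0"
    unfolding usual_trace_def induced_def \<alpha>
  proof (rule psmul.UN_coset[OF subspace_BA0])
    show "0 \<in> boundaries (cyclic_cx A) 0" by (rule psmul.subspace_0[OF C.subspace_boundaries])
    fix c assume "c \<in> boundaries (cyclic_cx A) 0"
    then obtain y r where c: "c = bdry (cyclic_cx A) y + r" "y \<in> ch (cyclic_cx A) 1"
      "r \<in> rel (cyclic_cx A)" "r \<in> ch (cyclic_cx A) 0"
      by (auto simp: boundaries_def)
    have "lext psmul trace_word r \<in> of_wdeg 0"
      using word[OF _ c(4)] A.trace_of_wdeg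
      by (intro lext_in_subspace[OF subspace_of_wdeg]) fastforce
    then have "lext psmul trace_word r \<in> BA0"
      using trace_cyclic_rel[OF c(3)] by (simp add: BA0_iff)
    then show "lext psmul trace_word (x + c) - lext psmul trace_word x \<in> BA0"
      using trace_cyclic_bdry[OF c(2)] by (simp add: c(1) lext_add psmul.subspace_add[OF subspace_BA0])
  qed
  define y where "y = lext psmul (\<lambda>w. trace_entry E 0 (lift (snd (hd w)))) x"
  have y_in: "y \<in> U" if "psmul.subspace U" "\<And>a. trace_entry E 0 (lift a) \<in> U" for U
    unfolding y_def using that by (rule lext_in_subspace)
  have y: "y \<in> W" "y \<in> of_wdeg 0" "y \<in> invariant_cycles"
    by (rule y_in; simp add: subspace_words_over subspace_of_wdeg subspace_invariant_cycles trace_W lift_gr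
        trace_of_wdeg trace_invariant d_degree_0 I_closed)+
  have "rep_map p y = (\<Sum>w\<in>Poly_Mapping.keys x. psmul (Poly_Mapping.lookup x w) (rep_map p (trace_entry E 0 (lift (snd (hd w))))))"
    by (simp add: y_def lext_def rep_map_sum rep_map_scale)
  also have "\<dots> = lext psmul trace_word x"
    unfolding lext_def
    by (intro sum.cong refl) (auto dest!: word[OF _ x] simp: trace_entry_def rep_map_simps p_lift)
  finally have "rep_map p y = lext psmul trace_word x" .
  moreover have "y +o B0 \<in> homology (rep_cx R E) 0"
    using y by (auto simp: homology_def ch_eq d_degree_0 I_closed)
  ultimately have "trace_0 R A p E \<alpha> = y +o B0"
    unfolding trace_0_def usual
    by (intro the_inv_into_f_eq inj_on_induced_rep_map) (simp_all add: induced_rep_map)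
  then show ?thesis using coset_of_invariant_cycle[OF y(3), of 0] by simp
qed

end

section \<open>Graded symmetric algebras\<close>

text \<open>
  The relations only involve letters that are homology classes, since these are closed under
  addition and scalar multiplication. So every representative of an element of \<open>gsym N
  K\<close> is a combination of words in homology classes.
\<close>

lemma gsym_ideal_words_over:
  assumes "linear_complex psmul K"
  shows "gsym_ideal N K \<subseteq> words_over (gsym_gens N K)"
proof -
  interpret K: linear_complex psmul K by (rule assms)
  have letter: "basis_vec [(n, X)] \<in> words_over (gsym_gens N K)" if "n \<in> N" "X \<in> homology K n" for n X
    using that by (simp add: words_over_basis gsym_gens_def)
  have comm: "comm_rel (gsym_gens N K) \<subseteq> words_over (gsym_gens N K)"
    unfolding comm_rel_def by (auto intro!: words_over_closed simp: words_over_basis)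
  show ?thesis
    unfolding gsym_ideal_def
    by (intro ideal_gen_words_over Un_least comm)
      (auto intro!: words_over_closed letter K.homology_add K.homology_scale)
qed

lemma gsym_representative:
  assumes "linear_complex psmul K" "Q \<in> gsym N K"
  shows "(SOME q. q \<in> Q) \<in> words_over (gsym_gens N K)"
proof -
  obtain x where Q: "Q = x +o gsym_ideal N K" and x: "x \<in> words_over (gsym_gens N K)"
    using assms(2) by (auto simp: gsym_def words_over_def)
  have "0 \<in> gsym_ideal N K"
    unfolding gsym_ideal_def by (rule ideal_gen_closed)
  then have "x \<in> Q" unfolding Q elt_set_plus_def by force
  then have "(SOME q. q \<in> Q) \<in> Q" by (rule someI)
  then obtain r where "(SOME q. q \<in> Q) = x + r" "r \<in> gsym_ideal N K"
    unfolding Q elt_set_plus_def by blast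
  then show ?thesis using x gsym_ideal_words_over[OF assms(1)] by (metis words_over_closed(4) subsetD)
qed

lemma gsym_ext_rep_in_subalgebra:
  assumes U: "psmul.subspace U" "1 \<in> U" "\<And>x y. x \<in> U \<Longrightarrow> y \<in> U \<Longrightarrow> x * y \<in> U"
    and T: "\<And>n X. n \<in> N \<Longrightarrow> X \<in> homology K n \<Longrightarrow> T n X \<subseteq> U \<and> T n X \<noteq> {}"
    and "linear_complex psmul K" "Q \<in> gsym N K"
  shows "gsym_ext_rep T Q \<in> U"
  unfolding gsym_ext_rep_def
proof (rule alg_ext_in_subalgebra[OF U _ gsym_representative[OF assms(5,6)]])
  fix g assume "g \<in> gsym_gens N K"
  then obtain n X where g: "g = (n, X)" "n \<in> N" "X \<in> homology K n" by (auto simp: gsym_gens_def)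
  have "(SOME z. z \<in> T n X) \<in> T n X" using T[OF g(2,3)] by (simp add: some_in_eq)
  then show "(case g of (n, X) \<Rightarrow> SOME z. z \<in> T n X) \<in> U" using T[OF g(2,3)] g(1) by auto
qed

lemma gsym_add:
  assumes "Q \<in> gsym N K" "Q' \<in> gsym N K"
  shows "Q + Q' \<in> gsym N K"
proof -
  obtain x y where Q: "Q = x +o gsym_ideal N K" "Q' = y +o gsym_ideal N K"
    and xy: "x \<in> words_over (gsym_gens N K)" "y \<in> words_over (gsym_gens N K)"
    using assms by (auto simp: gsym_def words_over_def)
  have "Q + Q' = (x + y) +o gsym_ideal N K"
    unfolding Q by (rule psmul.coset_add) (simp add: gsym_ideal_def subspace_ideal_gen)
  moreover have "x + y \<in> words_over (gsym_gens N K)" using xy by (rule words_over_closed)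
  ultimately show ?thesis unfolding gsym_def words_over_def by blast
qed

lemma gsym_scale:
  assumes "Q \<in> gsym N K"
  shows "(\<Union>x\<in>Q. psmul c x +o gsym_ideal N K) \<in> gsym N K"
proof -
  obtain x where Q: "Q = x +o gsym_ideal N K" and x: "x \<in> words_over (gsym_gens N K)"
    using assms by (auto simp: gsym_def words_over_def)
  have "(\<Union>x\<in>Q. psmul c x +o gsym_ideal N K) = psmul c x +o gsym_ideal N K"
    unfolding Q gsym_ideal_def
    by (rule psmul.UN_coset) (simp_all add: subspace_ideal_gen ideal_gen_closed psmul.scale_right_distrib)
  moreover have "psmul c x \<in> words_over (gsym_gens N K)" using x by (rule words_over_closed)
  ultimately show ?thesis unfolding gsym_def words_over_def by blast
qed

text \<open>
  Likewise the relations of the tensor product only involve pairs from the two factors.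
\<close>

lemma tensor_representative:
  fixes I :: "('x \<Rightarrow>\<^sub>0 'k::field) set" and J :: "('y \<Rightarrow>\<^sub>0 'k) set"
  assumes U: "\<And>a a'. a \<in> U \<Longrightarrow> a' \<in> U \<Longrightarrow> a + a' \<in> U" "\<And>c a. a \<in> U \<Longrightarrow> (\<Union>x\<in>a. psmul c x +o I) \<in> U"
    and V: "\<And>b b'. b \<in> V \<Longrightarrow> b' \<in> V \<Longrightarrow> b + b' \<in> V" "\<And>c b. b \<in> V \<Longrightarrow> (\<Union>y\<in>b. psmul c y +o J) \<in> V"
    and Q: "Q \<in> tensor I U J V"
  shows "Poly_Mapping.keys (SOME q. q \<in> Q) \<subseteq> U \<times> V"
proof -
  define S :: "(('x \<Rightarrow>\<^sub>0 'k) set \<times> ('y \<Rightarrow>\<^sub>0 'k) set \<Rightarrow>\<^sub>0 'k) set"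
    where "S = {x. Poly_Mapping.keys x \<subseteq> U \<times> V}"
  have S: "psmul.subspace S" unfolding S_def by (rule subspace_keys_subset)
  have basis: "basis_vec (a, b) \<in> S" if "a \<in> U" "b \<in> V" for a b
    using that by (simp add: S_def)
  have "tensor_rel I U J V \<subseteq> S"
    unfolding tensor_rel_def
    by (rule psmul.span_minimal[OF _ S])
      (auto intro!: psmul.subspace_diff[OF S] psmul.subspace_scale[OF S] basis U V)
  moreover obtain x where x: "Q = x +o tensor_rel I U J V" "x \<in> S"
    using Q by (auto simp: tensor_def S_def)
  moreover have "0 \<in> tensor_rel I U J V"
    unfolding tensor_rel_def by (rule psmul.span_zero)
  then have "x \<in> Q" unfolding x(1) elt_set_plus_def by force
  then have "(SOME q. q \<in> Q) \<in> Q" by (rule someI)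
  then obtain r where "(SOME q. q \<in> Q) = x + r" "r \<in> tensor_rel I U J V"
    unfolding x(1) elt_set_plus_def by blast
  ultimately show ?thesis using psmul.subspace_add[OF S, of x r] by (auto simp: S_def)
qed

theorem proposition4p1:
  fixes scA :: "'k::field_char_0 \<Rightarrow> 'a::ring \<Rightarrow> 'a" and e :: 'a
    and R :: "('k, 'r::ring) dga" and p :: "'r \<Rightarrow> 'a"
    and scV :: "'k \<Rightarrow> 'v::ab_group_add \<Rightarrow> 'v" and E :: "'v set"
  assumes "unital_algebra scA e"
    and "almost_free_resolution R (in_degree_0 scA e) p"
    and "finite_dimensional_vector_space scV E"
    and "\<exists>v::'v. v \<noteq> 0"
  shows "Lambda_Tr R (in_degree_0 scA e) p E ` Lambda_HC (in_degree_0 scA e)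
           \<subseteq> GL_invariants scV E R \<and>
         Tr_bar R (in_degree_0 scA e) p E ` Sym_tensor_Lambda (in_degree_0 scA e)
           \<subseteq> GL_invariants scV E R"
proof -
  interpret V: finite_dimensional_vector_space scV E by fact
  interpret degree_0_resolution R E scA e p
    using assms(1,2) V.finite_Basis
    by (simp add: degree_0_resolution_def degree_0_resolution_axioms_def representation_algebra_def
        representation_algebra_axioms_def almost_free_resolution_def)
  note subalgebra = subspace_invariant_cycles invariant_cycles_one invariant_cycles_mult
  note inv_class = invariant_cycle_class[OF representation_algebra_axioms assms(3)]
  have cyclic: "cyclic_trace R A p E n X \<subseteq> invariant_cycles \<and> cyclic_trace R A p E n X \<noteq> {}"
    if "X \<in> homology (cyclic_cx A) n" for n X
    using that trace_0_invariant reduced_trace_invariant by (cases "n = 0") (simp_all add: cyclic_trace_def)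
  have "Lambda_Tr R A p E Q \<in> GL_invariants scV E R" if Q: "Q \<in> Lambda_HC A" for Q
    unfolding Lambda_Tr_def
    by (intro inv_class gsym_ext_rep_in_subalgebra[OF subalgebra cyclic linear_complex_cyclic_cx Q[unfolded Lambda_HC_def]])
  moreover have "Tr_bar R A p E Q \<in> GL_invariants scV E R" if Q: "Q \<in> Sym_tensor_Lambda A" for Q
    unfolding Tr_bar_def
  proof (intro inv_class lext_in_subspace[OF subspace_invariant_cycles])
    fix w assume w: "w \<in> Poly_Mapping.keys (SOME q. q \<in> Q)"
    obtain a b where ab: "w = (a, b)" by (cases w)
    have "Poly_Mapping.keys (SOME q. q \<in> Q) \<subseteq> gsym {0} (cyclic_cx A) \<times> gsym {1..} (reduced_cyclic_cx A)"
      using gsym_add gsym_scale gsym_add gsym_scale Q[unfolded Sym_tensor_Lambda_def] by (rule tensor_representative)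
    then have a: "a \<in> gsym {0} (cyclic_cx A)" and b: "b \<in> gsym {1..} (reduced_cyclic_cx A)"
      using w ab by auto
    have "gsym_ext_rep (\<lambda>_. trace_0 R A p E) a \<in> invariant_cycles"
      using trace_0_invariant
      by (intro gsym_ext_rep_in_subalgebra[OF subalgebra _ linear_complex_cyclic_cx a]) auto
    moreover have "gsym_ext_rep (reduced_trace R p E) b \<in> invariant_cycles"
      by (rule gsym_ext_rep_in_subalgebra[OF subalgebra _ linear_complex_reduced_cyclic_cx b])
        (assumption | simp add: reduced_trace_invariant Suc_le_eq)+
    ultimately show "(case w of (a, b) \<Rightarrow> gsym_ext_rep (\<lambda>_. trace_0 R A p E) a * gsym_ext_rep (reduced_trace R p E) b) \<in> invariant_cycles"
      unfolding ab prod.case by (rule invariant_cycles_mult)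
  qed
  ultimately show ?thesis by blast
qed

end
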